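(* Let $\Phi$ be a hidden point process and $\Xi$ the measurement point process obtained from it by independent detection with constant probability $p_d\in(0,1]$, independent displacement with density $l_d(\cdot\mid x)$, and superposition with an independent Poisson clutter process with intensity function $l_c$, as described in the context; put $q_d=1-p_d$ and $\tilde l_d(z\mid x)=p_d\,l_d(z\mid x)$. Let $m\ge0$. For $\nu^{\otimes m}$-almost every $z_{1:m}=(z_1,\dots,z_m)\in\Lambda^m$ with $j^{(m)}_\Xi(z_{1:m})>0$, the second-order conditional factorial moment measure of $\Phi$ given $\Xi=z_{1:m}$ has density with respect to $\nu(dx)\nu(dy)$ given, for $x,y\in\Lambda$, $x\ne y$, by $$\rho^{(2)}_{\Phi\mid\Xi=z_{1:m}}(x,y)=q_d^2\,l^{(2)}_{z_{1:m}}(x,y)+q_d\sum_{r=1}^m\big(\tilde l_d(z_r\mid x)+\tilde l_d(z_r\mid y)\big)\,l^{(2)}_{z_{1:m}}(x,y;z_r)+\sum_{\substack{r,u=1\\ r\ne u}}^m\tilde l_d(z_r\mid x)\,\tilde l_d(z_u\mid y)\,l^{(2)}_{z_{1:m}}(x,y;z_r,z_u),$$ where $$l^{(2)}_{z_{1:m}}(x,y):=\frac{\Upsilon^{(2)}_{z_{1:m}}(x,y)}{j^{(m)}_\Xi(z_{1:m})},\qquad l^{(2)}_{z_{1:m}}(x,y;z_r):=\frac{\Upsilon^{(2)}_{z_{1:m}\setminus z_r}(x,y)}{j^{(m)}_\Xi(z_{1:m})},\qquad l^{(2)}_{z_{1:m}}(x,y;z_r,z_u):=\frac{\Upsilon^{(2)}_{z_{1:m}\setminus\{z_r,z_u\}}(x,y)}{j^{(m)}_\Xi(z_{1:m})},$$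 and, for any $k\ge0$ and any $w_{1:k}=(w_1,\dots,w_k)\in\Lambda^k$, $$\Upsilon^{(2)}_{w_{1:k}}(x,y):=\sum_{p\ge0}\ \sum_{\substack{S\subset\{1,\dots,k\}\\|S|\le p}}\frac{q_d^{\,p-|S|}}{(p-|S|)!}\prod_{j\in\{1,\dots,k\}\setminus S}l_c(w_j)\int_{\Lambda^p}j^{(p+2)}_\Phi(x_1,\dots,x_p,x,y)\prod_{i=1}^{|S|}\tilde l_d(w_{s_i}\mid x_i)\,\nu(dx_1)\cdots\nu(dx_p),$$ with $s_1<\dots<s_{|S|}$ the elements of $S$.
   Context: Setting. $\Lambda$ is a relatively compact (Borel) subset of $\mathbb R^d$ and $\nu$ is a Radon reference measure. $\Phi$ is a simple finite point process on $\Lambda$ having Janossy densities $j^{(n)}_\Phi:\Lambda^n\to[0,\infty)$, $n\ge 0$, with respect to $\nu$: symmetric measurable functions such that for all measurable $F\ge 0$ on finite configurations, $E[F(\Phi)]=F(\emptyset)j^{(0)}_\Phi+\sum_{n\ge1}\frac1{n!}\int_{\Lambda^n}F(\{x_1,\dots,x_n\})j^{(n)}_\Phi(x_1,\dots,x_n)\,\nu(dx_1)\cdots\nu(dx_n)$. Measurement process. For each $x\in\Lambda$, $l_d(\cdot\mid x)$ is a probability density on $\Lambda$ with respect to $\nu$, jointly measurable in $(z,x)$. Given $\Phi$, each point $x\in\Phi$ is, independently of the other points, kept with probability $p_d$ and then moved to a random location with density $l_d(\cdot\mid x)$, or deleted with probability $q_d=1-p_d$. $\Xi$ is the superposition of the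 resulting points and of a Poisson point process on $\Lambda$ (clutter), independent of everything else, with intensity function $l_c\ge0$ with respect to $\nu$, $\int_\Lambda l_c\,d\nu<\infty$. Notation. $j^{(m)}_\Xi$ denotes the function $$j^{(m)}_\Xi(z_{1:m})=\sum_{n\ge0}\ \sum_{\substack{S\subset\{1,\dots,m\}\\|S|\le n}}\prod_{j\in\{1,\dots,m\}\setminus S}l_c(z_j)\frac{q_d^{\,n-|S|}}{(n-|S|)!}\int_{\Lambda^n}j^{(n)}_\Phi(x_1,\dots,x_n)\prod_{i=1}^{|S|}\tilde l_d(z_{s_i}\mid x_i)\,\nu(dx_1)\cdots\nu(dx_n),$$ with $s_1<\dots<s_{|S|}$ the elements of $S$ (up to the constant factor $e^{-\int_\Lambda l_c d\nu}$ this is the $m$-th Janossy density of $\Xi$ with respect to $\nu^{\otimes m}$). $z_{1:m}\setminus z_r$ and $z_{1:m}\setminus\{z_r,z_u\}$ denote the sequence $(z_1,\dots,z_m)$ with the indicated entries omitted. The second-order conditional factorial moment density is defined by $E\big[\sum_{x,y\in\Phi,\,x\ne y}\mathbf 1_A(x)\mathbf 1_B(y)\,\big|\,\Xi=z_{1:m}\big]=\int_{A\times B}\rho^{(2)}_{\Phi\mid\Xi=z_{1:m}}(x,y)\,\nu(dx)\nu(dy)$ for measurable $A,B\subset\Lambda$ (with $\rho^{(2)}(x,x)=0$), under a regular conditional distribution of $\Phi$ given $\Xi$. Values in $[0,\infty]$ are allowed; the density identity is understood almost everywhere. Empty products equal $1$, empty sums $0$, and $0^0=1$. *)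

theory Defs
  imports "HOL-Probability.Probability" "HOL-Library.Multiset"
begin

section \<open>Finite point configurations\<close>

text \<open>
  Throughout, \<open>N\<close> is the reference measure restricted to the observation window, so that
  \<open>space N\<close> is the window. A finite configuration is a finite multiset: the reference measure may
  have atoms, and then displaced points and clutter can coincide with positive probability.
  Simplicity of the hidden process is a separate almost-sure condition.
\<close>

definition points_in :: "'a set \<Rightarrow> 'a multiset \<Rightarrow> nat" where
  "points_in B \<phi> = size {# x \<in># \<phi>. x \<in> B #}"

definition config_space :: "'a measure \<Rightarrow> 'a multiset measure" where
  "config_space N = sigma {\<phi>. set_mset \<phi> \<subseteq> space N}
     {{\<phi>. set_mset \<phi> \<subseteq> space N \<and> points_in B \<phi> = k} | B k. B \<in> sets N}"

definition simple_config :: "'a multiset \<Rightarrow> bool" where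
  "simple_config \<phi> \<longleftrightarrow> (\<forall>x. count \<phi> x \<le> 1)"

text \<open>
  A family of Janossy densities is one function \<open>j\<close> on lists whose restriction to lists of length
  \<open>n\<close> is the \<open>n\<close>-th density. The term \<open>n = 0\<close> of the expansion is \<open>F {#} * j []\<close>, because the
  empty product measure is the point mass at the empty tuple.
\<close>

definition janossy_densities :: "'a measure \<Rightarrow> 'a multiset measure \<Rightarrow> ('a list \<Rightarrow> real) \<Rightarrow> bool" where
  "janossy_densities N P j \<longleftrightarrow>
     (\<forall>xs. set xs \<subseteq> space N \<longrightarrow> 0 \<le> j xs) \<and>
     (\<forall>xs ys. set xs \<subseteq> space N \<and> mset xs = mset ys \<longrightarrow> j xs = j ys) \<and>
     (\<forall>n. (\<lambda>x. j (map x [0..<n])) \<in> borel_measurable (PiM {..<n} (\<lambda>_. N))) \<and>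
     (\<forall>F :: 'a multiset \<Rightarrow> ennreal. F \<in> borel_measurable (config_space N) \<longrightarrow>
        (\<integral>\<^sup>+ \<phi>. F \<phi> \<partial>P) =
          (\<Sum>n. ennreal (1 / fact n) *
             (\<integral>\<^sup>+ x. F (mset (map x [0..<n])) * ennreal (j (map x [0..<n])) \<partial>PiM {..<n} (\<lambda>_. N))))"

text \<open>The law \<open>P\<close> of a Poisson process with integrable intensity function \<open>lc\<close>.\<close>

definition poisson_process :: "'a measure \<Rightarrow> ('a \<Rightarrow> real) \<Rightarrow> 'a multiset measure \<Rightarrow> bool" where
  "poisson_process N lc P \<longleftrightarrow>
     prob_space P \<and> sets P = sets (config_space N) \<and>
     (\<forall>B\<in>sets N. \<forall>k. measure P {\<xi> \<in> space P. points_in B \<xi> = k} =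
        exp (- (LINT x:B|N. lc x)) * (LINT x:B|N. lc x) ^ k / fact k) \<and>
     (\<forall>(I :: nat set) B. finite I \<and> B ` I \<subseteq> sets N \<and> disjoint_family_on B I \<longrightarrow>
        prob_space.indep_vars P (\<lambda>_. count_space UNIV) (\<lambda>i. points_in (B i)) I)"

section \<open>Conditioning and the measurement mechanism\<close>

text \<open>\<open>K\<close> is a regular conditional distribution of \<open>Y\<close> given \<open>X\<close>.\<close>

definition regular_cond_distr ::
    "'w measure \<Rightarrow> 'b measure \<Rightarrow> ('w \<Rightarrow> 'b) \<Rightarrow> 'c measure \<Rightarrow> ('w \<Rightarrow> 'c) \<Rightarrow> ('b \<Rightarrow> 'c measure) \<Rightarrow> bool" where
  "regular_cond_distr M MX X MY Y K \<longleftrightarrow>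
     K \<in> measurable MX (prob_algebra MY) \<and>
     (\<forall>A\<in>sets MX. \<forall>B\<in>sets MY.
        emeasure M {\<omega> \<in> space M. X \<omega> \<in> A \<and> Y \<omega> \<in> B} =
        (\<integral>\<^sup>+ \<omega>. emeasure (K (X \<omega>)) B * indicator A (X \<omega>) \<partial>M))"

text \<open>
  The outcome of observing a single point \<open>x\<close>: a displaced copy with probability \<open>pd\<close>, otherwise
  nothing. Here \<open>ld z x\<close> is the displacement density at \<open>z\<close> given \<open>x\<close>.
\<close>

definition obs_point :: "'a measure \<Rightarrow> real \<Rightarrow> ('a \<Rightarrow> 'a \<Rightarrow> real) \<Rightarrow> 'a \<Rightarrow> 'a multiset measure" where
  "obs_point N pd ld x = measure_pmf (bernoulli_pmf pd) \<bind>
     (\<lambda>kept. if kept then distr (density N (\<lambda>z. ennreal (ld z x))) (config_space N) (\<lambda>z. {#z#})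
             else return (config_space N) {#})"

text \<open>
  Independent observations of all points of \<open>\<phi>\<close>. The points of a multiset are indexed by pairs
  \<open>(x, k)\<close> with \<open>k < count \<phi> x\<close>.
\<close>

definition obs_config :: "'a measure \<Rightarrow> real \<Rightarrow> ('a \<Rightarrow> 'a \<Rightarrow> real) \<Rightarrow> 'a multiset \<Rightarrow> 'a multiset measure" where
  "obs_config N pd ld \<phi> =
     (let I = (SIGMA x:set_mset \<phi>. {..<count \<phi> x})
      in distr (PiM I (\<lambda>(x, k). obs_point N pd ld x)) (config_space N) (\<lambda>\<omega>. \<Sum>i\<in>I. \<omega> i))"

section \<open>The densities\<close>

text \<open>
  Both \<open>j_Xi\<close> and \<open>Upsilon2\<close> are instances of one sum over the number \<open>n\<close> of hidden points
  and the set \<open>S\<close> of (zero-based) positions of those entries of \<open>w\<close> that come from hidden points.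
  \<open>nths w S\<close> lists the entries of \<open>w\<close> with position in \<open>S\<close> in increasing order of position.
\<close>

definition assoc_sum ::
    "'a measure \<Rightarrow> real \<Rightarrow> ('a \<Rightarrow> 'a \<Rightarrow> real) \<Rightarrow> ('a \<Rightarrow> real) \<Rightarrow> ('a list \<Rightarrow> real) \<Rightarrow> 'a list \<Rightarrow> ennreal" where
  "assoc_sum N pd ld lc f w =
     (\<Sum>n. \<Sum>S | S \<subseteq> {..<length w} \<and> card S \<le> n.
        ennreal (\<Prod>j\<in>{..<length w} - S. lc (w ! j)) *
        ennreal ((1 - pd) ^ (n - card S) / fact (n - card S)) *
        (\<integral>\<^sup>+ x. ennreal (f (map x [0..<n]) * (\<Prod>i<card S. pd * ld (nths w S ! i) (x i)))
           \<partial>PiM {..<n} (\<lambda>_. N)))"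

definition j_Xi ::
    "'a measure \<Rightarrow> real \<Rightarrow> ('a \<Rightarrow> 'a \<Rightarrow> real) \<Rightarrow> ('a \<Rightarrow> real) \<Rightarrow> ('a list \<Rightarrow> real) \<Rightarrow> 'a list \<Rightarrow> ennreal" where
  "j_Xi N pd ld lc j z = assoc_sum N pd ld lc j z"

definition Upsilon2 ::
    "'a measure \<Rightarrow> real \<Rightarrow> ('a \<Rightarrow> 'a \<Rightarrow> real) \<Rightarrow> ('a \<Rightarrow> real) \<Rightarrow> ('a list \<Rightarrow> real) \<Rightarrow> 'a list \<Rightarrow> 'a \<Rightarrow> 'a \<Rightarrow> ennreal" where
  "Upsilon2 N pd ld lc j w x y = assoc_sum N pd ld lc (\<lambda>xs. j (xs @ [x, y])) w"

text \<open>
  The entries of the measurement sequence \<open>z\<close> at the positions in \<open>R\<close> are omitted from the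
  numerator only.
\<close>

definition l2 ::
    "'a measure \<Rightarrow> real \<Rightarrow> ('a \<Rightarrow> 'a \<Rightarrow> real) \<Rightarrow> ('a \<Rightarrow> real) \<Rightarrow> ('a list \<Rightarrow> real) \<Rightarrow> 'a list \<Rightarrow> nat set \<Rightarrow> 'a \<Rightarrow> 'a \<Rightarrow> ennreal" where
  "l2 N pd ld lc j z R x y = Upsilon2 N pd ld lc j (nths z (- R)) x y / j_Xi N pd ld lc j z"

text \<open>
  \<open>\<rho>\<close> is a density with respect to \<open>N \<Otimes>\<^sub>M N\<close> of the second factorial moment measure of a
  (simple) point process with law \<open>P\<close>.
\<close>

definition second_factorial_density ::
    "'a measure \<Rightarrow> 'a multiset measure \<Rightarrow> ('a \<Rightarrow> 'a \<Rightarrow> ennreal) \<Rightarrow> bool" where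
  "second_factorial_density N P \<rho> \<longleftrightarrow>
     (\<lambda>(x, y). \<rho> x y) \<in> borel_measurable (N \<Otimes>\<^sub>M N) \<and>
     (\<forall>A\<in>sets N. \<forall>B\<in>sets N.
        (\<integral>\<^sup>+ \<phi>. (\<Sum>x\<in>#\<phi>. \<Sum>y\<in>#\<phi>. if x \<noteq> y then indicator A x * indicator B y else 0) \<partial>P) =
        (\<integral>\<^sup>+ (x, y). \<rho> x y * indicator (A \<times> B) (x, y) \<partial>(N \<Otimes>\<^sub>M N)))"

end

theory Submission
  imports Defs
begin

text \<open>
  For a function \<open>F\<close> on lists of hidden points, the sum \<open>J F z\<close> over all associations satisfies a
  recursion on the list \<open>z\<close> of measurements: the first measurement is either clutter or is linked to
  an additional hidden point, which is then integrated out. Two consequences drive the proof.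

  First, integrated against \<open>\<Prod>\<^sub>i f (z\<^sub>i)\<close> over all measurements, the sums
  \<open>J (\<one>\<^sub>E j)\<close> reproduce the generating functional of \<open>\<Xi>\<close> on the event \<open>\<Phi> \<in> E\<close>; generating functionals
  determine laws on configurations, so Bayes' formula follows: \<open>K z E = J (\<one>\<^sub>E j) z / J j z\<close> for
  almost every \<open>z\<close>. As \<open>K\<close> and the law of \<open>\<Xi>\<close> only see unordered configurations, this step ends with
  two symmetric densities that agree on unordered events, and polarization identifies them.

  Second, by induction on the measurements, a sum over one hidden point \<open>x\<close> inside an association sum
  turns into an integral over \<open>x\<close>, in which \<open>x\<close> was either missed (factor \<open>q\<close>) or is
  responsible for exactly one measurement, which is then removed. Applied twice to the sum over
  ordered pairs of distinct hidden points this gives the three terms of the density.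
\<close>

section \<open>Series\<close>

text \<open>Tuples of all lengths occur together, so lists carry one sigma-algebra and each series
  with factorial weights is an integral against a single measure on lists; with values in
  \<open>ennreal\<close>, every interchange is then Tonelli. Linking a measurement fixes a hidden
  point, and for this reason the recursion runs over arbitrary functions of the hidden list, with
  the fixed points as leading entries, and not over the one family \<open>j\<close>. A conditional
  distribution is determined only up to a null set that depends on the event. A countable
  intersection-stable generator of the configuration sigma-algebra yields a common null set, and
  outside it all further steps concern one fixed sequence of measurements. Until the last step
  Bayes' formula is kept without division, so the sequences of density 0 need no separate treatment.
  Generating functionals are tested on simple functions with values at most 1: for these the product
  over the points depends on finitely many counts, so it is measurable, and its expectation under
  the clutter follows from the Poisson counts on the level sets.\<close>

lemma suminf_commute_ennreal:
  fixes f :: "nat \<Rightarrow> nat \<Rightarrow> ennreal"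
  shows "(\<Sum>i. \<Sum>n. f i n) = (\<Sum>n. \<Sum>i. f i n)"
  using nn_integral_suminf[of f "count_space UNIV"] by (simp add: nn_integral_count_space_nat)

lemma suminf_shift_ennreal:
  fixes f :: "nat \<Rightarrow> ennreal"
  shows "(\<Sum>n. if s \<le> n then f n else 0) = (\<Sum>n. f (n + s))"
  by (subst suminf_offset[where i = s]) auto

lemma suminf_triangle_ennreal:
  fixes g :: "nat \<Rightarrow> nat \<Rightarrow> ennreal"
  shows "(\<Sum>m. \<Sum>d\<le>m. g d (m - d)) = (\<Sum>d. \<Sum>k. g d k)"
proof -
  have "(\<Sum>m. \<Sum>d\<le>m. g d (m - d)) = (\<Sum>m. \<Sum>d. if d \<le> m then g d (m - d) else 0)"
  proof (rule suminf_cong)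
    fix m
    show "(\<Sum>d\<le>m. g d (m - d)) = (\<Sum>d. if d \<le> m then g d (m - d) else 0)"
      by (subst suminf_finite[where N = "{..m}"]) auto
  qed
  also have "\<dots> = (\<Sum>d. \<Sum>m. if d \<le> m then g d (m - d) else 0)"
    by (rule suminf_commute_ennreal)
  finally show ?thesis
    by (simp add: suminf_shift_ennreal)
qed

text \<open>As \<open>t\<close> tends to 0 only the constant terms survive: for
  \<open>t \<le> 1\<close> the other terms on the right are at most \<open>t\<close> times the
  finite total of \<open>b\<close>. A limit is taken because in the next lemma the two series agree
  only after division by \<open>t ^ n\<close>, that is for \<open>0 < t\<close>.\<close>

lemma power_series_ennreal_le:
  fixes a b :: "nat \<Rightarrow> ennreal"
  assumes fin: "(\<Sum>n. b n) \<noteq> \<top>"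
    and le: "\<And>t. 0 < t \<Longrightarrow> t \<le> 1 \<Longrightarrow> (\<Sum>n. a n * ennreal t ^ n) \<le> (\<Sum>n. b n * ennreal t ^ n)"
  shows "a 0 \<le> b 0"
proof (rule ennreal_le_epsilon)
  fix e :: real assume e: "0 < e"
  obtain C where C: "(\<Sum>n. b n) = ennreal C" "0 \<le> C"
    using fin by (metis ennreal_cases infinity_ennreal_def)
  \<comment> \<open>Any \<open>t \<le> 1\<close> with \<open>t * C \<le> e\<close> serves;
    \<open>C + 1\<close> in place of \<open>C\<close> avoids division by 0.\<close>
  define t where "t = min 1 (e / (C + 1))"
  have t: "0 < t" "t \<le> 1"
    using e C by (auto simp: t_def)
  have "a 0 \<le> (\<Sum>n. a n * ennreal t ^ n)"
    using sum_le_suminf[of "\<lambda>n. a n * ennreal t ^ n" "{0}"] by simp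
  also have "\<dots> \<le> (\<Sum>n. b n * ennreal t ^ n)"
    using t by (rule le)
  also have "\<dots> = b 0 + (\<Sum>n. b (Suc n) * ennreal t ^ Suc n)"
    by (subst suminf_offset[where i = 1]) (auto simp: add.commute)
  also have "(\<Sum>n. b (Suc n) * ennreal t ^ Suc n) \<le> (\<Sum>n. ennreal t * b (Suc n))"
  proof (rule suminf_le)
    fix n
    have "ennreal t ^ n \<le> 1"
      using t by (simp add: ennreal_power power_le_one)
    then have "b (Suc n) * ennreal t * ennreal t ^ n \<le> b (Suc n) * ennreal t * 1"
      by (rule mult_left_mono) simp
    then show "b (Suc n) * ennreal t ^ Suc n \<le> ennreal t * b (Suc n)"
      by (simp add: mult_ac)
  qed auto
  also have "\<dots> \<le> ennreal t * (\<Sum>n. b n)"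
    unfolding ennreal_suminf_cmult by (intro mult_left_mono) (subst (2) suminf_offset[where i = 1], auto)
  also have "\<dots> \<le> ennreal e"
  proof -
    have "t * C \<le> e / (C + 1) * (C + 1)"
      using t C e by (intro mult_mono) (auto simp: t_def)
    then have "t * C \<le> e" using C by simp
    then show ?thesis
      using C t by (simp add: ennreal_mult[symmetric] ennreal_leI)
  qed
  finally show "a 0 \<le> b 0 + ennreal e"
    by (simp add: add_left_mono)
qed

text \<open>Strong induction: the terms below \<open>n\<close> agree and have a finite sum, so they
  cancel in extended arithmetic; dividing by \<open>t ^ n\<close> then makes \<open>a n\<close> and
  \<open>b n\<close> the constant terms.\<close>

lemma power_series_ennreal_unique:
  fixes a b :: "nat \<Rightarrow> ennreal"
  assumes a: "(\<Sum>n. a n) \<noteq> \<top>" and b: "(\<Sum>n. b n) \<noteq> \<top>"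
    and eq: "\<And>t. 0 < t \<Longrightarrow> t \<le> 1 \<Longrightarrow> (\<Sum>n. a n * ennreal t ^ n) = (\<Sum>n. b n * ennreal t ^ n)"
  shows "a n = b n"
proof (induction n rule: less_induct)
  case (less n)
  have split: "(\<Sum>k. f k * ennreal t ^ k) = ennreal t ^ n * (\<Sum>k. f (k + n) * ennreal t ^ k) + (\<Sum>k<n. f k * ennreal t ^ k)"
    for f :: "nat \<Rightarrow> ennreal" and t
    by (subst suminf_offset[where i = n])
       (auto simp: power_add mult_ac ennreal_suminf_cmult[symmetric] simp del: ennreal_suminf_cmult)
  have tail: "(\<Sum>k. f (k + n)) \<noteq> \<top>" if "(\<Sum>k. f k) \<noteq> \<top>" for f :: "nat \<Rightarrow> ennreal"
    using that by (subst (asm) suminf_offset[where i = n]) auto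
  have "(\<Sum>k. a (k + n) * ennreal t ^ k) = (\<Sum>k. b (k + n) * ennreal t ^ k)" if t: "0 < t" "t \<le> 1" for t
  proof -
    have "(\<Sum>k<n. b k * ennreal t ^ k) \<le> (\<Sum>k. b k)"
    proof -
      have "(\<Sum>k<n. b k * ennreal t ^ k) \<le> (\<Sum>k<n. b k * 1)"
        using t by (intro sum_mono mult_left_mono) (auto simp: ennreal_power power_le_one)
      also have "\<dots> \<le> (\<Sum>k. b k)"
        using sum_le_suminf[of b "{..<n}"] by simp
      finally show ?thesis .
    qed
    then have fin: "(\<Sum>k<n. b k * ennreal t ^ k) \<noteq> \<top>"
      by (rule neq_top_trans[OF b])
    have "(\<Sum>k<n. a k * ennreal t ^ k) = (\<Sum>k<n. b k * ennreal t ^ k)"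
      using less by simp
    then have "(\<Sum>k<n. b k * ennreal t ^ k) + ennreal t ^ n * (\<Sum>k. a (k + n) * ennreal t ^ k) =
        (\<Sum>k<n. b k * ennreal t ^ k) + ennreal t ^ n * (\<Sum>k. b (k + n) * ennreal t ^ k)"
      using eq[OF t] unfolding split[of a] split[of b] by (simp only: add.commute)
    then have "ennreal t ^ n * (\<Sum>k. a (k + n) * ennreal t ^ k) = ennreal t ^ n * (\<Sum>k. b (k + n) * ennreal t ^ k)"
      using fin by (simp only: ennreal_add_left_cancel simp_thms infinity_ennreal_def)
    then show ?thesis
      using t by (simp add: ennreal_mult_cancel_left ennreal_power)
  qed
  then have "a (0 + n) \<le> b (0 + n)" "b (0 + n) \<le> a (0 + n)"
    using tail[OF a] tail[OF b]
    by (auto intro!: power_series_ennreal_le[where a = "\<lambda>k. a (k + n)" and b = "\<lambda>k. b (k + n)", simplified]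
      power_series_ennreal_le[where a = "\<lambda>k. b (k + n)" and b = "\<lambda>k. a (k + n)", simplified])
  then show ?case by simp
qed

section \<open>The measurable space of finite lists\<close>

text \<open>This is the final sigma-algebra of the maps that send an \<open>n\<close>-tuple to its
  list, so the space is the disjoint union of all finite powers. Measurability of a function of one
  list can then be tested for each length separately.\<close>

definition list_space :: "'a measure \<Rightarrow> 'a list measure" where
  "list_space N = sigma (lists (space N))
     {A. A \<subseteq> lists (space N) \<and>
         (\<forall>n. {x \<in> space (PiM {..<n} (\<lambda>_. N)). map x [0..<n] \<in> A} \<in> sets (PiM {..<n} (\<lambda>_. N)))}"

lemma space_list_space: "space (list_space N) = lists (space N)"
  unfolding list_space_def by (rule space_measure_of) auto

lemma map_upt_in_lists: "x \<in> space (PiM {..<n} (\<lambda>_. N)) \<Longrightarrow> map x [0..<n] \<in> lists (space N)"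
  by (auto simp: space_PiM PiE_iff)

lemma sets_list_space:
  "sets (list_space N) = {A. A \<subseteq> lists (space N) \<and>
     (\<forall>n. {x \<in> space (PiM {..<n} (\<lambda>_. N)). map x [0..<n] \<in> A} \<in> sets (PiM {..<n} (\<lambda>_. N)))}"
    (is "_ = ?S")
proof -
  have "sigma_algebra (lists (space N)) ?S"
    unfolding sigma_algebra_iff2
  proof safe
    fix A n
    assume A: "\<forall>n. {x \<in> space (PiM {..<n} (\<lambda>_. N)). map x [0..<n] \<in> A} \<in> sets (PiM {..<n} (\<lambda>_. N))"
    have "{x \<in> space (PiM {..<n} (\<lambda>_. N)). map x [0..<n] \<in> lists (space N) - A} =
      space (PiM {..<n} (\<lambda>_. N)) - {x \<in> space (PiM {..<n} (\<lambda>_. N)). map x [0..<n] \<in> A}"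
      using map_upt_in_lists[of _ n N] by blast
    then show "{x \<in> space (PiM {..<n} (\<lambda>_. N)). map x [0..<n] \<in> lists (space N) - A}
      \<in> sets (PiM {..<n} (\<lambda>_. N))"
      using A by auto
  next
    fix A :: "nat \<Rightarrow> 'a list set" and n
    assume A: "range A \<subseteq> ?S"
    have eq: "{x \<in> space (PiM {..<n} (\<lambda>_. N)). map x [0..<n] \<in> (\<Union>i. A i)} =
      (\<Union>i. {x \<in> space (PiM {..<n} (\<lambda>_. N)). map x [0..<n] \<in> A i})"
      by blast
    have "range (\<lambda>i. {x \<in> space (PiM {..<n} (\<lambda>_. N)). map x [0..<n] \<in> A i}) \<subseteq> sets (PiM {..<n} (\<lambda>_. N))"
      using A by blast
    then show "{x \<in> space (PiM {..<n} (\<lambda>_. N)). map x [0..<n] \<in> (\<Union>i. A i)} \<in> sets (PiM {..<n} (\<lambda>_. N))"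
      unfolding eq by (rule sets.countable_UN)
  qed auto
  then show ?thesis
    unfolding list_space_def
    by (subst sets_measure_of) (auto simp: sigma_algebra.sigma_sets_eq)
qed

lemma measurable_map_upt [measurable]:
  "(\<lambda>x. map x [0..<n]) \<in> measurable (PiM {..<n} (\<lambda>_. N)) (list_space N)"
proof (rule measurableI)
  show "(\<lambda>x. map x [0..<n]) -` A \<inter> space (PiM {..<n} (\<lambda>_. N)) \<in> sets (PiM {..<n} (\<lambda>_. N))"
    if "A \<in> sets (list_space N)" for A
    using that by (auto simp: sets_list_space vimage_def Int_def conj_commute)
qed (auto simp: space_list_space space_PiM PiE_iff)

lemma list_space_setI:
  assumes "A \<subseteq> lists (space N)"
    and "\<And>n. {x \<in> space (PiM {..<n} (\<lambda>_. N)). map x [0..<n] \<in> A} \<in> sets (PiM {..<n} (\<lambda>_. N))"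
  shows "A \<in> sets (list_space N)"
  using assms by (auto simp: sets_list_space)

lemma sets_list_space_length: "{xs \<in> space (list_space N). length xs = n} \<in> sets (list_space N)"
proof (rule list_space_setI)
  fix k
  have eq: "{x \<in> space (PiM {..<k} (\<lambda>_. N)). map x [0..<k] \<in> {xs \<in> space (list_space N). length xs = n}} =
    (if k = n then space (PiM {..<k} (\<lambda>_. N)) else {})"
    using map_upt_in_lists[of _ k N] by (auto simp: space_list_space)
  show "{x \<in> space (PiM {..<k} (\<lambda>_. N)). map x [0..<k] \<in> {xs \<in> space (list_space N). length xs = n}}
    \<in> sets (PiM {..<k} (\<lambda>_. N))"
    unfolding eq by auto
qed (auto simp: space_list_space)

lemma measurable_length [measurable]: "length \<in> measurable (list_space N) (count_space UNIV)"
  by (subst measurable_count_space_eq2_countable)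
     (use sets_list_space_length in \<open>auto simp: vimage_def Int_def conj_commute\<close>)

text \<open>On lists of length \<open>n\<close> this inverts the passage from tuples to lists; the
  restriction to \<open>{..<n}\<close> is there because points of a product space are extensional
  functions.\<close>

lemma measurable_nths_restrict:
  "(\<lambda>xs. \<lambda>i\<in>{..<n}. xs ! i)
     \<in> measurable (restrict_space (list_space N) {xs. length xs = n}) (PiM {..<n} (\<lambda>_. N))"
proof (rule measurable_restrict)
  fix i assume i: "i \<in> {..<n}"
  have "{xs \<in> lists (space N). length xs = n \<and> xs ! i \<in> A} \<in> sets (list_space N)"
    if A: "A \<in> sets N" for A
  proof (rule list_space_setI)
    fix k
    have eq: "{x \<in> space (PiM {..<k} (\<lambda>_. N)). map x [0..<k] \<in> {xs \<in> lists (space N). length xs = n \<and> xs ! i \<in> A}}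
      = (if k = n then {x \<in> space (PiM {..<k} (\<lambda>_. N)). x i \<in> A} else {})"
      using i by (auto simp: space_PiM PiE_iff)
    show "{x \<in> space (PiM {..<k} (\<lambda>_. N)). map x [0..<k] \<in> {xs \<in> lists (space N). length xs = n \<and> xs ! i \<in> A}}
      \<in> sets (PiM {..<k} (\<lambda>_. N))"
      unfolding eq using i A by auto
  qed auto
  then show "(\<lambda>xs. xs ! i) \<in> measurable (restrict_space (list_space N) {xs. length xs = n}) N"
    using i sets_list_space_length[of N n]
    by (intro measurableI)
       (auto simp: space_restrict_space space_list_space sets_restrict_space_iff Int_def vimage_def conj_commute conj_left_commute)
qed

text \<open>A product with a final sigma-algebra need not be final again, so the definition does not
  apply directly to functions with a further parameter. Instead the product is cut into countably
  many measurable pieces according to the length, and on each piece the list is recoded as a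
  tuple.\<close>

lemma measurable_pair_list_space:
  fixes f :: "'b \<times> 'a list \<Rightarrow> 'c"
  assumes "\<And>n. (\<lambda>(b, x). f (b, map x [0..<n])) \<in> measurable (B \<Otimes>\<^sub>M PiM {..<n} (\<lambda>_. N)) P"
  shows "f \<in> measurable (B \<Otimes>\<^sub>M list_space N) P"
proof (rule measurable_piecewise_restrict[where C = "range (\<lambda>n. {p. length (snd p) = n})"])
  fix \<Omega> :: "('b \<times> 'a list) set" assume "\<Omega> \<in> range (\<lambda>n. {p. length (snd p) = n})"
  then obtain n where \<Omega>: "\<Omega> = {p. length (snd p) = n}" by auto
  have "{p \<in> space (B \<Otimes>\<^sub>M list_space N). length (snd p) = n} \<in> sets (B \<Otimes>\<^sub>M list_space N)"
    by measurable
  then show "\<Omega> \<inter> space (B \<Otimes>\<^sub>M list_space N) \<in> sets (B \<Otimes>\<^sub>M list_space N)"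
    unfolding \<Omega> by (simp add: Int_def conj_commute)
  have 1: "(\<lambda>p. (fst p, \<lambda>i\<in>{..<n}. snd p ! i))
     \<in> measurable (restrict_space (B \<Otimes>\<^sub>M list_space N) \<Omega>) (B \<Otimes>\<^sub>M PiM {..<n} (\<lambda>_. N))"
  proof (rule measurable_Pair)
    have "snd \<in> measurable (restrict_space (B \<Otimes>\<^sub>M list_space N) \<Omega>)
       (restrict_space (list_space N) {xs. length xs = n})"
      by (rule measurable_restrict_space3) (auto simp: \<Omega>)
    from measurable_compose[OF this measurable_nths_restrict]
    show "(\<lambda>p. \<lambda>i\<in>{..<n}. snd p ! i) \<in> measurable (restrict_space (B \<Otimes>\<^sub>M list_space N) \<Omega>) (PiM {..<n} (\<lambda>_. N))" .
  qed (auto intro: measurable_restrict_space1)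
  have "(\<lambda>p. (\<lambda>(b, x). f (b, map x [0..<n])) (fst p, \<lambda>i\<in>{..<n}. snd p ! i))
      \<in> measurable (restrict_space (B \<Otimes>\<^sub>M list_space N) \<Omega>) P"
    by (rule measurable_compose[OF 1 assms])
  moreover have "map (\<lambda>i\<in>{..<n}. xs ! i) [0..<n] = xs" if "length xs = n" for xs :: "'a list"
    using that by (intro nth_equalityI) auto
  ultimately show "f \<in> measurable (restrict_space (B \<Otimes>\<^sub>M list_space N) \<Omega>) P"
    by (subst measurable_cong) (auto simp: \<Omega> space_restrict_space case_prod_beta)
qed auto

lemma measurable_list_spaceI:
  assumes "\<And>n. (\<lambda>x. f (map x [0..<n])) \<in> measurable (PiM {..<n} (\<lambda>_. N)) P"
  shows "f \<in> measurable (list_space N) P"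
proof (rule measurableI)
  have "map (\<lambda>i\<in>{..<length xs}. xs ! i) [0..<length xs] = xs" for xs :: "'a list"
    by (intro nth_equalityI) auto
  moreover have "(\<lambda>i\<in>{..<length xs}. xs ! i) \<in> space (PiM {..<length xs} (\<lambda>_. N))"
    if "xs \<in> lists (space N)" for xs
    using that by (auto simp: space_PiM PiE_iff in_lists_conv_set)
  ultimately show "f xs \<in> space P" if "xs \<in> space (list_space N)" for xs
    using measurable_space[OF assms[of "length xs"], of "\<lambda>i\<in>{..<length xs}. xs ! i"] that
    by (simp add: space_list_space)
  fix A assume A: "A \<in> sets P"
  have "{x \<in> space (PiM {..<n} (\<lambda>_. N)). map x [0..<n] \<in> f -` A \<inter> lists (space N)} =
     (\<lambda>x. f (map x [0..<n])) -` A \<inter> space (PiM {..<n} (\<lambda>_. N))" for n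
    using map_upt_in_lists[of _ n N] by blast
  then show "f -` A \<inter> space (list_space N) \<in> sets (list_space N)"
    using measurable_sets[OF assms A] by (intro list_space_setI) (auto simp: space_list_space)
qed

lemma measurable_PiM_Cons:
  "(\<lambda>(x, y). \<lambda>i\<in>{..<Suc n}. case i of 0 \<Rightarrow> x | Suc k \<Rightarrow> y k)
     \<in> measurable (N \<Otimes>\<^sub>M PiM {..<n} (\<lambda>_. N)) (PiM {..<Suc n} (\<lambda>_. N))"
  unfolding case_prod_beta
proof (rule measurable_restrict)
  fix i assume "i \<in> {..<Suc n}"
  then show "(\<lambda>p. case i of 0 \<Rightarrow> fst p | Suc k \<Rightarrow> snd p k) \<in> measurable (N \<Otimes>\<^sub>M PiM {..<n} (\<lambda>_. N)) N"
    by (cases i) auto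
qed

lemma map_upt_Cons:
  "map (\<lambda>i\<in>{..<Suc n}. case i of 0 \<Rightarrow> x | Suc k \<Rightarrow> y k) [0..<Suc n] = x # map y [0..<n]"
  by (simp add: upt_conv_Cons map_Suc_upt[symmetric] del: upt_Suc)

lemma measurable_Cons_pair: "(\<lambda>(x, xs). x # xs) \<in> measurable (N \<Otimes>\<^sub>M list_space N) (list_space N)"
proof (rule measurable_pair_list_space)
  fix n
  show "(\<lambda>(x, y). case (x, map y [0..<n]) of (x, xs) \<Rightarrow> x # xs)
      \<in> measurable (N \<Otimes>\<^sub>M PiM {..<n} (\<lambda>_. N)) (list_space N)"
    using measurable_compose[OF measurable_PiM_Cons measurable_map_upt, of n N]
    by (simp add: case_prod_beta map_upt_Cons del: upt_Suc)
qed

lemma measurable_Cons [measurable (raw)]: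
  assumes "f \<in> measurable B N" "g \<in> measurable B (list_space N)"
  shows "(\<lambda>b. f b # g b) \<in> measurable B (list_space N)"
  using measurable_compose[OF measurable_Pair[OF assms] measurable_Cons_pair] by simp

lemma measurable_Nil [measurable]: "(\<lambda>b. []) \<in> measurable B (list_space N)"
  by (rule measurable_const) (simp add: space_list_space)

lemma measurable_map_list:
  assumes "\<And>w. w \<in> set ws \<Longrightarrow> w \<in> measurable B N" "g \<in> measurable B (list_space N)"
  shows "(\<lambda>b. map (\<lambda>w. w b) ws @ g b) \<in> measurable B (list_space N)"
  using assms by (induction ws) auto

lemma measurable_map_indices:
  assumes "set is \<subseteq> {..<n}"
  shows "(\<lambda>x. map x is) \<in> measurable (PiM {..<n} (\<lambda>_. N)) (list_space N)"
proof -
  have "(\<lambda>x. map (\<lambda>w. w x) (map (\<lambda>i x. x i) is) @ []) \<in> measurable (PiM {..<n} (\<lambda>_. N)) (list_space N)"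
    using assms by (intro measurable_map_list) auto
  then show ?thesis by (simp add: o_def)
qed

lemma measurable_append_pair:
  "(\<lambda>(ys, xs). xs @ ys) \<in> measurable (list_space N \<Otimes>\<^sub>M list_space N) (list_space N)"
proof (rule measurable_pair_list_space)
  fix n
  have "(\<lambda>p. map (\<lambda>w. w p) (map (\<lambda>i p. snd p i) [0..<n]) @ fst p)
      \<in> measurable (list_space N \<Otimes>\<^sub>M PiM {..<n} (\<lambda>_. N)) (list_space N)"
    by (rule measurable_map_list) auto
  then show "(\<lambda>(ys, x). case (ys, map x [0..<n]) of (ys, xs) \<Rightarrow> xs @ ys)
      \<in> measurable (list_space N \<Otimes>\<^sub>M PiM {..<n} (\<lambda>_. N)) (list_space N)"
    by (simp add: case_prod_beta o_def)
qed

lemma measurable_append [measurable (raw)]: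
  assumes "f \<in> measurable B (list_space N)" "g \<in> measurable B (list_space N)"
  shows "(\<lambda>b. f b @ g b) \<in> measurable B (list_space N)"
  using measurable_compose[OF measurable_Pair[OF assms(2,1)] measurable_append_pair] by simp

section \<open>Powers of the reference measure on lists and their weighted sums\<close>

definition list_power :: "'a measure \<Rightarrow> nat \<Rightarrow> 'a list measure" where
  "list_power N n = distr (PiM {..<n} (\<lambda>_. N)) (list_space N) (\<lambda>x. map x [0..<n])"

lemma sets_list_power [measurable_cong, simp]: "sets (list_power N n) = sets (list_space N)"
  by (simp add: list_power_def)

lemma space_list_power [simp]: "space (list_power N n) = space (list_space N)"
  by (simp add: list_power_def)

lemma nn_integral_list_power:
  "F \<in> borel_measurable (list_space N) \<Longrightarrow>
    (\<integral>\<^sup>+ xs. F xs \<partial>list_power N n) = (\<integral>\<^sup>+ x. F (map x [0..<n]) \<partial>PiM {..<n} (\<lambda>_. N))"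
  unfolding list_power_def by (rule nn_integral_distr) auto

text \<open>Weights \<open>1 / fact n\<close> give the measure behind the Janossy expansions,
  weights \<open>q ^ n / fact n\<close> the one that governs missed hidden points. Turning the
  series into a measure makes Tonelli and monotone convergence applicable to the sum and the
  integrals at once.\<close>

definition list_mix :: "'a measure \<Rightarrow> (nat \<Rightarrow> ennreal) \<Rightarrow> 'a list measure" where
  "list_mix N c = measure_of (space (list_space N)) (sets (list_space N))
     (\<lambda>A. \<Sum>n. c n * emeasure (list_power N n) A)"

lemma sets_list_mix [measurable_cong, simp]: "sets (list_mix N c) = sets (list_space N)"
  by (simp add: list_mix_def)

lemma space_list_mix [simp]: "space (list_mix N c) = space (list_space N)"
  by (simp add: list_mix_def)

lemma emeasure_list_mix:
  assumes "A \<in> sets (list_space N)"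
  shows "emeasure (list_mix N c) A = (\<Sum>n. c n * emeasure (list_power N n) A)"
proof (rule emeasure_measure_of[OF list_mix_def])
  show "countably_additive (sets (list_mix N c)) (\<lambda>A. \<Sum>n. c n * emeasure (list_power N n) A)"
  proof (rule countably_additiveI)
    fix A :: "nat \<Rightarrow> 'a list set"
    assume A: "range A \<subseteq> sets (list_mix N c)" "disjoint_family A"
    have "(\<Sum>i. \<Sum>n. c n * emeasure (list_power N n) (A i)) = (\<Sum>n. \<Sum>i. c n * emeasure (list_power N n) (A i))"
      by (rule suminf_commute_ennreal)
    also have "\<dots> = (\<Sum>n. c n * emeasure (list_power N n) (\<Union>i. A i))"
      using A by (subst ennreal_suminf_cmult) (auto simp: suminf_emeasure)
    finally show "(\<Sum>i. \<Sum>n. c n * emeasure (list_power N n) (A i)) = \<dots>" .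
  qed
qed (use assms sets.sets_into_space in \<open>auto simp: positive_def\<close>)

lemma nn_integral_list_mix:
  assumes "F \<in> borel_measurable (list_space N)"
  shows "(\<integral>\<^sup>+ xs. F xs \<partial>list_mix N c) = (\<Sum>n. c n * (\<integral>\<^sup>+ xs. F xs \<partial>list_power N n))"
  using assms
proof (induction rule: borel_measurable_induct)
  case (cong f g)
  then show ?case
    by (simp cong: nn_integral_cong_simp)
next
  case (set A)
  then show ?case
    by (simp add: emeasure_list_mix)
next
  case (mult f d)
  then show ?case
    by (simp add: nn_integral_cmult mult.left_commute ennreal_suminf_cmult)
next
  case (add f g)
  then show ?case
    by (simp add: nn_integral_add distrib_left suminf_add)
next
  case (seq U)
  have [measurable]: "U i \<in> borel_measurable (list_space N)" for i by fact
  have mono: "incseq (\<lambda>i. c n * (\<integral>\<^sup>+ xs. U i xs \<partial>list_power N n))" for n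
    using \<open>incseq U\<close> by (auto simp: incseq_def le_fun_def intro!: mult_left_mono nn_integral_mono)
  have "(\<integral>\<^sup>+ xs. (SUP i. U i xs) \<partial>list_mix N c) = (SUP i. \<integral>\<^sup>+ xs. U i xs \<partial>list_mix N c)"
    using \<open>incseq U\<close> by (intro nn_integral_monotone_convergence_SUP) auto
  also have "\<dots> = (SUP i. \<Sum>n. c n * (\<integral>\<^sup>+ xs. U i xs \<partial>list_power N n))"
    using seq by simp
  also have "\<dots> = (\<Sum>n. SUP i. c n * (\<integral>\<^sup>+ xs. U i xs \<partial>list_power N n))"
    using mono by (intro ennreal_suminf_SUP_eq[symmetric])
  also have "\<dots> = (\<Sum>n. c n * (\<integral>\<^sup>+ xs. (SUP i. U i xs) \<partial>list_power N n))"
  proof (rule suminf_cong)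
    fix n
    have "(\<integral>\<^sup>+ xs. (SUP i. U i xs) \<partial>list_power N n) = (SUP i. \<integral>\<^sup>+ xs. U i xs \<partial>list_power N n)"
      using \<open>incseq U\<close> by (intro nn_integral_monotone_convergence_SUP) auto
    then show "(SUP i. c n * (\<integral>\<^sup>+ xs. U i xs \<partial>list_power N n)) = c n * (\<integral>\<^sup>+ xs. (SUP i. U i xs) \<partial>list_power N n)"
      by (metis SUP_mult_left_ennreal)
  qed
  finally show ?case
    unfolding SUP_apply .
qed

lemma list_power_0: "F \<in> borel_measurable (list_space N) \<Longrightarrow> (\<integral>\<^sup>+ xs. F xs \<partial>list_power N 0) = F []"
  by (simp add: nn_integral_list_power PiM_empty nn_integral_count_space_finite)

context finite_measure
begin

lemma product_sigma_finite_const: "product_sigma_finite (\<lambda>_. M)"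
  by (simp add: product_sigma_finite_def sigma_finite_measure_axioms)

text \<open>Prepending shifts all later coordinates by one. It is enough to compare rectangles,
  whose preimages under this map are again rectangles.\<close>

lemma distr_PiM_Cons:
  "distr (M \<Otimes>\<^sub>M PiM {..<n} (\<lambda>_. M)) (PiM {..<Suc n} (\<lambda>_. M))
     (\<lambda>(x, y). \<lambda>i\<in>{..<Suc n}. case i of 0 \<Rightarrow> x | Suc k \<Rightarrow> y k) = PiM {..<Suc n} (\<lambda>_. M)"
proof -
  interpret product_sigma_finite "\<lambda>_. M"
    by (rule product_sigma_finite_const)
  interpret P: sigma_finite_measure "PiM {..<n} (\<lambda>_. M)"
    by (rule sigma_finite) simp
  show ?thesis
  proof (rule PiM_eqI)
    fix A :: "nat \<Rightarrow> 'a set"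
    assume A: "\<And>i. i \<in> {..<Suc n} \<Longrightarrow> A i \<in> sets M"
    have eq: "(\<lambda>(x, y). \<lambda>i\<in>{..<Suc n}. case i of 0 \<Rightarrow> x | Suc k \<Rightarrow> y k) -` (PiE {..<Suc n} A)
        \<inter> space (M \<Otimes>\<^sub>M PiM {..<n} (\<lambda>_. M)) = A 0 \<times> PiE {..<n} (\<lambda>i. A (Suc i))"
    proof (intro set_eqI iffI)
      fix p assume p: "p \<in> (\<lambda>(x, y). \<lambda>i\<in>{..<Suc n}. case i of 0 \<Rightarrow> x | Suc k \<Rightarrow> y k) -` (PiE {..<Suc n} A)
        \<inter> space (M \<Otimes>\<^sub>M PiM {..<n} (\<lambda>_. M))"
      then have *: "(case i of 0 \<Rightarrow> fst p | Suc k \<Rightarrow> snd p k) \<in> A i" if "i < Suc n" for i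
        using that by (auto simp: PiE_iff case_prod_beta)
      have "fst p \<in> A 0"
        using *[of 0] by simp
      moreover have "snd p k \<in> A (Suc k)" if "k < n" for k
        using *[of "Suc k"] that by simp
      ultimately show "p \<in> A 0 \<times> PiE {..<n} (\<lambda>i. A (Suc i))"
        using p by (auto simp: space_pair_measure space_PiM PiE_iff mem_Times_iff)
    next
      fix p assume p: "p \<in> A 0 \<times> PiE {..<n} (\<lambda>i. A (Suc i))"
      have sub: "A i \<subseteq> space M" if "i < Suc n" for i
        using A[of i] that sets.sets_into_space by auto
      have "fst p \<in> space M"
        using p sub[of 0] by auto
      moreover have "snd p k \<in> space M" if "k < n" for k
        using p sub[of "Suc k"] that by (auto simp: PiE_iff)
      moreover have "snd p \<in> extensional {..<n}"
        using p by (auto simp: PiE_def)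
      ultimately have "p \<in> space (M \<Otimes>\<^sub>M PiM {..<n} (\<lambda>_. M))"
        by (simp add: space_pair_measure space_PiM PiE_iff mem_Times_iff)
      moreover have "(case i of 0 \<Rightarrow> fst p | Suc k \<Rightarrow> snd p k) \<in> A i" if "i < Suc n" for i
      proof (cases i)
        case 0
        have "fst p \<in> A 0" using p by (simp add: mem_Times_iff)
        with 0 show ?thesis by simp
      next
        case (Suc k)
        have "snd p \<in> PiE {..<n} (\<lambda>i. A (Suc i))" using p by (simp add: mem_Times_iff)
        then have "snd p k \<in> A (Suc k)" using that Suc by (simp add: PiE_iff)
        with Suc show ?thesis by simp
      qed
      ultimately show "p \<in> (\<lambda>(x, y). \<lambda>i\<in>{..<Suc n}. case i of 0 \<Rightarrow> x | Suc k \<Rightarrow> y k) -` (PiE {..<Suc n} A)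
        \<inter> space (M \<Otimes>\<^sub>M PiM {..<n} (\<lambda>_. M))"
        unfolding vimage_def case_prod_beta Int_iff mem_Collect_eq restrict_PiE_iff by simp
    qed
    have "emeasure (distr (M \<Otimes>\<^sub>M PiM {..<n} (\<lambda>_. M)) (PiM {..<Suc n} (\<lambda>_. M))
        (\<lambda>(x, y). \<lambda>i\<in>{..<Suc n}. case i of 0 \<Rightarrow> x | Suc k \<Rightarrow> y k)) (PiE {..<Suc n} A)
      = emeasure (M \<Otimes>\<^sub>M PiM {..<n} (\<lambda>_. M)) (A 0 \<times> PiE {..<n} (\<lambda>i. A (Suc i)))"
      unfolding eq[symmetric] using A by (intro emeasure_distr measurable_PiM_Cons sets_PiM_I_finite) auto
    also have "\<dots> = emeasure M (A 0) * emeasure (PiM {..<n} (\<lambda>_. M)) (PiE {..<n} (\<lambda>i. A (Suc i)))"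
      using A by (intro P.emeasure_pair_measure_Times sets_PiM_I_finite) auto
    also have "\<dots> = (\<Prod>i<Suc n. emeasure M (A i))"
      using A emeasure_PiM[of "{..<n}" "\<lambda>i. A (Suc i)"]
      by (simp add: prod.lessThan_Suc_shift del: prod.lessThan_Suc)
    finally show "emeasure (distr (M \<Otimes>\<^sub>M PiM {..<n} (\<lambda>_. M)) (PiM {..<Suc n} (\<lambda>_. M))
        (\<lambda>(x, y). \<lambda>i\<in>{..<Suc n}. case i of 0 \<Rightarrow> x | Suc k \<Rightarrow> y k)) (PiE {..<Suc n} A) = \<dots>" .
  qed auto
qed

lemma nn_integral_list_power_Suc:
  assumes [measurable]: "F \<in> borel_measurable (list_space M)"
  shows "(\<integral>\<^sup>+ xs. F xs \<partial>list_power M (Suc n)) = (\<integral>\<^sup>+ x. \<integral>\<^sup>+ xs. F (x # xs) \<partial>list_power M n \<partial>M)"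
proof -
  interpret product_sigma_finite "\<lambda>_. M"
    by (rule product_sigma_finite_const)
  interpret P: sigma_finite_measure "PiM {..<n} (\<lambda>_. M)"
    by (rule sigma_finite) simp
  have "(\<integral>\<^sup>+ xs. F xs \<partial>list_power M (Suc n)) =
    (\<integral>\<^sup>+ p. F (map ((\<lambda>(x, y). \<lambda>i\<in>{..<Suc n}. case i of 0 \<Rightarrow> x | Suc k \<Rightarrow> y k) p) [0..<Suc n])
      \<partial>(M \<Otimes>\<^sub>M PiM {..<n} (\<lambda>_. M)))"
    unfolding nn_integral_list_power[OF assms]
    by (subst distr_PiM_Cons[symmetric], rule nn_integral_distr[OF measurable_PiM_Cons]) measurable
  also have "\<dots> = (\<integral>\<^sup>+ (x, y). F (x # map y [0..<n]) \<partial>(M \<Otimes>\<^sub>M PiM {..<n} (\<lambda>_. M)))"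
    by (simp add: case_prod_unfold map_upt_Cons del: upt_Suc)
  also have "\<dots> = (\<integral>\<^sup>+ x. \<integral>\<^sup>+ y. F (x # map y [0..<n]) \<partial>PiM {..<n} (\<lambda>_. M) \<partial>M)"
    by (subst P.nn_integral_fst[symmetric]) auto
  also have "\<dots> = (\<integral>\<^sup>+ x. \<integral>\<^sup>+ xs. F (x # xs) \<partial>list_power M n \<partial>M)"
    by (intro nn_integral_cong) (simp add: nn_integral_list_power)
  finally show ?thesis .
qed

lemma emeasure_list_power_space:
  "emeasure (list_power M n) (space (list_space M)) = emeasure M (space M) ^ n"
proof -
  have "(\<integral>\<^sup>+ xs. 1 \<partial>list_power M n) = emeasure M (space M) ^ n"
  proof (induction n)
    case 0
    show ?case by (subst list_power_0) auto
  next
    case (Suc n)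
    then show ?case by (subst nn_integral_list_power_Suc) (auto simp: mult.commute)
  qed
  then show ?thesis by simp
qed

lemma finite_measure_list_power: "finite_measure (list_power M n)"
  by (rule finite_measureI) (simp add: emeasure_list_power_space emeasure_eq_measure ennreal_power)

text \<open>The total mass is dominated by the exponential series at the mass of \<open>M\<close>.
  Finiteness matters because Tonelli is used with sigma-finite measures on lists.\<close>

lemma finite_measure_list_mix:
  assumes c: "\<And>n. c n \<le> ennreal (1 / fact n)"
  shows "finite_measure (list_mix M c)"
proof (rule finite_measureI)
  let ?a = "measure M (space M)"
  have "emeasure (list_mix M c) (space (list_space M)) \<le> (\<Sum>n. ennreal (?a ^ n /\<^sub>R fact n))"
    unfolding emeasure_list_mix[OF sets.top] emeasure_list_power_space emeasure_eq_measure
    using c by (intro suminf_le)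
      (auto simp: ennreal_power divide_inverse ennreal_mult' mult.commute intro!: mult_right_mono)
  also have "\<dots> = ennreal (exp ?a)"
    using exp_converges[of ?a] by (intro suminf_ennreal_eq) auto
  finally show "emeasure (list_mix M c) (space (list_mix M c)) \<noteq> \<infinity>"
    by (auto simp: top_unique)
qed

end

section \<open>Sums over removed entries\<close>

text \<open>The recursion on the list follows that of the association integrals below, so identities
  between the two go by structural induction; positions enter only when the result is compared with
  the sums over \<open>r\<close> and \<open>u\<close> in the theorem.\<close>

primrec removal_sum :: "('a \<Rightarrow> 'a list \<Rightarrow> ennreal) \<Rightarrow> 'a list \<Rightarrow> ennreal" where
  "removal_sum G [] = 0"
| "removal_sum G (x # xs) = G x xs + removal_sum (\<lambda>y ys. G y (x # ys)) xs"

lemma removal_sum_conv_sum: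
  "removal_sum G xs = (\<Sum>i<length xs. G (xs ! i) (take i xs @ drop (Suc i) xs))"
  by (induction xs arbitrary: G) (simp_all add: sum.lessThan_Suc_shift del: sum.lessThan_Suc)

lemma removal_sum_cong:
  assumes "xs \<in> lists S" "\<And>y ys. y \<in> S \<Longrightarrow> ys \<in> lists S \<Longrightarrow> G y ys = H y ys"
  shows "removal_sum G xs = removal_sum H xs"
  using assms
proof (induction xs arbitrary: G H)
  case (Cons x xs)
  then have "removal_sum (\<lambda>y ys. G y (x # ys)) xs = removal_sum (\<lambda>y ys. H y (x # ys)) xs"
    by (intro Cons.IH) simp_all
  moreover have "G x xs = H x xs"
    using Cons.hyps by (intro Cons.prems) auto
  ultimately show ?case by simp
qed simp

lemma removal_sum_add:
  "removal_sum (\<lambda>y ys. G y ys + H y ys) xs = removal_sum G xs + removal_sum H xs"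
  by (simp add: removal_sum_conv_sum sum.distrib)

lemma removal_sum_cmult: "removal_sum (\<lambda>y ys. a * G y ys) xs = a * removal_sum G xs"
  by (simp add: removal_sum_conv_sum sum_distrib_left)

lemma remove_nth_in_lists:
  "xs \<in> lists S \<Longrightarrow> take i xs @ drop (Suc i) xs \<in> lists S"
  by (auto dest: in_set_takeD in_set_dropD)

lemma removal_sum_nn_integral:
  assumes "xs \<in> lists S"
    and "\<And>y ys. y \<in> S \<Longrightarrow> ys \<in> lists S \<Longrightarrow> (\<lambda>b. G b y ys) \<in> borel_measurable B"
  shows "removal_sum (\<lambda>y ys. \<integral>\<^sup>+ b. G b y ys \<partial>B) xs = (\<integral>\<^sup>+ b. removal_sum (G b) xs \<partial>B)"
  unfolding removal_sum_conv_sum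
proof (rule nn_integral_sum[symmetric])
  show "(\<lambda>b. G b (xs ! i) (take i xs @ drop (Suc i) xs)) \<in> borel_measurable B" if "i \<in> {..<length xs}" for i
    using that assms(1) by (intro assms(2) remove_nth_in_lists) (auto simp: in_lists_conv_set)
qed

lemma removal_sum_measurable_pair:
  assumes G [measurable]: "(\<lambda>(b, y, ys). G b y ys) \<in> borel_measurable (B \<Otimes>\<^sub>M (N \<Otimes>\<^sub>M list_space N))"
  shows "(\<lambda>(b, xs). removal_sum (G b) xs) \<in> borel_measurable (B \<Otimes>\<^sub>M list_space N)"
proof (rule measurable_pair_list_space)
  fix n
  have "(\<lambda>(b, x). G b (x i) (map x (take i [0..<n] @ drop (Suc i) [0..<n])))
      \<in> borel_measurable (B \<Otimes>\<^sub>M PiM {..<n} (\<lambda>_. N))" if "i < n" for i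
  proof -
    have *: "(\<lambda>x. map x (take i [0..<n] @ drop (Suc i) [0..<n])) \<in> measurable (PiM {..<n} (\<lambda>_. N)) (list_space N)"
      by (rule measurable_map_indices) (auto dest: in_set_takeD in_set_dropD)
    have "(\<lambda>p. (fst p, snd p i, map (snd p) (take i [0..<n] @ drop (Suc i) [0..<n])))
      \<in> measurable (B \<Otimes>\<^sub>M PiM {..<n} (\<lambda>_. N)) (B \<Otimes>\<^sub>M (N \<Otimes>\<^sub>M list_space N))"
      using that by (intro measurable_Pair measurable_compose[OF measurable_snd *]
        measurable_compose[OF measurable_snd measurable_component_singleton]) auto
    from measurable_compose[OF this G] show ?thesis
      by (simp add: case_prod_unfold)
  qed
  then have "(\<lambda>p. \<Sum>i<n. (\<lambda>(b, x). G b (x i) (map x (take i [0..<n] @ drop (Suc i) [0..<n]))) p)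
      \<in> borel_measurable (B \<Otimes>\<^sub>M PiM {..<n} (\<lambda>_. N))"
    by (intro borel_measurable_sum) auto
  then show "(\<lambda>(b, x). case (b, map x [0..<n]) of (b, xs) \<Rightarrow> removal_sum (G b) xs)
      \<in> borel_measurable (B \<Otimes>\<^sub>M PiM {..<n} (\<lambda>_. N))"
    by (simp add: removal_sum_conv_sum case_prod_unfold take_map drop_map cong: sum.cong_simp)
qed

lemma removal_sum_measurable [measurable (raw)]:
  assumes "(\<lambda>(b, y, ys). G b y ys) \<in> borel_measurable (B \<Otimes>\<^sub>M (N \<Otimes>\<^sub>M list_space N))"
    and "g \<in> measurable B (list_space N)"
  shows "(\<lambda>b. removal_sum (G b) (g b)) \<in> borel_measurable B"
  using measurable_compose[OF measurable_Pair[OF measurable_ident assms(2)] removal_sum_measurable_pair[OF assms(1)]]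
  by simp

section \<open>Association integrals\<close>

text \<open>\<open>F\<close> is an arbitrary function, since linking \<open>z\<close> to
  \<open>x\<close> replaces it by \<open>\<lambda>xs. F (x # xs)\<close>. The factorial in the base
  case counts the missed points only: every linked point has a place of its own at the front of the
  argument and is not one of the interchangeable points.\<close>

primrec assoc_int :: "'a measure \<Rightarrow> real \<Rightarrow> ('a \<Rightarrow> 'a \<Rightarrow> ennreal) \<Rightarrow> ('a \<Rightarrow> ennreal) \<Rightarrow>
    ('a list \<Rightarrow> ennreal) \<Rightarrow> 'a list \<Rightarrow> ennreal" where
  "assoc_int N q k c F [] = (\<integral>\<^sup>+ xs. F xs \<partial>list_mix N (\<lambda>n. ennreal (q ^ n / fact n)))"
| "assoc_int N q k c F (z # zs) = c z * assoc_int N q k c F zs +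
     (\<integral>\<^sup>+ x. k z x * assoc_int N q k c (\<lambda>xs. F (x # xs)) zs \<partial>N)"

definition symmetric_on :: "'a set \<Rightarrow> ('a list \<Rightarrow> 'b) \<Rightarrow> bool" where
  "symmetric_on S F \<longleftrightarrow> (\<forall>xs ys. xs \<in> lists S \<longrightarrow> mset xs = mset ys \<longrightarrow> F xs = F ys)"

lemma symmetric_onD: "symmetric_on S F \<Longrightarrow> xs \<in> lists S \<Longrightarrow> mset xs = mset ys \<Longrightarrow> F xs = F ys"
  by (auto simp: symmetric_on_def)

lemma symmetric_on_Cons:
  assumes "symmetric_on S F" "x \<in> S"
  shows "symmetric_on S (\<lambda>xs. F (x # xs))"
  unfolding symmetric_on_def
proof (intro allI impI)
  fix xs ys
  assume "xs \<in> lists S" "mset xs = mset ys"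
  then show "F (x # xs) = F (x # ys)"
    using assms by (intro symmetric_onD[OF assms(1)]) auto
qed

locale association = finite_measure N for N :: "'a measure" +
  fixes q :: real and k :: "'a \<Rightarrow> 'a \<Rightarrow> ennreal" and c :: "'a \<Rightarrow> ennreal"
  assumes q_nonneg: "0 \<le> q" and q_le_1: "q \<le> 1"
    and k_measurable [measurable]: "(\<lambda>(z, x). k z x) \<in> borel_measurable (N \<Otimes>\<^sub>M N)"
    and c_measurable [measurable]: "c \<in> borel_measurable N"
begin

abbreviation J :: "('a list \<Rightarrow> ennreal) \<Rightarrow> 'a list \<Rightarrow> ennreal" where
  "J \<equiv> assoc_int N q k c"

abbreviation mix :: "'a list measure" where
  "mix \<equiv> list_mix N (\<lambda>n. ennreal (q ^ n / fact n))"

lemma finite_measure_mix: "finite_measure mix"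
  using q_nonneg q_le_1 by (intro finite_measure_list_mix) (simp add: divide_right_mono power_le_one)

sublocale mix: finite_measure mix
  by (rule finite_measure_mix)

lemma J_cong: "(\<And>xs. xs \<in> lists (space N) \<Longrightarrow> F xs = G xs) \<Longrightarrow> J F zs = J G zs"
proof (induction zs arbitrary: F G)
  case Nil
  then show ?case by (auto intro!: nn_integral_cong simp: space_list_space)
next
  case (Cons z zs)
  have "J F zs = J G zs"
    by (rule Cons.IH) (rule Cons.prems)
  moreover have "J (\<lambda>xs. F (x # xs)) zs = J (\<lambda>xs. G (x # xs)) zs" if "x \<in> space N" for x
    by (rule Cons.IH) (use Cons.prems that in auto)
  ultimately show ?case
    by (auto intro!: nn_integral_cong)
qed

text \<open>Joint measurability in parameter and measurements does not go by induction for a fixed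
  \<open>F\<close>, because the recursion puts integrated points into its argument. Here
  \<open>ys\<close> collects the points linked so far, and the measurements are measurable functions
  of the parameter \<open>b\<close>, so that the list \<open>ws\<close> is a fixed object for the
  induction.\<close>

lemma J_measurable_aux:
  fixes F :: "'b \<Rightarrow> 'a list \<Rightarrow> ennreal"
  assumes [measurable]: "(\<lambda>(b, xs). F b xs) \<in> borel_measurable (B \<Otimes>\<^sub>M list_space N)"
    and "\<And>w. w \<in> set ws \<Longrightarrow> w \<in> measurable B N"
  shows "(\<lambda>(b, ys). J (\<lambda>xs. F b (ys @ xs)) (map (\<lambda>w. w b) ws)) \<in> borel_measurable (B \<Otimes>\<^sub>M list_space N)"
  using assms(2)
proof (induction ws)
  case Nil
  show ?case
    by simp measurable
next
  case (Cons w ws)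
  have [measurable]: "w \<in> measurable B N"
    using Cons.prems by simp
  have IH [measurable]: "(\<lambda>(b, ys). J (\<lambda>xs. F b (ys @ xs)) (map (\<lambda>w. w b) ws)) \<in> borel_measurable (B \<Otimes>\<^sub>M list_space N)"
    by (rule Cons.IH) (use Cons.prems in auto)
  \<comment> \<open>The newly linked point is appended to \<open>ys\<close>, so that
    \<open>ys @ x # xs\<close> is again of the form covered by the induction hypothesis.\<close>
  have "(\<lambda>(p, x). (fst p, snd p @ [x])) \<in> measurable ((B \<Otimes>\<^sub>M list_space N) \<Otimes>\<^sub>M N) (B \<Otimes>\<^sub>M list_space N)"
    by measurable
  from measurable_compose[OF this IH]
  have [measurable]: "(\<lambda>(p, x). J (\<lambda>xs. F (fst p) (snd p @ x # xs)) (map (\<lambda>w. w (fst p)) ws))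
      \<in> borel_measurable ((B \<Otimes>\<^sub>M list_space N) \<Otimes>\<^sub>M N)"
    by (simp add: case_prod_unfold)
  have [measurable]: "(\<lambda>p. J (\<lambda>xs. F (fst p) (snd p @ xs)) (map (\<lambda>w. w (fst p)) ws)) \<in> borel_measurable (B \<Otimes>\<^sub>M list_space N)"
    using IH by (simp add: case_prod_unfold)
  have "(\<lambda>p. c (w (fst p)) * J (\<lambda>xs. F (fst p) (snd p @ xs)) (map (\<lambda>w. w (fst p)) ws) +
     (\<integral>\<^sup>+ x. k (w (fst p)) x * J (\<lambda>xs. F (fst p) (snd p @ x # xs)) (map (\<lambda>w. w (fst p)) ws) \<partial>N))
     \<in> borel_measurable (B \<Otimes>\<^sub>M list_space N)"
    by measurable
  then show ?case
    by (simp add: case_prod_unfold)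
qed

lemma J_measurable_pair:
  fixes F :: "'b \<Rightarrow> 'a list \<Rightarrow> ennreal"
  assumes F [measurable]: "(\<lambda>(b, xs). F b xs) \<in> borel_measurable (B \<Otimes>\<^sub>M list_space N)"
  shows "(\<lambda>(b, zs). J (F b) zs) \<in> borel_measurable (B \<Otimes>\<^sub>M list_space N)"
proof (rule measurable_pair_list_space)
  fix n
  have "(\<lambda>(p, ys). J (\<lambda>xs. F (fst p) (ys @ xs)) (map (\<lambda>w. w p) (map (\<lambda>i p. snd p i) [0..<n])))
    \<in> borel_measurable ((B \<Otimes>\<^sub>M PiM {..<n} (\<lambda>_. N)) \<Otimes>\<^sub>M list_space N)"
    by (rule J_measurable_aux) auto
  from measurable_compose[OF measurable_Pair[OF measurable_ident measurable_Nil] this]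
  show "(\<lambda>(b, x). case (b, map x [0..<n]) of (b, zs) \<Rightarrow> J (F b) zs) \<in> borel_measurable (B \<Otimes>\<^sub>M PiM {..<n} (\<lambda>_. N))"
    by (simp add: case_prod_unfold o_def)
qed

lemma J_measurable [measurable (raw)]:
  assumes "(\<lambda>(b, xs). F b xs) \<in> borel_measurable (B \<Otimes>\<^sub>M list_space N)" "g \<in> measurable B (list_space N)"
  shows "(\<lambda>b. J (F b) (g b)) \<in> borel_measurable B"
  using measurable_compose[OF measurable_Pair[OF measurable_ident assms(2)] J_measurable_pair[OF assms(1)]]
  by simp

lemma J_add:
  assumes "F \<in> borel_measurable (list_space N)" "G \<in> borel_measurable (list_space N)" "zs \<in> lists (space N)"
  shows "J (\<lambda>xs. F xs + G xs) zs = J F zs + J G zs"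
  using assms(3,1,2)
proof (induction zs arbitrary: F G)
  case Nil
  then show ?case by (simp add: nn_integral_add)
next
  case (Cons z zs)
  note [measurable] = Cons.prems
  have [measurable]: "zs \<in> space (list_space N)" "z \<in> space N"
    using Cons.hyps by (auto simp: space_list_space)
  have "(\<integral>\<^sup>+ x. k z x * J (\<lambda>xs. F (x # xs) + G (x # xs)) zs \<partial>N) =
    (\<integral>\<^sup>+ x. k z x * J (\<lambda>xs. F (x # xs)) zs + k z x * J (\<lambda>xs. G (x # xs)) zs \<partial>N)"
    by (intro nn_integral_cong) (simp add: Cons.IH distrib_left)
  also have "\<dots> = (\<integral>\<^sup>+ x. k z x * J (\<lambda>xs. F (x # xs)) zs \<partial>N) + (\<integral>\<^sup>+ x. k z x * J (\<lambda>xs. G (x # xs)) zs \<partial>N)"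
    by (intro nn_integral_add) measurable
  finally show ?case
    using Cons by (simp add: distrib_left add_ac)
qed

lemma J_cmult:
  assumes "F \<in> borel_measurable (list_space N)" "zs \<in> lists (space N)"
  shows "J (\<lambda>xs. a * F xs) zs = a * J F zs"
  using assms(2,1)
proof (induction zs arbitrary: F)
  case Nil
  then show ?case by (simp add: nn_integral_cmult)
next
  case (Cons z zs)
  note [measurable] = Cons.prems
  have [measurable]: "zs \<in> space (list_space N)" "z \<in> space N"
    using Cons.hyps by (auto simp: space_list_space)
  have "(\<integral>\<^sup>+ x. k z x * J (\<lambda>xs. a * F (x # xs)) zs \<partial>N) = (\<integral>\<^sup>+ x. a * (k z x * J (\<lambda>xs. F (x # xs)) zs) \<partial>N)"
    by (intro nn_integral_cong) (simp add: Cons.IH mult_ac)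
  also have "\<dots> = a * (\<integral>\<^sup>+ x. k z x * J (\<lambda>xs. F (x # xs)) zs \<partial>N)"
    by (intro nn_integral_cmult) measurable
  finally show ?case
    using Cons by (simp add: distrib_left mult_ac)
qed

text \<open>Monotonicity in \<open>i\<close> belongs to the conclusion: the induction step applies
  monotone convergence to the integral over the linked point, whose integrand contains the values of
  \<open>J\<close> for the shorter list.\<close>

lemma J_monotone_convergence:
  assumes "\<And>i. F i \<in> borel_measurable (list_space N)" "incseq F" "zs \<in> lists (space N)"
  shows "J (\<lambda>xs. SUP i. F i xs) zs = (SUP i. J (F i) zs) \<and> incseq (\<lambda>i. J (F i) zs)"
  using assms(3,1,2)
proof (induction zs arbitrary: F)
  case Nil
  have "incseq (\<lambda>i. integral\<^sup>N mix (F i))"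
    using \<open>incseq F\<close> by (auto simp: incseq_def le_fun_def intro!: nn_integral_mono)
  moreover have "(\<integral>\<^sup>+ xs. (SUP i. F i xs) \<partial>mix) = (SUP i. integral\<^sup>N mix (F i))"
    using Nil by (intro nn_integral_monotone_convergence_SUP) auto
  ultimately show ?case by simp
next
  case (Cons z zs)
  note [measurable] = Cons.prems(1)
  have [measurable]: "zs \<in> space (list_space N)" "z \<in> space N"
    using Cons.hyps by (auto simp: space_list_space)
  have IH: "J (\<lambda>xs. SUP i. F i (x # xs)) zs = (SUP i. J (\<lambda>xs. F i (x # xs)) zs) \<and>
      incseq (\<lambda>i. J (\<lambda>xs. F i (x # xs)) zs)" if "x \<in> space N" for x
  proof (rule Cons.IH)
    show "(\<lambda>xs. F i (x # xs)) \<in> borel_measurable (list_space N)" for i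
      using that by measurable
    show "incseq (\<lambda>i xs. F i (x # xs))"
      using \<open>incseq F\<close> by (auto simp: incseq_def le_fun_def)
  qed
  have IH0: "J (\<lambda>xs. SUP i. F i xs) zs = (SUP i. J (F i) zs)" "incseq (\<lambda>i. J (F i) zs)"
    using Cons.IH[of F] Cons.prems by auto
  have inc: "incseq (\<lambda>i. \<integral>\<^sup>+ x. k z x * J (\<lambda>xs. F i (x # xs)) zs \<partial>N)"
    using IH by (auto simp: incseq_def intro!: nn_integral_mono mult_left_mono)
  have "(\<integral>\<^sup>+ x. k z x * J (\<lambda>xs. SUP i. F i (x # xs)) zs \<partial>N) =
    (\<integral>\<^sup>+ x. (SUP i. k z x * J (\<lambda>xs. F i (x # xs)) zs) \<partial>N)"
    using IH by (intro nn_integral_cong) (simp add: SUP_mult_left_ennreal)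
  also have "\<dots> = (SUP i. \<integral>\<^sup>+ x. k z x * J (\<lambda>xs. F i (x # xs)) zs \<partial>N)"
  proof (rule nn_integral_monotone_convergence_SUP_AE)
    show "AE x in N. k z x * J (\<lambda>xs. F i (x # xs)) zs \<le> k z x * J (\<lambda>xs. F (Suc i) (x # xs)) zs" for i
      using IH by (auto simp: incseq_def intro!: mult_left_mono)
  qed measurable
  finally have *: "(\<integral>\<^sup>+ x. k z x * J (\<lambda>xs. SUP i. F i (x # xs)) zs \<partial>N) = \<dots>" .
  have inc0: "incseq (\<lambda>i. c z * J (F i) zs)"
    using IH0(2) by (auto simp: incseq_def intro!: mult_left_mono)
  have "c z * (SUP i. J (F i) zs) = (SUP i. c z * J (F i) zs)"
    by (rule SUP_mult_left_ennreal)
  then show ?case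
    using inc inc0 by (auto simp: * IH0(1) ennreal_SUP_add[symmetric] incseq_def intro: add_mono)
qed

text \<open>Induction moves \<open>w\<close> next to \<open>u\<close>, which leaves the exchange of
  two neighbours. If at most one of them is linked, the terms match directly; if both are linked,
  Tonelli exchanges the two hidden points and the symmetry of \<open>F\<close> restores their
  order.\<close>

lemma J_swap:
  assumes [measurable]: "F \<in> borel_measurable (list_space N)" and sym: "symmetric_on (space N) F"
    and "us \<in> lists (space N)" "vs \<in> lists (space N)" "w \<in> space N"
  shows "J F (us @ w # vs) = J F (w # us @ vs)"
  using assms(3,1,2)
proof (induction us arbitrary: F)
  case (Cons u us)
  note [measurable] = Cons.prems(1)
  note sym = Cons.prems(2)
  let ?r = "us @ vs"
  have sp [measurable]: "?r \<in> space (list_space N)" "u \<in> space N" "w \<in> space N"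
    using Cons.hyps assms(4,5) by (auto simp: space_list_space)
  have IH0: "J F (us @ w # vs) = J F (w # us @ vs)"
    using Cons by simp
  have IH: "J (\<lambda>xs. F (x # xs)) (us @ w # vs) = J (\<lambda>xs. F (x # xs)) (w # us @ vs)" if "x \<in> space N" for x
    using that by (intro Cons.IH symmetric_on_Cons sym) auto
  have comm: "J (\<lambda>xs. F (x # y # xs)) ?r = J (\<lambda>xs. F (y # x # xs)) ?r" if "x \<in> space N" "y \<in> space N" for x y
    by (rule J_cong) (use that in \<open>auto intro!: symmetric_onD[OF sym] simp: add_mset_commute\<close>)
  have "(\<integral>\<^sup>+ x. k u x * J (\<lambda>xs. F (x # xs)) (w # ?r) \<partial>N) =
     (\<integral>\<^sup>+ x. c w * (k u x * J (\<lambda>xs. F (x # xs)) ?r) + (\<integral>\<^sup>+ y. k u x * k w y * J (\<lambda>xs. F (x # y # xs)) ?r \<partial>N) \<partial>N)"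
    by (intro nn_integral_cong) (simp add: distrib_left mult_ac nn_integral_cmult[symmetric])
  also have "\<dots> = c w * (\<integral>\<^sup>+ x. k u x * J (\<lambda>xs. F (x # xs)) ?r \<partial>N) +
     (\<integral>\<^sup>+ x. \<integral>\<^sup>+ y. k u x * k w y * J (\<lambda>xs. F (x # y # xs)) ?r \<partial>N \<partial>N)"
    by (subst nn_integral_add) (auto simp: nn_integral_cmult)
  finally have 1: "(\<integral>\<^sup>+ x. k u x * J (\<lambda>xs. F (x # xs)) (w # ?r) \<partial>N) = \<dots>" .
  have "(\<integral>\<^sup>+ y. k w y * J (\<lambda>xs. F (y # xs)) (u # ?r) \<partial>N) =
     (\<integral>\<^sup>+ y. c u * (k w y * J (\<lambda>xs. F (y # xs)) ?r) + (\<integral>\<^sup>+ x. k u x * k w y * J (\<lambda>xs. F (x # y # xs)) ?r \<partial>N) \<partial>N)"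
    by (intro nn_integral_cong) (simp add: distrib_left mult_ac nn_integral_cmult[symmetric] comm cong: nn_integral_cong_simp)
  also have "\<dots> = c u * (\<integral>\<^sup>+ y. k w y * J (\<lambda>xs. F (y # xs)) ?r \<partial>N) +
     (\<integral>\<^sup>+ y. \<integral>\<^sup>+ x. k u x * k w y * J (\<lambda>xs. F (x # y # xs)) ?r \<partial>N \<partial>N)"
    by (subst nn_integral_add) (auto simp: nn_integral_cmult)
  finally have 2: "(\<integral>\<^sup>+ y. k w y * J (\<lambda>xs. F (y # xs)) (u # ?r) \<partial>N) = \<dots>" .
  have 3: "(\<integral>\<^sup>+ y. \<integral>\<^sup>+ x. k u x * k w y * J (\<lambda>xs. F (x # y # xs)) ?r \<partial>N \<partial>N) =
    (\<integral>\<^sup>+ x. \<integral>\<^sup>+ y. k u x * k w y * J (\<lambda>xs. F (x # y # xs)) ?r \<partial>N \<partial>N)"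
  proof -
    interpret pair_sigma_finite N N ..
    show ?thesis by (rule Fubini') measurable
  qed
  have "J F ((u # us) @ w # vs) = c u * J F (w # ?r) + (\<integral>\<^sup>+ x. k u x * J (\<lambda>xs. F (x # xs)) (w # ?r) \<partial>N)"
    unfolding append_Cons assoc_int.simps(2)[of _ _ _ _ _ u] IH0
    by (intro arg_cong2[where f = "(+)"] refl nn_integral_cong) (simp only: IH)
  also have "\<dots> = J F (w # u # ?r)"
    unfolding 1 assoc_int.simps(2)[of _ _ _ _ _ w "u # us @ vs"] 2 3
    by (simp add: distrib_left add_ac mult_ac)
  finally show ?case by simp
qed simp

lemma J_symmetric:
  assumes F: "F \<in> borel_measurable (list_space N)" "symmetric_on (space N) F"
    and zs: "zs \<in> lists (space N)" and eq: "mset zs = mset zs'"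
  shows "J F zs = J F zs'"
  using zs eq F
proof (induction zs arbitrary: zs' F)
  case (Cons z zs)
  have "z \<in> set zs'"
    using Cons.prems(1) by (metis list.set_intros(1) mset_eq_setD)
  then obtain us vs where zs': "zs' = us @ z # vs"
    by (auto simp: in_set_conv_decomp)
  note [measurable] = Cons.prems(2)
  have m: "mset zs = mset (us @ vs)"
    using Cons.prems(1) by (simp add: zs')
  then have sp: "us \<in> lists (space N)" "vs \<in> lists (space N)"
    using Cons.hyps mset_eq_setD[OF m] by (auto simp: in_lists_conv_set)
  have "J F zs = J F (us @ vs)"
    using m Cons by blast
  moreover have "J (\<lambda>xs. F (x # xs)) zs = J (\<lambda>xs. F (x # xs)) (us @ vs)" if "x \<in> space N" for x
    using that m by (intro Cons.IH symmetric_on_Cons Cons.prems) auto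
  ultimately have "J F (z # zs) = J F (z # us @ vs)"
    by (auto intro!: nn_integral_cong)
  also have "\<dots> = J F zs'"
    using Cons sp unfolding zs' by (intro J_swap[symmetric]) auto
  finally show ?case .
qed simp

lemma J_sum_list_power:
  "F \<in> borel_measurable (list_space N) \<Longrightarrow>
    J F [] = (\<Sum>n. ennreal (q ^ n / fact n) * (\<integral>\<^sup>+ xs. F xs \<partial>list_power N n))"
  by (simp add: nn_integral_list_mix)

lemma pair_sigma_finite_N: "pair_sigma_finite N N" ..

lemma sigma_finite_list_power: "sigma_finite_measure (list_power N n)"
  using finite_measure_list_power[of n] by (simp add: finite_measure_def)

text \<open>Under a power measure each of the \<open>Suc n\<close> positions contributes the same
  integral. In the induction the head gives one copy, and Tonelli identifies the contribution of the
  tail with copies of the same integral.\<close>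

lemma nn_integral_removal_sum:
  assumes "(\<lambda>(x, xs). G x xs) \<in> borel_measurable (N \<Otimes>\<^sub>M list_space N)"
  shows "(\<integral>\<^sup>+ xs. removal_sum G xs \<partial>list_power N (Suc n)) =
    of_nat (Suc n) * (\<integral>\<^sup>+ x. \<integral>\<^sup>+ xs. G x xs \<partial>list_power N n \<partial>N)"
  using assms
proof (induction n arbitrary: G)
  case 0
  note [measurable] = 0
  have "(\<integral>\<^sup>+ xs. removal_sum G (x # xs) \<partial>list_power N 0) = (\<integral>\<^sup>+ xs. G x xs \<partial>list_power N 0)"
    if [measurable]: "x \<in> space N" for x
    by (subst (1 2) list_power_0) auto
  then have "(\<integral>\<^sup>+ x. \<integral>\<^sup>+ xs. removal_sum G (x # xs) \<partial>list_power N 0 \<partial>N) =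
      (\<integral>\<^sup>+ x. \<integral>\<^sup>+ xs. G x xs \<partial>list_power N 0 \<partial>N)"
    by (rule nn_integral_cong)
  then show ?case
    by (subst nn_integral_list_power_Suc) auto
next
  case (Suc n)
  note [measurable] = Suc.prems
  interpret L: sigma_finite_measure "list_power N (Suc n)" by (rule sigma_finite_list_power)
  interpret L': sigma_finite_measure "list_power N n" by (rule sigma_finite_list_power)
  interpret pair_sigma_finite N N by (rule pair_sigma_finite_N)
  let ?I = "\<integral>\<^sup>+ x. \<integral>\<^sup>+ xs. G x xs \<partial>list_power N (Suc n) \<partial>N"
  have IH: "(\<integral>\<^sup>+ xs. removal_sum (\<lambda>y ys. G y (x # ys)) xs \<partial>list_power N (Suc n)) =
     of_nat (Suc n) * (\<integral>\<^sup>+ y. \<integral>\<^sup>+ xs. G y (x # xs) \<partial>list_power N n \<partial>N)" if "x \<in> space N" for x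
    by (rule Suc.IH) (use that in measurable)
  have "(\<integral>\<^sup>+ xs. removal_sum G xs \<partial>list_power N (Suc (Suc n))) =
    (\<integral>\<^sup>+ x. \<integral>\<^sup>+ xs. G x xs + removal_sum (\<lambda>y ys. G y (x # ys)) xs \<partial>list_power N (Suc n) \<partial>N)"
    by (subst nn_integral_list_power_Suc) auto
  also have "\<dots> = (\<integral>\<^sup>+ x. (\<integral>\<^sup>+ xs. G x xs \<partial>list_power N (Suc n)) +
     of_nat (Suc n) * (\<integral>\<^sup>+ y. \<integral>\<^sup>+ xs. G y (x # xs) \<partial>list_power N n \<partial>N) \<partial>N)"
    by (intro nn_integral_cong) (subst nn_integral_add, auto simp: IH)
  also have "\<dots> = ?I + of_nat (Suc n) * (\<integral>\<^sup>+ x. \<integral>\<^sup>+ y. \<integral>\<^sup>+ xs. G y (x # xs) \<partial>list_power N n \<partial>N \<partial>N)"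
    by (subst nn_integral_add) (auto simp: nn_integral_cmult)
  also have "(\<integral>\<^sup>+ x. \<integral>\<^sup>+ y. \<integral>\<^sup>+ xs. G y (x # xs) \<partial>list_power N n \<partial>N \<partial>N) =
    (\<integral>\<^sup>+ y. \<integral>\<^sup>+ x. \<integral>\<^sup>+ xs. G y (x # xs) \<partial>list_power N n \<partial>N \<partial>N)"
    by (rule Fubini') measurable
  also have "\<dots> = ?I"
    by (intro nn_integral_cong) (simp add: nn_integral_list_power_Suc)
  finally show ?case
    by (simp add: distrib_right)
qed

text \<open>A hidden point that is summed over was either missed, with weight \<open>q\<close>, or it accounts for
  one of the entries of \<open>zs\<close>.\<close>

lemma J_removal_sum:
  assumes "(\<lambda>(x, xs). G x xs) \<in> borel_measurable (N \<Otimes>\<^sub>M list_space N)" "zs \<in> lists (space N)"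
  shows "J (removal_sum G) zs =
    (\<integral>\<^sup>+ x. ennreal q * J (G x) zs + removal_sum (\<lambda>w ws. k w x * J (G x) ws) zs \<partial>N)"
  using assms(2,1)
proof (induction zs arbitrary: G)
  case Nil
  note [measurable] = Nil
  interpret pair_sigma_finite N mix ..
  have "J (removal_sum G) [] =
    (\<Sum>n. ennreal (q ^ n / fact n) * (\<integral>\<^sup>+ xs. removal_sum G xs \<partial>list_power N n))"
    by (rule J_sum_list_power) measurable
  \<comment> \<open>The term \<open>n = 0\<close> drops out, as the empty list has no entry to
    remove.\<close>
  also have "\<dots> = (\<Sum>n. ennreal (q ^ Suc n / fact (Suc n)) * (\<integral>\<^sup>+ xs. removal_sum G xs \<partial>list_power N (Suc n)))"
    by (subst suminf_offset[where i = 1]) (auto simp: list_power_0)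
  also have "\<dots> = (\<Sum>n. ennreal q * (\<integral>\<^sup>+ x. ennreal (q ^ n / fact n) * (\<integral>\<^sup>+ xs. G x xs \<partial>list_power N n) \<partial>N))"
  proof (rule suminf_cong)
    fix n
    interpret L: sigma_finite_measure "list_power N n" by (rule sigma_finite_list_power)
    \<comment> \<open>The \<open>Suc n\<close> equal removals cancel one factor of the factorial and
      leave the factor \<open>q\<close> of a missed point.\<close>
    have "q ^ Suc n / fact (Suc n) * real (Suc n) = q * (q ^ n / fact n)"
      by (simp add: field_simps del: of_nat_Suc)
    then have "ennreal (q ^ Suc n / fact (Suc n)) * of_nat (Suc n) = ennreal (q * (q ^ n / fact n))"
      using q_nonneg
      by (subst ennreal_of_nat_eq_real_of_nat, subst ennreal_mult[symmetric]) (auto simp del: of_nat_Suc fact_Suc)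
    also have "\<dots> = ennreal q * ennreal (q ^ n / fact n)"
      using q_nonneg by (intro ennreal_mult) auto
    finally show "ennreal (q ^ Suc n / fact (Suc n)) * (\<integral>\<^sup>+ xs. removal_sum G xs \<partial>list_power N (Suc n)) =
      ennreal q * (\<integral>\<^sup>+ x. ennreal (q ^ n / fact n) * (\<integral>\<^sup>+ xs. G x xs \<partial>list_power N n) \<partial>N)"
      unfolding nn_integral_removal_sum[OF Nil] mult.assoc[symmetric]
      by (simp add: nn_integral_cmult mult.assoc del: of_nat_Suc)
  qed
  also have "\<dots> = ennreal q * (\<integral>\<^sup>+ x. (\<Sum>n. ennreal (q ^ n / fact n) * (\<integral>\<^sup>+ xs. G x xs \<partial>list_power N n)) \<partial>N)"
  proof -
    have "(\<lambda>x. ennreal (q ^ n / fact n) * (\<integral>\<^sup>+ xs. G x xs \<partial>list_power N n)) \<in> borel_measurable N" for n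
    proof -
      interpret L: sigma_finite_measure "list_power N n" by (rule sigma_finite_list_power)
      show ?thesis by measurable
    qed
    then show ?thesis
      by (subst nn_integral_suminf) auto
  qed
  also have "\<dots> = ennreal q * (\<integral>\<^sup>+ x. J (G x) [] \<partial>N)"
    by (intro arg_cong2[where f = "(*)"] nn_integral_cong) (auto simp: J_sum_list_power simp del: assoc_int.simps)
  also have "\<dots> = (\<integral>\<^sup>+ x. ennreal q * J (G x) [] \<partial>N)"
    by (rule nn_integral_cmult[symmetric]) measurable
  finally show ?case
    by simp
next
  case (Cons z zs)
  note [measurable] = Cons.prems(1)
  have sp: "zs \<in> lists (space N)" using Cons.hyps by auto
  have [measurable]: "zs \<in> space (list_space N)" "z \<in> space N"
    using Cons.hyps by (auto simp: space_list_space)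
  interpret pair_sigma_finite N N by (rule pair_sigma_finite_N)
  let ?R = "\<lambda>y. removal_sum (\<lambda>w ws. k w y * J (G y) ws) zs"
  let ?G = "\<lambda>x y ys. G y (x # ys)"
  let ?H = "\<lambda>x y. ennreal q * J (?G x y) zs + removal_sum (\<lambda>w ws. k w y * J (?G x y) ws) zs"
  have IH: "J (removal_sum (?G x)) zs = (\<integral>\<^sup>+ y. ?H x y \<partial>N)" if "x \<in> space N" for x
    by (rule Cons.IH) (use that in measurable)
  \<comment> \<open>\<open>R\<close> covers removals from the tail \<open>zs\<close>, where
    \<open>z\<close> stays and is expanded as clutter or as linked to \<open>x\<close>; the removal
    of \<open>z\<close> itself enters through the terms \<open>k z y * J (G y) zs\<close>
    below.\<close>
  have R: "removal_sum (\<lambda>w ws. k w y * J (G y) (z # ws)) zs =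
     c z * ?R y + (\<integral>\<^sup>+ x. k z x * removal_sum (\<lambda>w ws. k w y * J (?G x y) ws) zs \<partial>N)"
    if [measurable]: "y \<in> space N" for y
  proof -
    have "removal_sum (\<lambda>w ws. k w y * J (G y) (z # ws)) zs =
      removal_sum (\<lambda>w ws. c z * (k w y * J (G y) ws) + (\<integral>\<^sup>+ x. k z x * (k w y * J (?G x y) ws) \<partial>N)) zs"
    proof (rule removal_sum_cong[OF sp])
      fix w ws assume "w \<in> space N" "ws \<in> lists (space N)"
      then have [measurable]: "w \<in> space N" "ws \<in> space (list_space N)"
        by (auto simp: space_list_space)
      have "k w y * (\<integral>\<^sup>+ x. k z x * J (?G x y) ws \<partial>N) = (\<integral>\<^sup>+ x. k w y * (k z x * J (?G x y) ws) \<partial>N)"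
        by (rule nn_integral_cmult[symmetric]) measurable
      then show "k w y * J (G y) (z # ws) = c z * (k w y * J (G y) ws) + (\<integral>\<^sup>+ x. k z x * (k w y * J (?G x y) ws) \<partial>N)"
        by (simp add: distrib_left mult_ac)
    qed
    also have "\<dots> = c z * ?R y + removal_sum (\<lambda>w ws. \<integral>\<^sup>+ x. k z x * (k w y * J (?G x y) ws) \<partial>N) zs"
      by (simp only: removal_sum_add removal_sum_cmult)
    also have "removal_sum (\<lambda>w ws. \<integral>\<^sup>+ x. k z x * (k w y * J (?G x y) ws) \<partial>N) zs =
      (\<integral>\<^sup>+ x. removal_sum (\<lambda>w ws. k z x * (k w y * J (?G x y) ws)) zs \<partial>N)"
    proof (rule removal_sum_nn_integral[OF sp])
      fix w ws assume "w \<in> space N" "ws \<in> lists (space N)"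
      then have [measurable]: "w \<in> space N" "ws \<in> space (list_space N)"
        by (auto simp: space_list_space)
      show "(\<lambda>x. k z x * (k w y * J (?G x y) ws)) \<in> borel_measurable N"
        by measurable
    qed
    finally show ?thesis
      by (simp add: removal_sum_cmult)
  qed
  \<comment> \<open>If \<open>z\<close> is linked to \<open>x\<close>, the removed entry is either
    \<open>x\<close> itself, which gives \<open>G x xs\<close>, or one of the remaining
    points.\<close>
  have "J (removal_sum G) (z # zs) = c z * J (removal_sum G) zs +
     (\<integral>\<^sup>+ x. k z x * J (\<lambda>xs. G x xs + removal_sum (?G x) xs) zs \<partial>N)"
    by simp
  also have "(\<integral>\<^sup>+ x. k z x * J (\<lambda>xs. G x xs + removal_sum (?G x) xs) zs \<partial>N) =
    (\<integral>\<^sup>+ x. k z x * J (G x) zs + (\<integral>\<^sup>+ y. k z x * ?H x y \<partial>N) \<partial>N)"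
  proof (rule nn_integral_cong)
    fix x assume [measurable]: "x \<in> space N"
    have "J (\<lambda>xs. G x xs + removal_sum (?G x) xs) zs = J (G x) zs + J (removal_sum (?G x)) zs"
      by (rule J_add[OF _ _ sp]) measurable
    moreover have "k z x * J (removal_sum (?G x)) zs = (\<integral>\<^sup>+ y. k z x * ?H x y \<partial>N)"
      unfolding IH[OF \<open>x \<in> space N\<close>] by (rule nn_integral_cmult[symmetric]) measurable
    ultimately show "k z x * J (\<lambda>xs. G x xs + removal_sum (?G x) xs) zs =
        k z x * J (G x) zs + (\<integral>\<^sup>+ y. k z x * ?H x y \<partial>N)"
      by (simp only: distrib_left[of "k z x" "J (G x) zs"])
  qed
  also have "\<dots> = (\<integral>\<^sup>+ x. k z x * J (G x) zs \<partial>N) + (\<integral>\<^sup>+ x. \<integral>\<^sup>+ y. k z x * ?H x y \<partial>N \<partial>N)"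
    by (intro nn_integral_add) measurable
  also have "(\<integral>\<^sup>+ x. \<integral>\<^sup>+ y. k z x * ?H x y \<partial>N \<partial>N) = (\<integral>\<^sup>+ y. \<integral>\<^sup>+ x. k z x * ?H x y \<partial>N \<partial>N)"
    by (rule Fubini') measurable
  also have "c z * J (removal_sum G) zs = (\<integral>\<^sup>+ y. c z * (ennreal q * J (G y) zs + ?R y) \<partial>N)"
    unfolding Cons.IH[OF Cons.prems] by (rule nn_integral_cmult[symmetric]) measurable
  finally have "J (removal_sum G) (z # zs) = (\<integral>\<^sup>+ y. c z * (ennreal q * J (G y) zs + ?R y) \<partial>N) +
     ((\<integral>\<^sup>+ y. k z y * J (G y) zs \<partial>N) + (\<integral>\<^sup>+ y. \<integral>\<^sup>+ x. k z x * ?H x y \<partial>N \<partial>N))" .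
  also have "\<dots> = (\<integral>\<^sup>+ y. c z * (ennreal q * J (G y) zs + ?R y) + (k z y * J (G y) zs + (\<integral>\<^sup>+ x. k z x * ?H x y \<partial>N)) \<partial>N)"
  proof -
    let ?A = "\<lambda>y. c z * (ennreal q * J (G y) zs + ?R y)" and ?B = "\<lambda>y. k z y * J (G y) zs"
      and ?C = "\<lambda>y. \<integral>\<^sup>+ x. k z x * ?H x y \<partial>N"
    have "(\<integral>\<^sup>+ y. ?B y + ?C y \<partial>N) = (\<integral>\<^sup>+ y. ?B y \<partial>N) + (\<integral>\<^sup>+ y. ?C y \<partial>N)"
      by (rule nn_integral_add) measurable
    moreover have "(\<integral>\<^sup>+ y. ?A y + (?B y + ?C y) \<partial>N) = (\<integral>\<^sup>+ y. ?A y \<partial>N) + (\<integral>\<^sup>+ y. ?B y + ?C y \<partial>N)"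
      by (rule nn_integral_add) measurable
    ultimately show ?thesis
      by (simp only:)
  qed
  also have "\<dots> = (\<integral>\<^sup>+ y. ennreal q * J (G y) (z # zs) + removal_sum (\<lambda>w ws. k w y * J (G y) ws) (z # zs) \<partial>N)"
  proof (rule nn_integral_cong)
    fix y assume [measurable]: "y \<in> space N"
    have "(\<integral>\<^sup>+ x. k z x * ?H x y \<partial>N) = (\<integral>\<^sup>+ x. ennreal q * (k z x * J (?G x y) zs) +
        k z x * removal_sum (\<lambda>w ws. k w y * J (?G x y) ws) zs \<partial>N)"
      by (intro nn_integral_cong) (simp add: distrib_left mult_ac)
    also have "\<dots> = (\<integral>\<^sup>+ x. ennreal q * (k z x * J (?G x y) zs) \<partial>N) +
        (\<integral>\<^sup>+ x. k z x * removal_sum (\<lambda>w ws. k w y * J (?G x y) ws) zs \<partial>N)"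
      by (rule nn_integral_add) measurable
    also have "(\<integral>\<^sup>+ x. ennreal q * (k z x * J (?G x y) zs) \<partial>N) = ennreal q * (\<integral>\<^sup>+ x. k z x * J (?G x y) zs \<partial>N)"
      by (rule nn_integral_cmult) measurable
    finally show "c z * (ennreal q * J (G y) zs + ?R y) + (k z y * J (G y) zs + (\<integral>\<^sup>+ x. k z x * ?H x y \<partial>N)) =
      ennreal q * J (G y) (z # zs) + removal_sum (\<lambda>w ws. k w y * J (G y) ws) (z # zs)"
      unfolding removal_sum.simps R[OF \<open>y \<in> space N\<close>] by (simp add: distrib_left mult_ac add_ac)
  qed
  finally show ?case .
qed

section \<open>Expansion over the sets of linked measurements\<close>

text \<open>The likelihood that the leading entries of \<open>xs\<close> produce \<open>ws\<close>
  in order. The value 0 on shorter lists is a convention: below, the function is integrated over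
  lists of length at least \<open>length ws\<close>.\<close>

definition link_weight :: "'a list \<Rightarrow> 'a list \<Rightarrow> ennreal" where
  "link_weight ws xs = (if length xs < length ws then 0 else \<Prod>i<length ws. k (ws ! i) (xs ! i))"

lemma link_weight_Nil [simp]: "link_weight [] xs = 1"
  by (simp add: link_weight_def)

lemma link_weight_Cons [simp]: "link_weight (w # ws) (x # xs) = k w x * link_weight ws xs"
  by (simp add: link_weight_def prod.lessThan_Suc_shift del: prod.lessThan_Suc)

lemma link_weight_measurable [measurable]:
  assumes "ws \<in> lists (space N)"
  shows "link_weight ws \<in> borel_measurable (list_space N)"
proof (rule measurable_list_spaceI)
  fix n
  have "(\<lambda>x. \<Prod>i<length ws. k (ws ! i) (x i)) \<in> borel_measurable (PiM {..<n} (\<lambda>_. N))" if "length ws \<le> n"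
  proof (rule borel_measurable_prod_ennreal)
    fix i assume "i \<in> {..<length ws}"
    then have [measurable]: "ws ! i \<in> space N" "i \<in> {..<n}"
      using assms that by (auto simp: in_lists_conv_set)
    show "(\<lambda>x. k (ws ! i) (x i)) \<in> borel_measurable (PiM {..<n} (\<lambda>_. N))"
      by measurable
  qed
  then show "(\<lambda>x. link_weight ws (map x [0..<n])) \<in> borel_measurable (PiM {..<n} (\<lambda>_. N))"
    by (cases "n < length ws") (simp_all add: link_weight_def cong: prod.cong_simp)
qed

text \<open>The part of the recursion in which every listed measurement is linked, that is, the
  contribution of one set \<open>S\<close> without its clutter factors. The nested form agrees with
  the recursion of \<open>J\<close>, and \<open>link_int_eq\<close> turns it into the single
  integral of the stated densities.\<close>

primrec link_int :: "('a list \<Rightarrow> ennreal) \<Rightarrow> 'a list \<Rightarrow> ennreal" where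
  "link_int F [] = J F []"
| "link_int F (w # ws) = (\<integral>\<^sup>+ x. k w x * link_int (\<lambda>xs. F (x # xs)) ws \<partial>N)"

text \<open>The index \<open>n\<close> counts the missed points, so the power measure has
  \<open>n + length ws\<close> coordinates, the linked ones first.\<close>

lemma link_int_eq:
  assumes "F \<in> borel_measurable (list_space N)" "ws \<in> lists (space N)"
  shows "link_int F ws = (\<Sum>n. ennreal (q ^ n / fact n) *
    (\<integral>\<^sup>+ xs. F xs * link_weight ws xs \<partial>list_power N (n + length ws)))"
  using assms(2,1)
proof (induction ws arbitrary: F)
  case Nil
  then show ?case by (simp add: J_sum_list_power del: assoc_int.simps)
next
  case (Cons w ws)
  note [measurable] = Cons.prems
  have ws [measurable]: "ws \<in> lists (space N)" "w \<in> space N" using Cons.hyps by auto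
  have [measurable]: "(\<lambda>x. \<integral>\<^sup>+ xs. F (x # xs) * link_weight ws xs \<partial>list_power N n) \<in> borel_measurable N" for n
  proof -
    interpret L: sigma_finite_measure "list_power N n" by (rule sigma_finite_list_power)
    show ?thesis by measurable
  qed
  have "link_int F (w # ws) = (\<integral>\<^sup>+ x. (\<Sum>n. ennreal (q ^ n / fact n) *
      (k w x * (\<integral>\<^sup>+ xs. F (x # xs) * link_weight ws xs \<partial>list_power N (n + length ws)))) \<partial>N)"
    by (auto simp: Cons.IH ennreal_suminf_cmult[symmetric] mult_ac simp del: ennreal_suminf_cmult intro!: nn_integral_cong)
  also have "\<dots> = (\<Sum>n. ennreal (q ^ n / fact n) *
      (\<integral>\<^sup>+ x. k w x * (\<integral>\<^sup>+ xs. F (x # xs) * link_weight ws xs \<partial>list_power N (n + length ws)) \<partial>N))"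
    by (simp add: nn_integral_suminf nn_integral_cmult)
  also have "\<dots> = (\<Sum>n. ennreal (q ^ n / fact n) *
    (\<integral>\<^sup>+ xs. F xs * link_weight (w # ws) xs \<partial>list_power N (n + length (w # ws))))"
  proof (intro suminf_cong arg_cong2[where f = "(*)"] refl)
    fix n
    have "(\<integral>\<^sup>+ xs. F xs * link_weight (w # ws) xs \<partial>list_power N (Suc (n + length ws))) =
      (\<integral>\<^sup>+ x. \<integral>\<^sup>+ xs. k w x * (F (x # xs) * link_weight ws xs) \<partial>list_power N (n + length ws) \<partial>N)"
      using Cons.hyps by (subst nn_integral_list_power_Suc) (auto simp: mult_ac)
    also have "\<dots> = (\<integral>\<^sup>+ x. k w x * (\<integral>\<^sup>+ xs. F (x # xs) * link_weight ws xs \<partial>list_power N (n + length ws)) \<partial>N)"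
      by (intro nn_integral_cong nn_integral_cmult) measurable
    finally show "(\<integral>\<^sup>+ x. k w x * (\<integral>\<^sup>+ xs. F (x # xs) * link_weight ws xs \<partial>list_power N (n + length ws)) \<partial>N) =
      (\<integral>\<^sup>+ xs. F xs * link_weight (w # ws) xs \<partial>list_power N (n + length (w # ws)))"
      by simp
  qed
  finally show ?case .
qed

text \<open>A subset of \<open>{..<Suc n}\<close> omits or contains 0, and its other elements are
  shifted by one. In the application 0 is the position of the first measurement, which is clutter or
  linked accordingly.\<close>

lemma sum_Pow_lessThan_Suc:
  fixes g :: "nat set \<Rightarrow> 'b :: comm_monoid_add"
  shows "(\<Sum>S\<in>Pow {..<Suc n}. g S) = (\<Sum>S\<in>Pow {..<n}. g (Suc ` S)) + (\<Sum>S\<in>Pow {..<n}. g (insert 0 (Suc ` S)))"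
proof -
  have inj: "inj_on (\<lambda>S. Suc ` S) A" for A
    by (auto intro!: inj_onI simp: inj_image_eq_iff)
  have eq: "Pow {..<Suc n} = (\<lambda>S. Suc ` S) ` Pow {..<n} \<union> insert 0 ` (\<lambda>S. Suc ` S) ` Pow {..<n}"
    by (simp add: lessThan_Suc_eq_insert_0 Pow_insert image_Pow_surj)
  have inj2: "inj_on (insert 0) ((\<lambda>S. Suc ` S) ` Pow {..<n})"
    by (rule inj_onI) (auto simp: insert_ident)
  show ?thesis
    unfolding eq by (subst sum.union_disjoint) (auto simp: sum.reindex[OF inj2] sum.reindex[OF inj] o_def)
qed

text \<open>Multiplying out the recursion: each measurement selects one of its two summands, and
  \<open>S\<close> records those that are linked.\<close>

lemma J_conv_link_int:
  assumes "F \<in> borel_measurable (list_space N)" "ws \<in> lists (space N)"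
  shows "J F ws = (\<Sum>S\<in>Pow {..<length ws}. (\<Prod>j\<in>{..<length ws} - S. c (ws ! j)) * link_int F (nths ws S))"
  using assms(2,1)
proof (induction ws arbitrary: F)
  case (Cons w ws)
  note [measurable] = Cons.prems
  have ws [measurable]: "ws \<in> lists (space N)" "w \<in> space N" using Cons.hyps by auto
  let ?n = "length ws" and ?p = "\<lambda>S. \<Prod>j\<in>{..<length ws} - S. c (ws ! j)"
  have d0: "{..<Suc ?n} - Suc ` S = insert 0 (Suc ` ({..<?n} - S))" for S
    by (auto simp: lessThan_Suc_eq_insert_0)
  have d1: "{..<Suc ?n} - insert 0 (Suc ` S) = Suc ` ({..<?n} - S)" for S
    by (auto simp: lessThan_Suc_eq_insert_0)
  have p0: "(\<Prod>j\<in>{..<Suc ?n} - Suc ` S. c ((w # ws) ! j)) = c w * ?p S" for S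
    unfolding d0 by (subst prod.insert) (auto simp: prod.reindex)
  have p1: "(\<Prod>j\<in>{..<Suc ?n} - insert 0 (Suc ` S). c ((w # ws) ! j)) = ?p S" for S
    unfolding d1 by (simp add: prod.reindex)
  have n0: "nths (w # ws) (Suc ` S) = nths ws S" and n1: "nths (w # ws) (insert 0 (Suc ` S)) = w # nths ws S" for S
    by (auto simp: nths_Cons image_iff)
  have sub: "nths ws S \<in> lists (space N)" for S
    using ws(1) set_nths_subset[of ws S] by auto
  \<comment> \<open>Measurability in \<open>x\<close> is read off from the closed form, in which
    \<open>x\<close> enters under a single integral for each \<open>n\<close>.\<close>
  have [measurable]: "(\<lambda>x. link_int (\<lambda>xs. F (x # xs)) (nths ws S)) \<in> borel_measurable N" for S
  proof -
    have [measurable]: "(\<lambda>x. \<integral>\<^sup>+ xs. F (x # xs) * link_weight (nths ws S) xs \<partial>list_power N n) \<in> borel_measurable N" for n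
    proof -
      interpret L: sigma_finite_measure "list_power N n" by (rule sigma_finite_list_power)
      note link_weight_measurable[OF sub, measurable]
      show ?thesis by measurable
    qed
    have "(\<lambda>x. \<Sum>n. ennreal (q ^ n / fact n) *
      (\<integral>\<^sup>+ xs. F (x # xs) * link_weight (nths ws S) xs \<partial>list_power N (n + length (nths ws S)))) \<in> borel_measurable N"
      by measurable
    then show ?thesis
      by (subst measurable_cong[OF link_int_eq[OF _ sub]]) auto
  qed
  have "(\<integral>\<^sup>+ x. k w x * J (\<lambda>xs. F (x # xs)) ws \<partial>N) =
    (\<integral>\<^sup>+ x. (\<Sum>S\<in>Pow {..<?n}. ?p S * (k w x * link_int (\<lambda>xs. F (x # xs)) (nths ws S))) \<partial>N)"
    by (intro nn_integral_cong) (simp add: Cons.IH sum_distrib_left mult_ac)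
  also have "\<dots> = (\<Sum>S\<in>Pow {..<?n}. ?p S * link_int F (w # nths ws S))"
    by (subst nn_integral_sum) (auto simp: nn_integral_cmult)
  finally have "J F (w # ws) = (\<Sum>S\<in>Pow {..<?n}. c w * ?p S * link_int F (nths ws S)) +
     (\<Sum>S\<in>Pow {..<?n}. ?p S * link_int F (w # nths ws S))"
    by (simp only: assoc_int.simps Cons.IH[OF Cons.prems] sum_distrib_left mult.assoc)
  then show ?case
    by (simp only: list.size(4) add_0_right add_Suc_right One_nat_def sum_Pow_lessThan_Suc p0 p1 n0 n1)
qed simp

end

section \<open>Removal sums by position and for symmetric functions\<close>

lemma nths_Compl_0 [simp]: "nths (x # xs) (- {0}) = xs"
  by (simp add: nths_Cons) (metis nths_upt_eq_take UNIV_I nths_all)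

lemma nths_Compl_Suc: "nths (x # xs) (- {Suc r}) = x # nths xs (- {r})"
  by (simp add: nths_Cons Compl_eq)

lemma removal_sum_conv_nths:
  "removal_sum G xs = (\<Sum>r<length xs. G (xs ! r) (nths xs (- {r})))"
  by (induction xs arbitrary: G) (simp_all add: sum.lessThan_Suc_shift nths_Compl_Suc del: sum.lessThan_Suc)

text \<open>Nested removal meets positions of a shortened list; complements of position sets refer
  to the original one and avoid the shift. In the induction the head is removed first, removed
  second, or kept, which gives the three sums.\<close>

lemma removal_sum_removal_sum_conv_nths:
  "removal_sum (\<lambda>w ws. removal_sum (G w) ws) xs =
     (\<Sum>r<length xs. \<Sum>u\<in>{..<length xs} - {r}. G (xs ! r) (xs ! u) (nths xs (- {r, u})))"
proof (induction xs arbitrary: G)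
  case (Cons x xs)
  let ?n = "length xs"
  have s0: "{..<Suc ?n} - {0} = Suc ` {..<?n}"
    by (auto simp: lessThan_Suc_eq_insert_0)
  have s1: "{..<Suc ?n} - {Suc r} = insert 0 (Suc ` ({..<?n} - {r}))" for r
    by (auto simp: lessThan_Suc_eq_insert_0)
  have n0: "nths (x # xs) (- {0, Suc u}) = nths xs (- {u})" "nths (x # xs) (- {Suc u, 0}) = nths xs (- {u})" for u
    by (simp_all add: nths_Cons Compl_eq)
  have n1: "nths (x # xs) (- {Suc r, Suc u}) = x # nths xs (- {r, u})" for r u
    by (simp add: nths_Cons Compl_eq)
  have "removal_sum (\<lambda>w ws. removal_sum (G w) ws) (x # xs) = removal_sum (G x) xs +
     (removal_sum (\<lambda>w ws. G w x ws) xs + removal_sum (\<lambda>w ws. removal_sum (\<lambda>v vs. G w v (x # vs)) ws) xs)"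
    by (simp add: removal_sum_add)
  also have "\<dots> = (\<Sum>u<?n. G x (xs ! u) (nths xs (- {u}))) + ((\<Sum>r<?n. G (xs ! r) x (nths xs (- {r}))) +
      (\<Sum>r<?n. \<Sum>u\<in>{..<?n} - {r}. G (xs ! r) (xs ! u) (x # nths xs (- {r, u}))))"
    using Cons.IH[of "\<lambda>w v vs. G w v (x # vs)"] by (simp add: removal_sum_conv_nths)
  also have "\<dots> = (\<Sum>r<Suc ?n. \<Sum>u\<in>{..<Suc ?n} - {r}. G ((x # xs) ! r) ((x # xs) ! u) (nths (x # xs) (- {r, u})))"
    unfolding sum.lessThan_Suc_shift s0 s1
    by (simp add: sum.reindex sum.distrib n0 n1)
  finally show ?case by simp
qed simp

text \<open>A symmetric function does not notice that the removed entry is put in front, so it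
  factors out. Read from right to left, this makes a sum over hidden points a removal sum, to which
  \<open>J_removal_sum\<close> applies.\<close>

lemma removal_sum_symmetric:
  assumes "symmetric_on S F" "xs \<in> lists S"
  shows "removal_sum (\<lambda>y ys. a y * F (y # ys)) xs = (\<Sum>y\<leftarrow>xs. a y) * F xs"
proof -
  have eq: "F (xs ! i # take i xs @ drop (Suc i) xs) = F xs" if "i < length xs" for i
  proof (rule symmetric_onD[OF assms(1), symmetric])
    show "mset xs = mset (xs ! i # take i xs @ drop (Suc i) xs)"
      using that by (subst id_take_nth_drop[OF that]) simp
  qed fact
  have "removal_sum (\<lambda>y ys. a y * F (y # ys)) xs = (\<Sum>i<length xs. a (xs ! i) * F xs)"
    unfolding removal_sum_conv_sum by (intro sum.cong refl) (simp add: eq)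
  then show ?thesis
    by (simp add: sum_list_sum_nth atLeast0LessThan sum_distrib_right)
qed

lemma removal_sum_removal_sum_symmetric:
  assumes F: "symmetric_on S F" and xs: "xs \<in> lists S" and h: "\<And>x. h x x = 0"
  shows "removal_sum (\<lambda>x ys. removal_sum (\<lambda>y zs. h x y * F (x # y # zs)) ys) xs =
    (\<Sum>x\<leftarrow>xs. \<Sum>y\<leftarrow>xs. h x y) * F xs"
proof -
  have "removal_sum (\<lambda>x ys. removal_sum (\<lambda>y zs. h x y * F (x # y # zs)) ys) xs =
    removal_sum (\<lambda>x ys. (\<Sum>y\<leftarrow>ys. h x y) * F (x # ys)) xs"
    by (rule removal_sum_cong[OF xs]) (rule removal_sum_symmetric[OF symmetric_on_Cons[OF F]])
  also have "\<dots> = (\<Sum>i<length xs. (\<Sum>y\<leftarrow>xs. h (xs ! i) y) * F (xs ! i # take i xs @ drop (Suc i) xs))"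
    unfolding removal_sum_conv_sum
  proof (intro sum.cong refl arg_cong2[where f = "(*)"])
    fix i assume "i \<in> {..<length xs}"
    \<comment> \<open>The removed entry may be put back into the inner sum, because its term
      \<open>h (xs ! i) (xs ! i)\<close> is 0.\<close>
    then show "(\<Sum>y\<leftarrow>take i xs @ drop (Suc i) xs. h (xs ! i) y) = (\<Sum>y\<leftarrow>xs. h (xs ! i) y)"
      by (subst (4) id_take_nth_drop[of i]) (auto simp: h)
  qed
  also have "\<dots> = removal_sum (\<lambda>x ys. (\<Sum>y\<leftarrow>xs. h x y) * F (x # ys)) xs"
    by (simp add: removal_sum_conv_sum)
  also have "\<dots> = (\<Sum>x\<leftarrow>xs. \<Sum>y\<leftarrow>xs. h x y) * F xs"
    by (rule removal_sum_symmetric[OF F xs])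
  finally show ?thesis .
qed

context association
begin

text \<open>The three terms sort the pairs by whether both points are missed, exactly one is, or
  none. In the last case two different measurements are removed, since the second removal acts on
  the list that the first one leaves.\<close>

lemma J_pair_sum:
  assumes h: "(\<lambda>(x, y). h x y) \<in> borel_measurable (N \<Otimes>\<^sub>M N)" "\<And>x. h x x = 0"
    and F: "F \<in> borel_measurable (list_space N)" "symmetric_on (space N) F"
    and zs: "zs \<in> lists (space N)"
  shows "J (\<lambda>xs. (\<Sum>x\<leftarrow>xs. \<Sum>y\<leftarrow>xs. h x y) * F xs) zs =
    (\<integral>\<^sup>+ x. \<integral>\<^sup>+ y. h x y *
       (ennreal q ^ 2 * J (\<lambda>xs. F (x # y # xs)) zs
        + ennreal q * removal_sum (\<lambda>w ws. (k w x + k w y) * J (\<lambda>xs. F (x # y # xs)) ws) zs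
        + removal_sum (\<lambda>w ws. removal_sum (\<lambda>v vs. k w x * k v y * J (\<lambda>xs. F (x # y # xs)) vs) ws) zs) \<partial>N \<partial>N)"
proof -
  note [measurable] = h(1) F(1)
  have zs' [measurable]: "zs \<in> space (list_space N)"
    using zs by (simp add: space_list_space)
  let ?F = "\<lambda>x y xs. F (x # y # xs)"
  let ?G = "\<lambda>x y xs. h x y * ?F x y xs"
  have G: "J (?G x y) ws = h x y * J (?F x y) ws"
    if [measurable]: "x \<in> space N" "y \<in> space N" and "ws \<in> lists (space N)" for x y ws
    by (rule J_cmult) (measurable, fact)
  have 1: "J (removal_sum (?G x)) ws = (\<integral>\<^sup>+ y. h x y * (ennreal q * J (?F x y) ws +
      removal_sum (\<lambda>v vs. k v y * J (?F x y) vs) ws) \<partial>N)"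
    if x [measurable]: "x \<in> space N" and ws: "ws \<in> lists (space N)" for x ws
  proof -
    have "J (removal_sum (?G x)) ws = (\<integral>\<^sup>+ y. ennreal q * J (?G x y) ws +
       removal_sum (\<lambda>v vs. k v y * J (?G x y) vs) ws \<partial>N)"
      by (rule J_removal_sum[OF _ ws]) measurable
    also have "\<dots> = (\<integral>\<^sup>+ y. h x y * (ennreal q * J (?F x y) ws + removal_sum (\<lambda>v vs. k v y * J (?F x y) vs) ws) \<partial>N)"
    proof (rule nn_integral_cong)
      fix y assume y: "y \<in> space N"
      have "removal_sum (\<lambda>v vs. k v y * J (?G x y) vs) ws = removal_sum (\<lambda>v vs. h x y * (k v y * J (?F x y) vs)) ws"
        by (rule removal_sum_cong[OF ws]) (simp add: G x y mult_ac)
      then show "ennreal q * J (?G x y) ws + removal_sum (\<lambda>v vs. k v y * J (?G x y) vs) ws =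
         h x y * (ennreal q * J (?F x y) ws + removal_sum (\<lambda>v vs. k v y * J (?F x y) vs) ws)"
        by (simp add: G x y ws removal_sum_cmult distrib_left mult_ac)
    qed
    finally show ?thesis .
  qed
  have "J (\<lambda>xs. (\<Sum>x\<leftarrow>xs. \<Sum>y\<leftarrow>xs. h x y) * F xs) zs = J (removal_sum (\<lambda>x. removal_sum (?G x))) zs"
    by (rule J_cong, rule removal_sum_removal_sum_symmetric[OF F(2) _ h(2), symmetric])
  also have "\<dots> = (\<integral>\<^sup>+ x. ennreal q * J (removal_sum (?G x)) zs +
      removal_sum (\<lambda>w ws. k w x * J (removal_sum (?G x)) ws) zs \<partial>N)"
    by (rule J_removal_sum[OF _ zs]) measurable
  also have "\<dots> = (\<integral>\<^sup>+ x. \<integral>\<^sup>+ y. h x y *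
       (ennreal q ^ 2 * J (?F x y) zs
        + ennreal q * removal_sum (\<lambda>w ws. (k w x + k w y) * J (?F x y) ws) zs
        + removal_sum (\<lambda>w ws. removal_sum (\<lambda>v vs. k w x * k v y * J (?F x y) vs) ws) zs) \<partial>N \<partial>N)"
  proof (rule nn_integral_cong)
    fix x assume x [measurable]: "x \<in> space N"
    let ?T = "\<lambda>y ws. ennreal q * J (?F x y) ws + removal_sum (\<lambda>v vs. k v y * J (?F x y) vs) ws"
    have "removal_sum (\<lambda>w ws. k w x * J (removal_sum (?G x)) ws) zs =
      removal_sum (\<lambda>w ws. \<integral>\<^sup>+ y. k w x * (h x y * ?T y ws) \<partial>N) zs"
    proof (rule removal_sum_cong[OF zs])
      fix w ws assume "w \<in> space N" and ws: "ws \<in> lists (space N)"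
      then have [measurable]: "w \<in> space N" "ws \<in> space (list_space N)"
        by (auto simp: space_list_space)
      show "k w x * J (removal_sum (?G x)) ws = (\<integral>\<^sup>+ y. k w x * (h x y * ?T y ws) \<partial>N)"
        unfolding 1[OF x ws] by (rule nn_integral_cmult[symmetric]) measurable
    qed
    also have "\<dots> = (\<integral>\<^sup>+ y. removal_sum (\<lambda>w ws. k w x * (h x y * ?T y ws)) zs \<partial>N)"
    proof (rule removal_sum_nn_integral[OF zs])
      fix w ws assume "w \<in> space N" and ws: "ws \<in> lists (space N)"
      then have [measurable]: "w \<in> space N" "ws \<in> space (list_space N)"
        by (auto simp: space_list_space)
      show "(\<lambda>y. k w x * (h x y * ?T y ws)) \<in> borel_measurable N"
        by measurable
    qed
    finally have "ennreal q * J (removal_sum (?G x)) zs + removal_sum (\<lambda>w ws. k w x * J (removal_sum (?G x)) ws) zs =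
      ennreal q * (\<integral>\<^sup>+ y. h x y * ?T y zs \<partial>N) + (\<integral>\<^sup>+ y. removal_sum (\<lambda>w ws. k w x * (h x y * ?T y ws)) zs \<partial>N)"
      unfolding 1[OF x zs] by simp
    also have "ennreal q * (\<integral>\<^sup>+ y. h x y * ?T y zs \<partial>N) = (\<integral>\<^sup>+ y. ennreal q * (h x y * ?T y zs) \<partial>N)"
      by (rule nn_integral_cmult[symmetric]) measurable
    also have "(\<integral>\<^sup>+ y. ennreal q * (h x y * ?T y zs) \<partial>N) + (\<integral>\<^sup>+ y. removal_sum (\<lambda>w ws. k w x * (h x y * ?T y ws)) zs \<partial>N) =
      (\<integral>\<^sup>+ y. ennreal q * (h x y * ?T y zs) + removal_sum (\<lambda>w ws. k w x * (h x y * ?T y ws)) zs \<partial>N)"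
      by (rule nn_integral_add[symmetric]) measurable
    also have "\<dots> = (\<integral>\<^sup>+ y. h x y * (ennreal q ^ 2 * J (?F x y) zs
        + ennreal q * removal_sum (\<lambda>w ws. (k w x + k w y) * J (?F x y) ws) zs
        + removal_sum (\<lambda>w ws. removal_sum (\<lambda>v vs. k w x * k v y * J (?F x y) vs) ws) zs) \<partial>N)"
    proof (rule nn_integral_cong)
      fix y
      have "removal_sum (\<lambda>w ws. k w x * (h x y * ?T y ws)) zs =
        h x y * (ennreal q * removal_sum (\<lambda>w ws. k w x * J (?F x y) ws) zs
          + removal_sum (\<lambda>w ws. removal_sum (\<lambda>v vs. k w x * k v y * J (?F x y) vs) ws) zs)"
        unfolding removal_sum_cmult[symmetric] removal_sum_add[symmetric]
        by (intro arg_cong2[where f = removal_sum] ext refl)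
           (simp add: removal_sum_cmult distrib_left mult_ac)
      \<comment> \<open>The two mixed cases come from different places: \<open>k w y\<close> from
        the inner removal with \<open>x\<close> missed, \<open>k w x\<close> from the outer one with
        \<open>y\<close> missed.\<close>
      moreover have "removal_sum (\<lambda>w ws. (k w x + k w y) * J (?F x y) ws) zs =
        removal_sum (\<lambda>w ws. k w x * J (?F x y) ws) zs + removal_sum (\<lambda>w ws. k w y * J (?F x y) ws) zs"
        by (simp add: distrib_right removal_sum_add)
      ultimately show "ennreal q * (h x y * ?T y zs) + removal_sum (\<lambda>w ws. k w x * (h x y * ?T y ws)) zs =
        h x y * (ennreal q ^ 2 * J (?F x y) zs
        + ennreal q * removal_sum (\<lambda>w ws. (k w x + k w y) * J (?F x y) ws) zs
        + removal_sum (\<lambda>w ws. removal_sum (\<lambda>v vs. k w x * k v y * J (?F x y) vs) ws) zs)"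
        by (simp add: distrib_left power2_eq_square mult_ac add_ac)
    qed
    finally show "ennreal q * J (removal_sum (?G x)) zs + removal_sum (\<lambda>w ws. k w x * J (removal_sum (?G x)) ws) zs = \<dots>" .
  qed
  finally show ?thesis .
qed

end

section \<open>Model parameters and the association sums of the statement\<close>

locale measurement = finite_measure N for N :: "'a measure" +
  fixes p :: real and ld :: "'a \<Rightarrow> 'a \<Rightarrow> real" and lc :: "'a \<Rightarrow> real"
  assumes p_pos: "0 < p" and p_le_1: "p \<le> 1"
    and ld_measurable [measurable]: "(\<lambda>(z, x). ld z x) \<in> borel_measurable (N \<Otimes>\<^sub>M N)"
    and ld_nonneg: "\<And>z x. z \<in> space N \<Longrightarrow> x \<in> space N \<Longrightarrow> 0 \<le> ld z x"
    and ld_normalized: "\<And>x. x \<in> space N \<Longrightarrow> (\<integral>\<^sup>+ z. ennreal (ld z x) \<partial>N) = 1"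
    and lc_integrable: "integrable N lc"
    and lc_nonneg: "\<And>z. z \<in> space N \<Longrightarrow> 0 \<le> lc z"
begin

lemma lc_measurable [measurable]: "lc \<in> borel_measurable N"
  using lc_integrable by (rule borel_measurable_integrable)

sublocale association N "1 - p" "\<lambda>z x. ennreal (p * ld z x)" "\<lambda>z. ennreal (lc z)"
  by unfold_locales (use p_pos p_le_1 in auto)

text \<open>Connects the closed form with the recursion. Replacing \<open>n\<close> by
  \<open>n + card S\<close> splits the hidden points into linked and missed ones; nonnegativity of
  \<open>f\<close>, of the displacement density and of the intensity lets \<open>ennreal\<close>
  pass through the products.\<close>

lemma assoc_sum_eq_J:
  assumes f: "\<And>xs. xs \<in> lists (space N) \<Longrightarrow> 0 \<le> f xs"
    and [measurable]: "(\<lambda>xs. ennreal (f xs)) \<in> borel_measurable (list_space N)"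
    and w: "w \<in> lists (space N)"
  shows "assoc_sum N p ld lc f w = J (\<lambda>xs. ennreal (f xs)) w"
proof -
  let ?q = "1 - p" and ?m = "length w"
  define T where "T n S = ennreal (\<Prod>j\<in>{..<?m} - S. lc (w ! j)) *
        ennreal (?q ^ (n - card S) / fact (n - card S)) *
        (\<integral>\<^sup>+ x. ennreal (f (map x [0..<n]) * (\<Prod>i<card S. p * ld (nths w S ! i) (x i))) \<partial>PiM {..<n} (\<lambda>_. N))" for n S
  have nths_sp: "nths w S \<in> lists (space N)" for S
    using w set_nths_subset[of w S] by auto
  have T: "T (n + card S) S = (\<Prod>j\<in>{..<?m} - S. ennreal (lc (w ! j))) * (ennreal (?q ^ n / fact n) *
    (\<integral>\<^sup>+ xs. ennreal (f xs) * link_weight (nths w S) xs \<partial>list_power N (n + length (nths w S))))"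
    if S: "S \<in> Pow {..<?m}" for n S
  proof -
    have len: "length (nths w S) = card S"
      using S by (simp add: length_nths) (metis (no_types, lifting) Collect_cong Collect_mem_eq lessThan_iff subsetD)
    note link_weight_measurable[OF nths_sp, measurable]
    have "(\<integral>\<^sup>+ x. ennreal (f (map x [0..<n + card S]) * (\<Prod>i<card S. p * ld (nths w S ! i) (x i))) \<partial>PiM {..<n + card S} (\<lambda>_. N)) =
      (\<integral>\<^sup>+ x. ennreal (f (map x [0..<n + card S])) * link_weight (nths w S) (map x [0..<n + card S]) \<partial>PiM {..<n + card S} (\<lambda>_. N))"
    proof (rule nn_integral_cong)
      fix x assume x: "x \<in> space (PiM {..<n + card S} (\<lambda>_. N))"
      have ld: "0 \<le> p * ld (nths w S ! i) (x i)" if "i < card S" for i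
        using that x nths_sp[of S] p_pos
        by (intro mult_nonneg_nonneg ld_nonneg) (auto simp: in_lists_conv_set len[symmetric] space_PiM PiE_iff)
      have "link_weight (nths w S) (map x [0..<n + card S]) = (\<Prod>i<card S. ennreal (p * ld (nths w S ! i) (x i)))"
        by (auto simp: link_weight_def len intro!: prod.cong)
      also have "\<dots> = ennreal (\<Prod>i<card S. p * ld (nths w S ! i) (x i))"
        using ld by (intro prod_ennreal) auto
      finally show "ennreal (f (map x [0..<n + card S]) * (\<Prod>i<card S. p * ld (nths w S ! i) (x i))) =
        ennreal (f (map x [0..<n + card S])) * link_weight (nths w S) (map x [0..<n + card S])"
        using f[OF map_upt_in_lists[OF x]] by (simp add: ennreal_mult' prod_nonneg)
    qed
    also have "\<dots> = (\<integral>\<^sup>+ xs. ennreal (f xs) * link_weight (nths w S) xs \<partial>list_power N (n + length (nths w S)))"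
      unfolding len by (subst nn_integral_list_power) auto
    finally have *: "(\<integral>\<^sup>+ x. ennreal (f (map x [0..<n + card S]) * (\<Prod>i<card S. p * ld (nths w S ! i) (x i))) \<partial>PiM {..<n + card S} (\<lambda>_. N)) = \<dots>" .
    have "ennreal (\<Prod>j\<in>{..<?m} - S. lc (w ! j)) = (\<Prod>j\<in>{..<?m} - S. ennreal (lc (w ! j)))"
      using w lc_nonneg by (intro prod_ennreal[symmetric]) (auto simp: in_lists_conv_set)
    then show ?thesis
      unfolding T_def * by (simp add: mult.assoc)
  qed
  have "assoc_sum N p ld lc f w = (\<Sum>n. \<Sum>S | S \<in> Pow {..<?m} \<and> card S \<le> n. T n S)"
    unfolding assoc_sum_def T_def by simp
  \<comment> \<open>The condition \<open>card S \<le> n\<close> becomes a zero term, so that the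
    range of \<open>S\<close> no longer depends on \<open>n\<close> and the two sums can be
    exchanged.\<close>
  also have "\<dots> = (\<Sum>n. \<Sum>S\<in>Pow {..<?m}. if card S \<le> n then T n S else 0)"
    by (intro suminf_cong sum.inter_filter) auto
  also have "\<dots> = (\<Sum>S\<in>Pow {..<?m}. \<Sum>n. if card S \<le> n then T n S else 0)"
    by (rule suminf_sum) simp
  also have "\<dots> = (\<Sum>S\<in>Pow {..<?m}. \<Sum>n. T (n + card S) S)"
    by (simp add: suminf_shift_ennreal)
  also have "\<dots> = (\<Sum>S\<in>Pow {..<?m}. (\<Prod>j\<in>{..<?m} - S. ennreal (lc (w ! j))) * link_int (\<lambda>xs. ennreal (f xs)) (nths w S))"
    by (intro sum.cong refl) (simp only: T link_int_eq[OF assms(2) nths_sp] ennreal_suminf_cmult)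
  also have "\<dots> = J (\<lambda>xs. ennreal (f xs)) w"
    by (rule J_conv_link_int[OF assms(2) w, symmetric])
  finally show ?thesis .
qed

end

section \<open>The measurable space of configurations\<close>

lemma points_in_simps [simp]:
  "points_in B {#} = 0"
  "points_in B (add_mset x \<phi>) = (if x \<in> B then 1 else 0) + points_in B \<phi>"
  "points_in B (\<phi> + \<psi>) = points_in B \<phi> + points_in B \<psi>"
  by (simp_all add: points_in_def)

lemma space_config_space: "space (config_space N) = {\<phi>. set_mset \<phi> \<subseteq> space N}"
  unfolding config_space_def by (rule space_measure_of) auto

lemma measurable_points_in [measurable]:
  assumes "B \<in> sets N"
  shows "points_in B \<in> measurable (config_space N) (count_space UNIV)"
proof -
  have "{\<phi>. set_mset \<phi> \<subseteq> space N \<and> points_in B \<phi> = k} \<in> sets (config_space N)" for k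
    unfolding config_space_def using assms by (intro in_measure_of) auto
  then show ?thesis
    by (subst measurable_count_space_eq2_countable)
       (auto simp: space_config_space vimage_def Int_def conj_commute)
qed

lemma measurable_configI:
  assumes "\<And>x. x \<in> space M \<Longrightarrow> set_mset (f x) \<subseteq> space N"
    and "\<And>B. B \<in> sets N \<Longrightarrow> (\<lambda>x. points_in B (f x)) \<in> measurable M (count_space UNIV)"
  shows "f \<in> measurable M (config_space N)"
  unfolding config_space_def
proof (rule measurable_measure_of)
  fix A assume "A \<in> {{\<phi>. set_mset \<phi> \<subseteq> space N \<and> points_in B \<phi> = k} | B k. B \<in> sets N}"
  then obtain B k where A: "A = {\<phi>. set_mset \<phi> \<subseteq> space N \<and> points_in B \<phi> = k}" and B: "B \<in> sets N"
    by auto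
  have "f -` A \<inter> space M = (\<lambda>x. points_in B (f x)) -` {k} \<inter> space M"
    using assms(1) by (auto simp: A)
  then show "f -` A \<inter> space M \<in> sets M"
    using measurable_sets[OF assms(2)[OF B], of "{k}"] by simp
qed (use assms(1) in auto)

lemma measurable_config_plus [measurable (raw)]:
  assumes "f \<in> measurable M (config_space N)" "g \<in> measurable M (config_space N)"
  shows "(\<lambda>x. f x + g x) \<in> measurable M (config_space N)"
proof (rule measurable_configI)
  show "set_mset (f x + g x) \<subseteq> space N" if "x \<in> space M" for x
    using that assms[THEN measurable_space] by (auto simp: space_config_space)
  fix B assume [measurable]: "B \<in> sets N"
  note [measurable] = assms
  show "(\<lambda>x. points_in B (f x + g x)) \<in> measurable M (count_space UNIV)"
    by simp measurable
qed

lemma measurable_config_single [measurable]: "(\<lambda>z. {#z#}) \<in> measurable N (config_space N)"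
  by (rule measurable_configI) auto

lemma measurable_config_empty [measurable]: "(\<lambda>x. {#}) \<in> measurable M (config_space N)"
  by (rule measurable_configI) auto

lemma points_in_mset_map:
  fixes n :: nat
  shows "points_in B (mset (map x [0..<n])) = (\<Sum>i<n. if x i \<in> B then 1 else 0)"
  by (induction n) auto

lemma measurable_mset [measurable]: "mset \<in> measurable (list_space N) (config_space N)"
proof (rule measurable_configI)
  fix B assume B [measurable]: "B \<in> sets N"
  show "(\<lambda>xs. points_in B (mset xs)) \<in> measurable (list_space N) (count_space UNIV)"
  proof (rule measurable_list_spaceI)
    fix n :: nat
    have "(\<lambda>x. \<Sum>i<n. if x i \<in> B then 1 else (0::nat)) \<in> measurable (PiM {..<n} (\<lambda>_. N)) (count_space UNIV)"
    proof (rule measurable_sum_nat)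
      fix i assume [measurable]: "i \<in> {..<n}"
      show "(\<lambda>x. if x i \<in> B then 1 else (0::nat)) \<in> measurable (PiM {..<n} (\<lambda>_. N)) (count_space UNIV)"
        by measurable
    qed
    then show "(\<lambda>x. points_in B (mset (map x [0..<n]))) \<in> measurable (PiM {..<n} (\<lambda>_. N)) (count_space UNIV)"
      by (simp only: points_in_mset_map)
  qed
qed (auto simp: space_list_space)

lemma measurable_size [measurable]: "size \<in> measurable (config_space N) (count_space UNIV)"
proof -
  have "points_in (space N) \<phi> = size \<phi>" if "\<phi> \<in> space (config_space N)" for \<phi>
    using that by (induction \<phi>) (auto simp: space_config_space)
  then have "points_in (space N) \<in> measurable (config_space N) (count_space UNIV) \<longleftrightarrow>
      size \<in> measurable (config_space N) (count_space UNIV)"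
    by (rule measurable_cong)
  then show ?thesis by simp
qed

lemma of_nat_points_in_UN:
  assumes "disjoint_family A"
  shows "(of_nat (points_in (\<Union>i. A i) \<phi>) :: ennreal) = (\<Sum>i. of_nat (points_in (A i) \<phi>))"
proof (induction \<phi>)
  case (add x \<phi>)
  have ind: "(of_nat (points_in B (add_mset x \<phi>)) :: ennreal) = indicator B x + of_nat (points_in B \<phi>)" for B
    by simp
  show ?case
    unfolding ind add suminf_indicator[OF assms, symmetric] by (rule suminf_add) auto
qed simp

text \<open>With lists of constraints, intersections become concatenations: the cylinders over any
  family are intersection-stable, and they are countable when the family is.\<close>

definition cylinder :: "'a measure \<Rightarrow> ('a set \<times> nat) list \<Rightarrow> 'a multiset set" where
  "cylinder N l = {\<phi>. set_mset \<phi> \<subseteq> space N \<and> (\<forall>(B, k)\<in>set l. points_in B \<phi> = k)}"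

lemma cylinder_append: "cylinder N (l @ l') = cylinder N l \<inter> cylinder N l'"
  unfolding cylinder_def set_append ball_Un Int_def mem_Collect_eq by (rule Collect_cong) argo

lemma cylinder_Nil: "cylinder N [] = space (config_space N)"
  by (simp add: cylinder_def space_config_space)

lemma cylinder_Cons: "cylinder N ((B, k) # l) = cylinder N l \<inter> {\<phi> \<in> space (config_space N). points_in B \<phi> = k}"
  by (auto simp: cylinder_def space_config_space)

lemma sets_cylinder: "fst ` set l \<subseteq> sets N \<Longrightarrow> cylinder N l \<in> sets (config_space N)"
proof (induction l)
  case (Cons a l)
  obtain B k where a: "a = (B, k)" by (cases a)
  with Cons have [measurable]: "B \<in> sets N" "cylinder N l \<in> sets (config_space N)" by auto
  show ?case
    unfolding a cylinder_Cons by measurable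
qed (simp add: cylinder_Nil)

lemma Int_stable_cylinder: "Int_stable (cylinder N ` lists (E \<times> UNIV))"
proof (rule Int_stableI_image)
  fix l l' assume "l \<in> lists (E \<times> (UNIV :: nat set))" "l' \<in> lists (E \<times> (UNIV :: nat set))"
  then show "\<exists>l''\<in>lists (E \<times> UNIV). cylinder N l \<inter> cylinder N l' = cylinder N l''"
    by (intro bexI[of _ "l @ l'"]) (simp_all add: cylinder_append)
qed

text \<open>Used twice: with \<open>sets N\<close> as the family when measures are compared, and
  with a countable family when a common null set is wanted. The sets \<open>B\<close> whose count is
  measurable for the cylinders form a Dynkin class; complements are handled by subtraction from the
  total count, which is why \<open>space N\<close> must belong to \<open>E\<close>.\<close>

lemma sets_config_space_cylinder:
  assumes E: "Int_stable E" "space N \<in> E" "sets N = sigma_sets (space N) E"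
  shows "sets (config_space N) = sigma_sets (space (config_space N)) (cylinder N ` lists (E \<times> UNIV))"
    (is "_ = sigma_sets ?\<Omega> ?C")
proof -
  have E_sets: "E \<subseteq> sets N"
    unfolding E(3) by auto
  have E_Pow: "E \<subseteq> Pow (space N)"
    using E_sets sets.sets_into_space by blast
  have C_sets: "?C \<subseteq> sets (config_space N)"
  proof (rule image_subsetI)
    fix l assume "l \<in> lists (E \<times> (UNIV :: nat set))"
    then show "cylinder N l \<in> sets (config_space N)"
      using E_sets by (intro sets_cylinder) auto
  qed
  let ?M = "sigma ?\<Omega> ?C"
  have C: "?C \<subseteq> Pow ?\<Omega>"
    using C_sets sets.sets_into_space by blast
  have M: "sets ?M = sigma_sets ?\<Omega> ?C" "space ?M = ?\<Omega>"
    using C by simp_all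
  have points: "points_in B \<in> measurable ?M (count_space UNIV)" if "B \<in> sets N" for B
  proof -
    \<comment> \<open>Counts are moved to \<open>ennreal\<close>, where the count of a countable
      disjoint union is a series.\<close>
    have iff: "(\<lambda>\<phi>. of_nat (points_in A \<phi>) :: ennreal) \<in> borel_measurable ?M \<longleftrightarrow>
        points_in A \<in> measurable ?M (count_space UNIV)" for A
    proof
      assume [measurable]: "(\<lambda>\<phi>. of_nat (points_in A \<phi>) :: ennreal) \<in> borel_measurable ?M"
      have "{\<phi> \<in> space ?M. (of_nat (points_in A \<phi>) :: ennreal) = of_nat k} \<in> sets ?M" for k
        by measurable
      then show "points_in A \<in> measurable ?M (count_space UNIV)"
        by (subst measurable_count_space_eq2_countable) (auto simp: vimage_def Int_def conj_commute)
    next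
      assume "points_in A \<in> measurable ?M (count_space UNIV)"
      moreover have "of_nat \<in> measurable (count_space UNIV) (borel :: ennreal measure)" by simp
      ultimately show "(\<lambda>\<phi>. of_nat (points_in A \<phi>) :: ennreal) \<in> borel_measurable ?M"
        by (rule measurable_compose)
    qed
    have "points_in {} \<phi> = 0" for \<phi> :: "'a multiset"
      by (simp add: points_in_def)
    then have p0: "(\<lambda>\<phi>. of_nat (points_in {} \<phi>) :: ennreal) \<in> borel_measurable ?M"
      by simp
    have "(\<lambda>\<phi>. of_nat (points_in B \<phi>) :: ennreal) \<in> borel_measurable ?M"
      using E(1) E_Pow that[unfolded E(3)]
    proof (induction B rule: sigma_sets_induct_disjoint)
      case (basic A)
      have "cylinder N [(A, k)] \<in> sets ?M" for k
        unfolding M using basic by (intro sigma_sets.Basic imageI) auto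
      then have "points_in A \<in> measurable ?M (count_space UNIV)"
        using M(2) by (subst measurable_count_space_eq2_countable)
          (auto simp: vimage_def Int_def conj_commute cylinder_def space_config_space)
      then show ?case
        by (simp only: iff)
    next
      case empty
      show ?case by (rule p0)
    next
      case (compl A)
      then have [measurable]: "points_in A \<in> measurable ?M (count_space UNIV)"
        by (simp only: iff)
      have "cylinder N [(space N, k)] \<in> sets ?M" for k
        unfolding M using E(2) by (intro sigma_sets.Basic imageI) auto
      then have [measurable]: "points_in (space N) \<in> measurable ?M (count_space UNIV)"
        using M(2) by (subst measurable_count_space_eq2_countable)
          (auto simp: vimage_def Int_def conj_commute cylinder_def space_config_space)
      have "points_in (space N - A) \<phi> = points_in (space N) \<phi> - points_in A \<phi>" if "\<phi> \<in> space ?M" for \<phi>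
      proof -
        have "A \<subseteq> space N"
          using compl E(3) sets.sets_into_space by blast
        then have "points_in (space N) \<phi> = points_in (space N - A) \<phi> + points_in A \<phi>"
          by (induction \<phi>) auto
        then show ?thesis by simp
      qed
      moreover have "(\<lambda>\<phi>. of_nat (points_in (space N) \<phi> - points_in A \<phi>) :: ennreal) \<in> borel_measurable ?M"
        by measurable
      ultimately show ?case
        by (subst measurable_cong[where g = "\<lambda>\<phi>. of_nat (points_in (space N) \<phi> - points_in A \<phi>)"]) auto
    next
      case (union A)
      then show ?case
        by (simp add: of_nat_points_in_UN)
    qed
    then show ?thesis
      by (simp only: iff)
  qed
  have id: "(\<lambda>\<phi>. \<phi>) \<in> measurable ?M (config_space N)"
  proof (rule measurable_configI)
    show "set_mset \<phi> \<subseteq> space N" if "\<phi> \<in> space ?M" for \<phi>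
      using that M(2) by (simp add: space_config_space)
  qed (rule points)
  have "A \<in> sets ?M" if A: "A \<in> sets (config_space N)" for A
  proof -
    have "(\<lambda>\<phi>. \<phi>) -` A \<inter> space ?M \<in> sets ?M"
      by (rule measurable_sets[OF id A])
    moreover have "(\<lambda>\<phi>. \<phi>) -` A \<inter> space ?M = A"
      unfolding M(2) vimage_ident using sets.sets_into_space[OF A] by blast
    ultimately show ?thesis by simp
  qed
  then have "sets (config_space N) \<subseteq> sets ?M"
    by blast
  moreover have "sigma_sets ?\<Omega> ?C \<subseteq> sets (config_space N)"
    using C_sets by (rule sets.sigma_sets_subset)
  ultimately show ?thesis
    using M by auto
qed

text \<open>Second countability enters here: finite intersections of basic open sets, traced on
  \<open>\<Lambda>\<close>, form a countable generator on the window, and there are only countably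
  many cylinders over it.\<close>

lemma countable_config_generator:
  fixes N :: "'a :: second_countable_topology measure"
  assumes N: "sets N = sets (restrict_space borel \<Lambda>)" and \<Lambda>: "\<Lambda> \<in> sets borel"
  obtains E where "countable E" "Int_stable E" "E \<subseteq> Pow (space (config_space N))"
    "space (config_space N) \<in> E" "sets (config_space N) = sigma_sets (space (config_space N)) E"
proof -
  obtain B :: "'a set set" where B: "countable B" "topological_basis B"
    using ex_countable_basis by blast
  have spN: "space N = \<Lambda>"
    using sets_eq_imp_space_eq[OF N] by (simp add: space_restrict_space)
  \<comment> \<open>The empty family \<open>F\<close> is included and contributes the window itself,
    as \<open>sets_config_space_cylinder\<close> requires.\<close>
  define D where "D = (\<lambda>F. \<Lambda> \<inter> \<Inter>F) ` {F. finite F \<and> F \<subseteq> B}"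
  have D_countable: "countable D"
    unfolding D_def using countable_Collect_finite_subset[OF B(1)] by (intro countable_image) simp
  have D_Int: "Int_stable D"
    unfolding D_def
  proof (rule Int_stableI_image)
    fix F G assume "F \<in> {F. finite F \<and> F \<subseteq> B}" "G \<in> {F. finite F \<and> F \<subseteq> B}"
    then show "\<exists>H\<in>{F. finite F \<and> F \<subseteq> B}. (\<Lambda> \<inter> \<Inter>F) \<inter> (\<Lambda> \<inter> \<Inter>G) = \<Lambda> \<inter> \<Inter>H"
      by (intro bexI[of _ "F \<union> G"]) auto
  qed
  have D_space: "space N \<in> D"
    unfolding D_def spN by (intro image_eqI[of _ _ "{}"]) auto
  have borel: "sets borel = sigma_sets UNIV B"
    unfolding borel_eq_countable_basis[OF B] by (simp add: sets_measure_of)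
  have D_sets: "D \<subseteq> sets N"
  proof
    fix A assume "A \<in> D"
    then obtain F where F: "A = \<Lambda> \<inter> \<Inter>F" "finite F" "F \<subseteq> B"
      by (auto simp: D_def)
    have "\<Inter>F \<in> sets borel"
      using F(2,3)
    proof (induction F rule: finite_induct)
      case (insert G F)
      then have "G \<in> sets borel" "\<Inter>F \<in> sets borel"
        using B(2) by (auto simp: topological_basis_open)
      then show ?case by auto
    qed simp
    then show "A \<in> sets N"
      unfolding N sets_restrict_space F(1) by auto
  qed
  have "sets N = sigma_sets (space N) D"
  proof
    show "sigma_sets (space N) D \<subseteq> sets N"
      using D_sets by (rule sets.sigma_sets_subset)
    have sub: "(\<inter>) \<Lambda> ` B \<subseteq> D"
    proof (rule image_subsetI)
      fix b assume "b \<in> B"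
      then show "\<Lambda> \<inter> b \<in> D"
        unfolding D_def by (intro image_eqI[of _ _ "{b}"]) auto
    qed
    have "sets N = (\<inter>) \<Lambda> ` sigma_sets UNIV B"
      unfolding N sets_restrict_space borel ..
    also have "\<dots> = sigma_sets \<Lambda> ((\<inter>) \<Lambda> ` B)"
      using \<Lambda> unfolding borel by (rule sigma_sets_Int) simp
    also have "\<dots> \<subseteq> sigma_sets (space N) D"
      unfolding spN by (rule sigma_sets_mono'[OF sub])
    finally show "sets N \<subseteq> sigma_sets (space N) D" .
  qed
  note gen = sets_config_space_cylinder[OF D_Int D_space this]
  let ?E = "cylinder N ` lists (D \<times> (UNIV :: nat set))"
  have "countable ?E"
    using D_countable by (intro countable_image countable_lists countable_SIGMA) auto
  moreover have "?E \<subseteq> Pow (space (config_space N))"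
    by (auto simp: cylinder_def space_config_space)
  moreover have "space (config_space N) \<in> ?E"
    by (intro image_eqI[of _ _ "[]"]) (simp_all add: cylinder_Nil)
  ultimately show thesis
    by (rule that[OF _ Int_stable_cylinder _ _ gen])
qed

text \<open>Its integrals form the probability generating functional.\<close>

definition config_prod :: "('a \<Rightarrow> ennreal) \<Rightarrow> 'a multiset \<Rightarrow> ennreal" where
  "config_prod f \<phi> = (\<Prod>x\<in>#\<phi>. f x)"

lemma config_prod_simps [simp]:
  "config_prod f {#} = 1"
  "config_prod f (add_mset x \<phi>) = f x * config_prod f \<phi>"
  "config_prod f (\<phi> + \<psi>) = config_prod f \<phi> * config_prod f \<psi>"
  by (simp_all add: config_prod_def)

lemma config_prod_sum: "finite I \<Longrightarrow> config_prod f (\<Sum>i\<in>I. \<omega> i) = (\<Prod>i\<in>I. config_prod f (\<omega> i))"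
  by (induction I rule: finite_induct) auto

lemma config_prod_mult: "config_prod (\<lambda>x. f x * g x) \<phi> = config_prod f \<phi> * config_prod g \<phi>"
  by (induction \<phi>) (auto simp: mult_ac)

lemma config_prod_If: "config_prod (\<lambda>x. if x \<in> B then t else 1) \<phi> = t ^ points_in B \<phi>"
  by (induction \<phi>) auto

lemma config_prod_le_1:
  assumes "\<And>x. x \<in># \<phi> \<Longrightarrow> f x \<le> 1"
  shows "config_prod f \<phi> \<le> 1"
  using assms
proof (induction \<phi>)
  case (add x \<phi>)
  then have "f x * config_prod f \<phi> \<le> 1 * 1"
    by (intro mult_mono) auto
  then show ?case by simp
qed simp

text \<open>Sorting the points by the value of \<open>f\<close> leaves finitely many counts.
  Measurability of the product and its expectation under a Poisson process both rest on this
  form.\<close>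

lemma config_prod_simple:
  assumes f: "simple_function N f" and \<phi>: "\<phi> \<in> space (config_space N)"
  shows "config_prod f \<phi> = (\<Prod>v\<in>f ` space N. v ^ points_in (f -` {v} \<inter> space N) \<phi>)"
  using \<phi>
proof (induction \<phi>)
  case (add x \<phi>)
  then have x: "x \<in> space N" and \<phi>: "\<phi> \<in> space (config_space N)"
    by (auto simp: space_config_space)
  have fin: "finite (f ` space N)"
    using f by (rule simple_functionD)
  have "(\<Prod>v\<in>f ` space N. v ^ points_in (f -` {v} \<inter> space N) (add_mset x \<phi>)) =
    (\<Prod>v\<in>f ` space N. (if v = f x then v else 1) * v ^ points_in (f -` {v} \<inter> space N) \<phi>)"
    using x by (intro prod.cong) auto
  also have "\<dots> = f x * (\<Prod>v\<in>f ` space N. v ^ points_in (f -` {v} \<inter> space N) \<phi>)"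
    using fin x by (simp add: prod.distrib prod.delta)
  finally show ?case
    using add.IH[OF \<phi>] by simp
qed simp

lemma config_prod_measurable [measurable]:
  assumes "simple_function N f"
  shows "config_prod f \<in> borel_measurable (config_space N)"
proof -
  have [measurable]: "f -` {v} \<inter> space N \<in> sets N" for v
    using assms by (rule simple_functionD)
  have "(\<lambda>\<phi>. v ^ points_in (f -` {v} \<inter> space N) \<phi>) \<in> borel_measurable (config_space N)" for v
  proof -
    have "(\<lambda>k. v ^ k) \<in> measurable (count_space UNIV) (borel :: ennreal measure)" by simp
    from measurable_compose[OF measurable_points_in this] show ?thesis by measurable
  qed
  then have "(\<lambda>\<phi>. \<Prod>v\<in>f ` space N. v ^ points_in (f -` {v} \<inter> space N) \<phi>) \<in> borel_measurable (config_space N)"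
    by (intro borel_measurable_prod_ennreal) auto
  then show ?thesis
    by (subst measurable_cong[OF config_prod_simple[OF assms]])
qed

text \<open>Multiplying \<open>f\<close> by \<open>t\<close> on \<open>B\<close> turns the generating functional into a power series
  in \<open>t\<close> whose \<open>k\<close>-th coefficient sees only the configurations with \<open>k\<close> points in \<open>B\<close>.\<close>

lemma generating_functional_unique:
  assumes fin: "finite_measure P" "finite_measure Q"
    and sets [measurable_cong]: "sets P = sets (config_space N)" "sets Q = sets (config_space N)"
    and eq: "\<And>f. simple_function N f \<Longrightarrow> (\<And>x. x \<in> space N \<Longrightarrow> f x \<le> 1) \<Longrightarrow>
      (\<integral>\<^sup>+ \<phi>. config_prod f \<phi> \<partial>P) = (\<integral>\<^sup>+ \<phi>. config_prod f \<phi> \<partial>Q)"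
  shows "P = Q"
proof -
  \<comment> \<open>The constraints in \<open>l\<close> are peeled off one at a time, each by a
    perturbation of \<open>f\<close> on its set \<open>B\<close>, so \<open>f\<close> must be
    arbitrary in the induction.\<close>
  have coeff: "(\<integral>\<^sup>+ \<phi>. indicator (cylinder N l) \<phi> * config_prod f \<phi> \<partial>P) =
      (\<integral>\<^sup>+ \<phi>. indicator (cylinder N l) \<phi> * config_prod f \<phi> \<partial>Q)"
    if "l \<in> lists (sets N \<times> UNIV)" "simple_function N f" "\<And>x. x \<in> space N \<Longrightarrow> f x \<le> 1" for l f
    using that
  proof (induction l arbitrary: f)
    case Nil
    have "(\<integral>\<^sup>+ \<phi>. indicator (cylinder N []) \<phi> * config_prod f \<phi> \<partial>M) = (\<integral>\<^sup>+ \<phi>. config_prod f \<phi> \<partial>M)"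
      if "sets M = sets (config_space N)" for M
      using sets_eq_imp_space_eq[OF that] by (intro nn_integral_cong) (simp add: cylinder_Nil)
    then show ?case
      using eq Nil sets by simp
  next
    case (Cons a l)
    obtain B k where a: "a = (B, k)" by (cases a)
    have B [measurable]: "B \<in> sets N" and l: "l \<in> lists (sets N \<times> UNIV)"
      using Cons.hyps by (auto simp: a)
    have l' [measurable]: "cylinder N l \<in> sets (config_space N)"
      using l by (intro sets_cylinder) auto
    note [measurable] = Cons.prems(1)
    \<comment> \<open>\<open>c M n\<close> is the coefficient of \<open>t ^ n\<close> in the
      perturbed functional; it carries one constraint more than the induction hypothesis.\<close>
    define c where "c M n = (\<integral>\<^sup>+ \<phi>. indicator (cylinder N ((B, n) # l)) \<phi> * config_prod f \<phi> \<partial>M)" for M n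
    have series: "(\<Sum>n. c M n * t ^ n) = (\<integral>\<^sup>+ \<phi>. indicator (cylinder N l) \<phi> *
        config_prod (\<lambda>x. f x * (if x \<in> B then t else 1)) \<phi> \<partial>M)"
      if M [measurable_cong]: "sets M = sets (config_space N)" for M t
    proof -
      have [measurable]: "cylinder N ((B, n) # l) \<in> sets (config_space N)" for n
        using B l by (intro sets_cylinder) auto
      have "(\<Sum>n. c M n * t ^ n) =
        (\<integral>\<^sup>+ \<phi>. (\<Sum>n. indicator (cylinder N ((B, n) # l)) \<phi> * config_prod f \<phi> * t ^ n) \<partial>M)"
        unfolding c_def by (subst nn_integral_suminf) (auto simp: nn_integral_multc)
      also have "\<dots> = (\<integral>\<^sup>+ \<phi>. indicator (cylinder N l) \<phi> * (config_prod f \<phi> * t ^ points_in B \<phi>) \<partial>M)"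
      proof (rule nn_integral_cong)
        fix \<phi> assume "\<phi> \<in> space M"
        then have "\<phi> \<in> space (config_space N)"
          using sets_eq_imp_space_eq[OF M] by simp
        then have "indicator (cylinder N ((B, n) # l)) \<phi> * config_prod f \<phi> * t ^ n =
            (if n = points_in B \<phi> then indicator (cylinder N l) \<phi> * (config_prod f \<phi> * t ^ n) else 0)" for n
          by (auto simp: cylinder_Cons indicator_def mult_ac)
        then show "(\<Sum>n. indicator (cylinder N ((B, n) # l)) \<phi> * config_prod f \<phi> * t ^ n) =
           indicator (cylinder N l) \<phi> * (config_prod f \<phi> * t ^ points_in B \<phi>)"
          by (simp only:) (rule sums_unique[OF sums_single, symmetric])
      qed
      finally show ?thesis
        by (simp add: config_prod_mult config_prod_If)
    qed
    \<comment> \<open>Since \<open>f\<close> is at most 1 and the measure is finite, the series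
      converges at \<open>t = 1\<close>, as the comparison of coefficients requires.\<close>
    have finite: "(\<Sum>n. c M n) \<noteq> \<top>" if M: "sets M = sets (config_space N)" "finite_measure M" for M
    proof -
      interpret M: finite_measure M by fact
      have "(\<Sum>n. c M n) = (\<integral>\<^sup>+ \<phi>. indicator (cylinder N l) \<phi> * config_prod f \<phi> \<partial>M)"
        using series[OF M(1), of 1] by simp
      also have "\<dots> \<le> (\<integral>\<^sup>+ \<phi>. 1 \<partial>M)"
      proof (rule nn_integral_mono)
        fix \<phi> assume "\<phi> \<in> space M"
        then have "\<phi> \<in> space (config_space N)"
          using sets_eq_imp_space_eq[OF M(1)] by simp
        then have "config_prod f \<phi> \<le> 1"
          using Cons.prems(2) by (intro config_prod_le_1) (auto simp: space_config_space)
        then show "indicator (cylinder N l) \<phi> * config_prod f \<phi> \<le> 1"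
          by (auto simp: indicator_def)
      qed
      also have "\<dots> < \<top>"
        by (simp add: M.emeasure_eq_measure)
      finally show ?thesis by simp
    qed
    have "c P k = c Q k"
    proof (rule power_series_ennreal_unique)
      fix t :: real assume t: "0 < t" "t \<le> 1"
      \<comment> \<open>For \<open>t \<le> 1\<close> the perturbed function is still simple and at
        most 1, hence admissible in the induction hypothesis.\<close>
      let ?f = "\<lambda>x. f x * (if x \<in> B then ennreal t else 1)"
      have "simple_function N (\<lambda>x. if x \<in> B then ennreal t else 1)"
        by (intro simple_function_If_set) auto
      then have "simple_function N ?f"
        by (intro simple_function_mult Cons.prems)
      moreover have "?f x \<le> 1" if "x \<in> space N" for x
      proof -
        have "?f x \<le> 1 * 1"
          using t Cons.prems(2)[OF that] by (intro mult_mono) auto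
        then show ?thesis by simp
      qed
      ultimately have "(\<integral>\<^sup>+ \<phi>. indicator (cylinder N l) \<phi> * config_prod ?f \<phi> \<partial>P) =
          (\<integral>\<^sup>+ \<phi>. indicator (cylinder N l) \<phi> * config_prod ?f \<phi> \<partial>Q)"
        by (rule Cons.IH)
      then show "(\<Sum>n. c P n * ennreal t ^ n) = (\<Sum>n. c Q n * ennreal t ^ n)"
        by (simp only: series sets)
    qed (use finite fin sets in auto)
    then show ?case
      by (simp add: c_def a)
  qed
  let ?E = "cylinder N ` lists (sets N \<times> (UNIV :: nat set))"
  have gen: "sets (config_space N) = sigma_sets (space (config_space N)) ?E"
    by (rule sets_config_space_cylinder) (auto simp: sets.Int_stable sets.sigma_sets_eq)
  show ?thesis
  proof (rule measure_eqI_generator_eq)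
    show "Int_stable ?E" by (rule Int_stable_cylinder)
    show "?E \<subseteq> Pow (space (config_space N))"
      by (auto simp: cylinder_def space_config_space)
    fix X assume "X \<in> ?E"
    then obtain l where X: "X = cylinder N l" and l: "l \<in> lists (sets N \<times> UNIV)" by blast
    have [measurable]: "X \<in> sets (config_space N)"
      unfolding X using l by (intro sets_cylinder) auto
    have "config_prod (\<lambda>_. 1) \<phi> = 1" for \<phi> :: "'a multiset"
      by (simp add: config_prod_def)
    then show "emeasure P X = emeasure Q X"
      using coeff[OF l, of "\<lambda>_. 1"] by (simp add: X[symmetric] sets)
  next
    show "range (\<lambda>i::nat. space (config_space N)) \<subseteq> ?E"
      by (auto intro!: image_eqI[of _ _ "[]"] simp: cylinder_Nil)
    show "emeasure P (space (config_space N)) \<noteq> \<infinity>"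
      using fin(1) by (simp add: finite_measure.emeasure_eq_measure)
  qed (use gen sets in auto)
qed

text \<open>The set of pairs with distinct entries is no rectangle, so its measurability needs an
  argument. Rectangles factor into products of counts, and a Dynkin argument covers all measurable
  sets of pairs; for complements, the sum over all pairs is the square of the number of
  points.\<close>

lemma sum_mset_pair_measurable:
  assumes "W \<in> sets (N \<Otimes>\<^sub>M N)"
  shows "(\<lambda>\<phi>. \<Sum>x\<in>#\<phi>. \<Sum>y\<in>#\<phi>. indicator W (x, y) :: ennreal) \<in> borel_measurable (config_space N)"
proof -
  define s where "s W \<phi> = (\<Sum>x\<in>#\<phi>. \<Sum>y\<in>#\<phi>. indicator W (x, y) :: ennreal)" for W :: "('a \<times> 'a) set" and \<phi>
  have s_mset: "s W (mset xs) = (\<Sum>i<length xs. \<Sum>j<length xs. indicator W (xs ! i, xs ! j))" for W xs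
    unfolding s_def by (simp add: mset_map[symmetric] sum_mset_sum_list sum_list_sum_nth atLeast0LessThan del: mset_map)
  have "s W \<in> borel_measurable (config_space N)"
    using Int_stable_pair_measure_generator pair_measure_closed assms
    unfolding sets_pair_measure
  proof (induction rule: sigma_sets_induct_disjoint)
    case (basic X)
    then obtain A B where X: "X = A \<times> B" and [measurable]: "A \<in> sets N" "B \<in> sets N" by auto
    have points: "(\<Sum>x\<in>#\<phi>. indicator D x :: ennreal) = of_nat (points_in D \<phi>)" for D :: "'a set" and \<phi>
      by (induction \<phi>) auto
    have "s X \<phi> = of_nat (points_in A \<phi>) * of_nat (points_in B \<phi>)" for \<phi>
      unfolding s_def X indicator_times fst_conv snd_conv
      by (simp add: sum_mset_distrib_left[symmetric] sum_mset_distrib_right[symmetric] points)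
    then have "s X = (\<lambda>\<phi>. of_nat (points_in A \<phi>) * of_nat (points_in B \<phi>))"
      by auto
    then show ?case by simp
  next
    case empty
    have "s {} = (\<lambda>_. 0)" by (auto simp: s_def)
    then show ?case by simp
  next
    case (compl X)
    have "s (space N \<times> space N - X) \<phi> = of_nat (size \<phi>) ^ 2 - s X \<phi>" if \<phi>: "\<phi> \<in> space (config_space N)" for \<phi>
    proof -
      obtain xs where xs: "\<phi> = mset xs" using ex_mset by metis
      have "s (space N \<times> space N - X) \<phi> + s X \<phi> = (\<Sum>i<length xs. \<Sum>j<length xs. 1)"
        unfolding xs s_mset sum.distrib[symmetric]
        using \<phi> by (intro sum.cong refl) (auto simp: xs space_config_space indicator_def subset_iff)
      then have "s (space N \<times> space N - X) \<phi> + s X \<phi> = of_nat (size \<phi>) ^ 2"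
        by (simp add: xs power2_eq_square)
      \<comment> \<open>Cancellation needs a finite term; \<open>s X \<phi>\<close> is bounded by
        the square of a natural number.\<close>
      moreover from this have "s X \<phi> \<noteq> \<top>"
        by (metis add_top ennreal_add_eq_top ennreal_of_nat_neq_top ennreal_top_neq_one power_eq_top_ennreal_iff top_neq_ennreal)
      ultimately show ?thesis
        by (metis ennreal_add_diff_cancel_right infinity_ennreal_def)
    qed
    moreover have "(\<lambda>\<phi>. of_nat (size \<phi>) ^ 2 - s X \<phi>) \<in> borel_measurable (config_space N)"
      using compl by measurable
    ultimately show ?case
      by (subst measurable_cong) auto
  next
    case (union X)
    have "s (\<Union>i. X i) \<phi> = (\<Sum>i. s (X i) \<phi>)" for \<phi>
    proof -
      obtain xs where xs: "\<phi> = mset xs" using ex_mset by metis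
      show ?thesis
        unfolding xs s_mset suminf_indicator[OF union(1), symmetric]
        by (subst suminf_sum[symmetric], simp)+ simp
    qed
    then have "s (\<Union>i. X i) = (\<lambda>\<phi>. \<Sum>i. s (X i) \<phi>)"
      by auto
    then show ?case
      using union by simp
  qed
  then show ?thesis
    by (simp add: s_def[abs_def])
qed

section \<open>Generating functionals\<close>

lemma sum_choose_Suc:
  fixes g :: "nat \<Rightarrow> nat \<Rightarrow> 'a :: comm_semiring_1"
  shows "(\<Sum>d\<le>Suc m. of_nat (Suc m choose d) * g d (Suc m - d)) =
    (\<Sum>d\<le>m. of_nat (m choose d) * g d (Suc (m - d))) + (\<Sum>d\<le>m. of_nat (m choose d) * g (Suc d) (m - d))"
proof -
  have "(\<Sum>d\<le>Suc m. of_nat (Suc m choose d) * g d (Suc m - d)) =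
    g 0 (Suc m) + (\<Sum>d\<le>m. of_nat (m choose Suc d) * g (Suc d) (m - d)) + (\<Sum>d\<le>m. of_nat (m choose d) * g (Suc d) (m - d))"
    unfolding sum.atMost_Suc_shift by (simp add: distrib_right sum.distrib add_ac)
  also have "g 0 (Suc m) + (\<Sum>d\<le>m. of_nat (m choose Suc d) * g (Suc d) (m - d)) =
    (\<Sum>d\<le>Suc m. of_nat (m choose d) * g d (Suc m - d))"
    unfolding sum.atMost_Suc_shift by simp
  also have "\<dots> = (\<Sum>d\<le>m. of_nat (m choose d) * g d (Suc (m - d)))"
    by (simp add: Suc_diff_le binomial_eq_0)
  finally show ?thesis .
qed

text \<open>A binomial theorem for operators: each of \<open>m\<close> steps applies
  \<open>Q\<close> or \<open>A\<close>, and since \<open>Q\<close> can be absorbed through powers of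
  \<open>A\<close> under \<open>Y\<close>, only the number \<open>d\<close> of uses of
  \<open>A\<close> matters. \<open>good\<close> is the class of functions on which the hypotheses
  hold, later the symmetric measurable ones.\<close>

lemma operator_binomial:
  fixes X Y :: "nat \<Rightarrow> 'b \<Rightarrow> 'c :: comm_semiring_1" and A Q :: "'b \<Rightarrow> 'b"
  assumes X0: "\<And>F. good F \<Longrightarrow> X 0 F = Y 0 F"
    and X_Suc: "\<And>m F. good F \<Longrightarrow> X (Suc m) F = X m (Q F) + X m (A F)"
    and good: "\<And>F. good F \<Longrightarrow> good (Q F)" "\<And>F. good F \<Longrightarrow> good (A F)"
    and Y: "\<And>F j d. good F \<Longrightarrow> Y j ((A ^^ d) (Q F)) = Y (Suc j) ((A ^^ d) F)"
    and F: "good F"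
  shows "X m F = (\<Sum>d\<le>m. of_nat (m choose d) * Y (m - d) ((A ^^ d) F))"
  using F
proof (induction m arbitrary: F)
  case (Suc m)
  show ?case
    unfolding X_Suc[OF Suc.prems] Suc.IH[OF good(1)[OF Suc.prems]] Suc.IH[OF good(2)[OF Suc.prems]]
      Y[OF Suc.prems] sum_choose_Suc[of m "\<lambda>d j. Y j ((A ^^ d) F)"]
    by (simp add: funpow_swap1)
qed (simp add: X0)

text \<open>Binomial coefficients become products of reciprocal factorials, so the exponential
  generating series is summed over \<open>d\<close> and over the remaining index
  independently.\<close>

lemma operator_exponential:
  fixes X Y :: "nat \<Rightarrow> 'b \<Rightarrow> ennreal"
  assumes "\<And>m. X m F = (\<Sum>d\<le>m. of_nat (m choose d) * Y (m - d) ((A ^^ d) F))"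
  shows "(\<Sum>m. ennreal (1 / fact m) * X m F) =
    (\<Sum>d. ennreal (1 / fact d) * (\<Sum>j. ennreal (1 / fact j) * Y j ((A ^^ d) F)))"
proof -
  have "ennreal (1 / fact m) * of_nat (m choose d) = ennreal (1 / fact d) * ennreal (1 / fact (m - d))"
    if "d \<le> m" for m d
    using binomial_fact[OF that, where ?'a = real]
    by (simp add: ennreal_of_nat_eq_real_of_nat ennreal_mult[symmetric])
  then have "(\<Sum>m. ennreal (1 / fact m) * X m F) =
    (\<Sum>m. \<Sum>d\<le>m. ennreal (1 / fact d) * (ennreal (1 / fact (m - d)) * Y (m - d) ((A ^^ d) F)))"
    unfolding assms sum_distrib_left by (intro suminf_cong sum.cong refl) (simp add: mult.assoc[symmetric])
  also have "\<dots> = (\<Sum>d. \<Sum>j. ennreal (1 / fact d) * (ennreal (1 / fact j) * Y j ((A ^^ d) F)))"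
    by (rule suminf_triangle_ennreal)
  finally show ?thesis
    by simp
qed

section \<open>Insertion operators and generating functionals of association integrals\<close>

context association
begin

text \<open>An operator on functions of the hidden list. The constant weight \<open>q\<close>
  describes a missed point, the weight \<open>detect_int f\<close> a detected one whose measurement
  is tested with \<open>f\<close>.\<close>

definition insert_int :: "('a \<Rightarrow> ennreal) \<Rightarrow> ('a list \<Rightarrow> ennreal) \<Rightarrow> 'a list \<Rightarrow> ennreal" where
  "insert_int g F xs = (\<integral>\<^sup>+ x. g x * F (x # xs) \<partial>N)"

lemma insert_int_measurable [measurable]:
  assumes [measurable]: "g \<in> borel_measurable N" "F \<in> borel_measurable (list_space N)"
  shows "insert_int g F \<in> borel_measurable (list_space N)"
  unfolding insert_int_def[abs_def] by measurable

lemma insert_int_symmetric: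
  assumes "symmetric_on (space N) F"
  shows "symmetric_on (space N) (insert_int g F)"
  unfolding symmetric_on_def insert_int_def
proof (intro allI impI nn_integral_cong)
  fix xs ys x assume "xs \<in> lists (space N)" "mset xs = mset ys" "x \<in> space N"
  then show "g x * F (x # xs) = g x * F (x # ys)"
    by (intro arg_cong2[where f = "(*)"] refl symmetric_onD[OF assms]) auto
qed

lemma insert_int_cong:
  assumes "\<And>xs. xs \<in> lists (space N) \<Longrightarrow> F xs = G xs" "xs \<in> lists (space N)"
  shows "insert_int g F xs = insert_int g G xs"
  unfolding insert_int_def using assms by (intro nn_integral_cong) auto

lemma insert_int_funpow_cong:
  assumes "\<And>xs. xs \<in> lists (space N) \<Longrightarrow> F xs = G xs" "xs \<in> lists (space N)"
  shows "(insert_int g ^^ d) F xs = (insert_int g ^^ d) G xs"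
  using assms(2)
proof (induction d arbitrary: xs)
  case (Suc d)
  then show ?case by (simp add: insert_int_cong[OF Suc.IH])
qed (simp add: assms(1))

text \<open>Tonelli exchanges the two inserted points, and symmetry of \<open>F\<close> puts them
  back in order. This is the source of the commutation that \<open>operator_binomial\<close>
  demands.\<close>

lemma insert_int_commute:
  assumes [measurable]: "g \<in> borel_measurable N" "h \<in> borel_measurable N" "F \<in> borel_measurable (list_space N)"
    and sym: "symmetric_on (space N) F" and xs: "xs \<in> lists (space N)"
  shows "insert_int g (insert_int h F) xs = insert_int h (insert_int g F) xs"
proof -
  interpret pair_sigma_finite N N by (rule pair_sigma_finite_N)
  have [measurable]: "xs \<in> space (list_space N)"
    using xs by (simp add: space_list_space)
  have "insert_int g (insert_int h F) xs = (\<integral>\<^sup>+ x. \<integral>\<^sup>+ y. g x * (h y * F (y # x # xs)) \<partial>N \<partial>N)"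
    unfolding insert_int_def by (intro nn_integral_cong nn_integral_cmult[symmetric]) measurable
  also have "\<dots> = (\<integral>\<^sup>+ y. \<integral>\<^sup>+ x. g x * (h y * F (y # x # xs)) \<partial>N \<partial>N)"
    by (rule Fubini') measurable
  also have "\<dots> = (\<integral>\<^sup>+ y. \<integral>\<^sup>+ x. h y * (g x * F (x # y # xs)) \<partial>N \<partial>N)"
  proof (intro nn_integral_cong)
    fix x y assume "x \<in> space N" "y \<in> space N"
    then have "F (y # x # xs) = F (x # y # xs)"
      using xs by (intro symmetric_onD[OF sym]) auto
    then show "g x * (h y * F (y # x # xs)) = h y * (g x * F (x # y # xs))"
      by (simp add: mult_ac)
  qed
  also have "\<dots> = insert_int h (insert_int g F) xs"
    unfolding insert_int_def by (intro nn_integral_cong nn_integral_cmult) measurable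
  finally show ?thesis .
qed

lemma insert_int_funpow_commute:
  assumes g: "g \<in> borel_measurable N" and h: "h \<in> borel_measurable N"
    and F: "F \<in> borel_measurable (list_space N)" "symmetric_on (space N) F" and xs: "xs \<in> lists (space N)"
  shows "(insert_int g ^^ d) (insert_int h F) xs = insert_int h ((insert_int g ^^ d) F) xs"
  using F
proof (induction d arbitrary: F)
  case (Suc d)
  have "(insert_int g ^^ Suc d) (insert_int h F) xs = (insert_int g ^^ d) (insert_int g (insert_int h F)) xs"
    by (simp add: funpow_swap1)
  also have "\<dots> = (insert_int g ^^ d) (insert_int h (insert_int g F)) xs"
    using g h Suc.prems xs by (intro insert_int_funpow_cong insert_int_commute)
  also have "\<dots> = insert_int h ((insert_int g ^^ d) (insert_int g F)) xs"
    using g Suc.prems by (intro Suc.IH insert_int_measurable insert_int_symmetric)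
  finally show ?case
    by (simp add: funpow_swap1)
qed simp

lemma insert_int_funpow_cmult:
  assumes g: "g \<in> borel_measurable N"
    and F: "F \<in> borel_measurable (list_space N)" and xs: "xs \<in> lists (space N)"
  shows "(insert_int g ^^ d) (\<lambda>xs. b * F xs) xs = b * (insert_int g ^^ d) F xs"
  using F xs
proof (induction d arbitrary: F)
  case (Suc d)
  note [measurable] = g Suc.prems(1)
  have *: "insert_int g (\<lambda>xs. b * F xs) ys = b * insert_int g F ys" if "ys \<in> lists (space N)" for ys
  proof -
    have [measurable]: "ys \<in> space (list_space N)"
      using that by (simp add: space_list_space)
    show ?thesis
      unfolding insert_int_def mult.left_commute[of _ b] by (rule nn_integral_cmult) measurable
  qed
  have "(insert_int g ^^ Suc d) (\<lambda>xs. b * F xs) xs = (insert_int g ^^ d) (insert_int g (\<lambda>xs. b * F xs)) xs"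
    by (simp add: funpow_swap1)
  also have "\<dots> = (insert_int g ^^ d) (\<lambda>xs. b * insert_int g F xs) xs"
    using * Suc.prems(2) by (rule insert_int_funpow_cong)
  also have "\<dots> = b * (insert_int g ^^ d) (insert_int g F) xs"
    using g Suc.prems by (intro Suc.IH insert_int_measurable)
  finally show ?case
    by (simp add: funpow_swap1)
qed simp

lemma nn_integral_insert_int:
  assumes [measurable]: "g \<in> borel_measurable N" "F \<in> borel_measurable (list_space N)"
  shows "(\<integral>\<^sup>+ xs. insert_int g F xs \<partial>list_power N n) = (\<integral>\<^sup>+ x. g x * (\<integral>\<^sup>+ xs. F (x # xs) \<partial>list_power N n) \<partial>N)"
proof -
  interpret L: sigma_finite_measure "list_power N n" by (rule sigma_finite_list_power)
  interpret pair_sigma_finite N "list_power N n" ..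
  have "(\<integral>\<^sup>+ xs. insert_int g F xs \<partial>list_power N n) = (\<integral>\<^sup>+ x. \<integral>\<^sup>+ xs. g x * F (x # xs) \<partial>list_power N n \<partial>N)"
    unfolding insert_int_def by (rule Fubini') measurable
  also have "\<dots> = (\<integral>\<^sup>+ x. g x * (\<integral>\<^sup>+ xs. F (x # xs) \<partial>list_power N n) \<partial>N)"
    by (intro nn_integral_cong nn_integral_cmult) measurable
  finally show ?thesis .
qed

lemma J_insert_int:
  assumes "g \<in> borel_measurable N" "F \<in> borel_measurable (list_space N)" "zs \<in> lists (space N)"
  shows "J (insert_int g F) zs = (\<integral>\<^sup>+ x. g x * J (\<lambda>xs. F (x # xs)) zs \<partial>N)"
proof -
  note [measurable] = assms(1,2)
  \<comment> \<open>A general \<open>H\<close> survives the recursion, which puts the linked point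
    \<open>y\<close> between \<open>x\<close> and \<open>xs\<close>.\<close>
  have "J (\<lambda>xs. \<integral>\<^sup>+ x. H x xs \<partial>N) zs = (\<integral>\<^sup>+ x. J (H x) zs \<partial>N)"
    if "(\<lambda>(x, xs). H x xs) \<in> borel_measurable (N \<Otimes>\<^sub>M list_space N)" for H :: "'a \<Rightarrow> 'a list \<Rightarrow> ennreal"
    using assms(3) that
  proof (induction zs arbitrary: H)
    case Nil
    note [measurable] = Nil
    interpret pair_sigma_finite N mix ..
    show ?case
      by simp (rule Fubini', measurable)
  next
    case (Cons z zs)
    note [measurable] = Cons.prems
    interpret pair_sigma_finite N N by (rule pair_sigma_finite_N)
    have [measurable]: "z \<in> space N" "zs \<in> space (list_space N)"
      using Cons.hyps by (auto simp: space_list_space)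
    have IH: "J (\<lambda>xs. \<integral>\<^sup>+ x. H x (y # xs) \<partial>N) zs = (\<integral>\<^sup>+ x. J (\<lambda>xs. H x (y # xs)) zs \<partial>N)" if [measurable]: "y \<in> space N" for y
      by (rule Cons.IH) measurable
    have "(\<integral>\<^sup>+ y. k z y * J (\<lambda>xs. \<integral>\<^sup>+ x. H x (y # xs) \<partial>N) zs \<partial>N) =
      (\<integral>\<^sup>+ y. \<integral>\<^sup>+ x. k z y * J (\<lambda>xs. H x (y # xs)) zs \<partial>N \<partial>N)"
    proof (rule nn_integral_cong)
      fix y assume [measurable]: "y \<in> space N"
      show "k z y * J (\<lambda>xs. \<integral>\<^sup>+ x. H x (y # xs) \<partial>N) zs = (\<integral>\<^sup>+ x. k z y * J (\<lambda>xs. H x (y # xs)) zs \<partial>N)"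
        unfolding IH[OF \<open>y \<in> space N\<close>] by (rule nn_integral_cmult[symmetric]) measurable
    qed
    also have "\<dots> = (\<integral>\<^sup>+ x. \<integral>\<^sup>+ y. k z y * J (\<lambda>xs. H x (y # xs)) zs \<partial>N \<partial>N)"
      by (rule Fubini') measurable
    finally have "J (\<lambda>xs. \<integral>\<^sup>+ x. H x xs \<partial>N) (z # zs) =
      (\<integral>\<^sup>+ x. c z * J (H x) zs \<partial>N) + (\<integral>\<^sup>+ x. \<integral>\<^sup>+ y. k z y * J (\<lambda>xs. H x (y # xs)) zs \<partial>N \<partial>N)"
      by (simp add: Cons.IH[OF Cons.prems] nn_integral_cmult)
    also have "\<dots> = (\<integral>\<^sup>+ x. c z * J (H x) zs + (\<integral>\<^sup>+ y. k z y * J (\<lambda>xs. H x (y # xs)) zs \<partial>N) \<partial>N)"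
      by (rule nn_integral_add[symmetric]) measurable
    finally show ?case by simp
  qed
  from this[of "\<lambda>x xs. g x * F (x # xs)"]
  have "J (insert_int g F) zs = (\<integral>\<^sup>+ x. J (\<lambda>xs. g x * F (x # xs)) zs \<partial>N)"
    unfolding insert_int_def[abs_def] by simp
  also have "\<dots> = (\<integral>\<^sup>+ x. g x * J (\<lambda>xs. F (x # xs)) zs \<partial>N)"
    using assms(3) by (intro nn_integral_cong J_cmult) auto
  finally show ?thesis .
qed

text \<open>Up to subtraction of the total intensity, this is the exponent in the generating
  functional of the Poisson clutter.\<close>

definition clutter_int :: "('a \<Rightarrow> ennreal) \<Rightarrow> ennreal" where
  "clutter_int f = (\<integral>\<^sup>+ z. f z * c z \<partial>N)"

text \<open>Together with the constant \<open>q\<close> this is the generating functional of the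
  observation of a single hidden point \<open>x\<close>, as \<open>nn_integral_obs_point\<close>
  shows.\<close>

definition detect_int :: "('a \<Rightarrow> ennreal) \<Rightarrow> 'a \<Rightarrow> ennreal" where
  "detect_int f x = (\<integral>\<^sup>+ z. f z * k z x \<partial>N)"

lemma detect_int_measurable [measurable]:
  assumes [measurable]: "f \<in> borel_measurable N"
  shows "detect_int f \<in> borel_measurable N"
  unfolding detect_int_def[abs_def] by measurable

lemma prod_list_measurable [measurable]:
  assumes "f \<in> borel_measurable N"
  shows "(\<lambda>xs. prod_list (map f xs) :: ennreal) \<in> borel_measurable (list_space N)"
proof (rule measurable_list_spaceI)
  fix n :: nat
  note [measurable] = assms
  have "(\<lambda>x. \<Prod>i<n. f (x i)) \<in> borel_measurable (PiM {..<n} (\<lambda>_. N))"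
    by measurable
  then show "(\<lambda>x. prod_list (map f (map x [0..<n]))) \<in> borel_measurable (PiM {..<n} (\<lambda>_. N))"
    by (simp add: prod.list_conv_set_nth atLeast0LessThan cong: prod.cong_simp)
qed

text \<open>The first measurement is integrated out. As clutter it leaves a constant factor, as a
  linked measurement it turns into the weight of an inserted hidden point; the result is a recursion
  of the form required by \<open>operator_binomial\<close>.\<close>

lemma nn_integral_prod_J_Suc:
  assumes [measurable]: "f \<in> borel_measurable N" "F \<in> borel_measurable (list_space N)"
  shows "(\<integral>\<^sup>+ zs. prod_list (map f zs) * J F zs \<partial>list_power N (Suc m)) =
    clutter_int f * (\<integral>\<^sup>+ zs. prod_list (map f zs) * J F zs \<partial>list_power N m) +
    (\<integral>\<^sup>+ zs. prod_list (map f zs) * J (insert_int (detect_int f) F) zs \<partial>list_power N m)"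
proof -
  interpret L: sigma_finite_measure "list_power N m" by (rule sigma_finite_list_power)
  interpret pair_sigma_finite N "list_power N m" ..
  let ?P = "\<lambda>zs. prod_list (map f zs)"
  have "(\<integral>\<^sup>+ zs. ?P zs * J F zs \<partial>list_power N (Suc m)) =
     (\<integral>\<^sup>+ z. \<integral>\<^sup>+ zs. ?P (z # zs) * J F (z # zs) \<partial>list_power N m \<partial>N)"
    by (rule nn_integral_list_power_Suc) measurable
  also have "\<dots> = (\<integral>\<^sup>+ zs. \<integral>\<^sup>+ z. ?P (z # zs) * J F (z # zs) \<partial>N \<partial>list_power N m)"
    by (rule Fubini'[symmetric]) measurable
  also have "\<dots> = (\<integral>\<^sup>+ zs. clutter_int f * (?P zs * J F zs) + ?P zs * J (insert_int (detect_int f) F) zs \<partial>list_power N m)"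
  proof (rule nn_integral_cong)
    fix zs assume zs [measurable]: "zs \<in> space (list_power N m)"
    then have [measurable]: "zs \<in> space (list_space N)" and zs': "zs \<in> lists (space N)"
      by (simp_all add: space_list_space)
    interpret NN: pair_sigma_finite N N by (rule pair_sigma_finite_N)
    have "(\<integral>\<^sup>+ z. ?P (z # zs) * J F (z # zs) \<partial>N) =
      (\<integral>\<^sup>+ z. f z * c z * (?P zs * J F zs) + (\<integral>\<^sup>+ x. ?P zs * (f z * k z x * J (\<lambda>xs. F (x # xs)) zs) \<partial>N) \<partial>N)"
    proof (rule nn_integral_cong)
      fix z assume [measurable]: "z \<in> space N"
      have "(\<integral>\<^sup>+ x. ?P zs * (f z * k z x * J (\<lambda>xs. F (x # xs)) zs) \<partial>N) =
        (\<integral>\<^sup>+ x. (?P zs * f z) * (k z x * J (\<lambda>xs. F (x # xs)) zs) \<partial>N)"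
        by (simp add: mult_ac)
      also have "\<dots> = ?P zs * f z * (\<integral>\<^sup>+ x. k z x * J (\<lambda>xs. F (x # xs)) zs \<partial>N)"
        by (rule nn_integral_cmult) measurable
      finally show "?P (z # zs) * J F (z # zs) =
        f z * c z * (?P zs * J F zs) + (\<integral>\<^sup>+ x. ?P zs * (f z * k z x * J (\<lambda>xs. F (x # xs)) zs) \<partial>N)"
        by (simp add: distrib_left mult_ac)
    qed
    also have "\<dots> = (\<integral>\<^sup>+ z. f z * c z * (?P zs * J F zs) \<partial>N) +
      (\<integral>\<^sup>+ z. \<integral>\<^sup>+ x. ?P zs * (f z * k z x * J (\<lambda>xs. F (x # xs)) zs) \<partial>N \<partial>N)"
      by (rule nn_integral_add) measurable
    also have "(\<integral>\<^sup>+ z. f z * c z * (?P zs * J F zs) \<partial>N) = clutter_int f * (?P zs * J F zs)"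
      unfolding clutter_int_def by (rule nn_integral_multc) measurable
    also have "(\<integral>\<^sup>+ z. \<integral>\<^sup>+ x. ?P zs * (f z * k z x * J (\<lambda>xs. F (x # xs)) zs) \<partial>N \<partial>N) =
      (\<integral>\<^sup>+ x. \<integral>\<^sup>+ z. ?P zs * (f z * k z x * J (\<lambda>xs. F (x # xs)) zs) \<partial>N \<partial>N)"
      by (rule NN.Fubini') measurable
    also have "\<dots> = (\<integral>\<^sup>+ x. ?P zs * (detect_int f x * J (\<lambda>xs. F (x # xs)) zs) \<partial>N)"
    proof (rule nn_integral_cong)
      fix x assume [measurable]: "x \<in> space N"
      have "(\<integral>\<^sup>+ z. ?P zs * (f z * k z x * J (\<lambda>xs. F (x # xs)) zs) \<partial>N) =
        ?P zs * (\<integral>\<^sup>+ z. f z * k z x * J (\<lambda>xs. F (x # xs)) zs \<partial>N)"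
        by (rule nn_integral_cmult) measurable
      also have "(\<integral>\<^sup>+ z. f z * k z x * J (\<lambda>xs. F (x # xs)) zs \<partial>N) = detect_int f x * J (\<lambda>xs. F (x # xs)) zs"
        unfolding detect_int_def by (rule nn_integral_multc) measurable
      finally show "(\<integral>\<^sup>+ z. ?P zs * (f z * k z x * J (\<lambda>xs. F (x # xs)) zs) \<partial>N) =
        ?P zs * (detect_int f x * J (\<lambda>xs. F (x # xs)) zs)" .
    qed
    also have "\<dots> = ?P zs * (\<integral>\<^sup>+ x. detect_int f x * J (\<lambda>xs. F (x # xs)) zs \<partial>N)"
      by (rule nn_integral_cmult) measurable
    finally show "(\<integral>\<^sup>+ z. ?P (z # zs) * J F (z # zs) \<partial>N) =
      clutter_int f * (?P zs * J F zs) + ?P zs * J (insert_int (detect_int f) F) zs"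
      using zs' by (simp add: J_insert_int)
  qed
  also have "\<dots> = (\<integral>\<^sup>+ zs. clutter_int f * (?P zs * J F zs) \<partial>list_power N m) +
      (\<integral>\<^sup>+ zs. ?P zs * J (insert_int (detect_int f) F) zs \<partial>list_power N m)"
    by (rule nn_integral_add) measurable
  also have "(\<integral>\<^sup>+ zs. clutter_int f * (?P zs * J F zs) \<partial>list_power N m) =
      clutter_int f * (\<integral>\<^sup>+ zs. ?P zs * J F zs \<partial>list_power N m)"
    by (rule nn_integral_cmult) measurable
  finally show ?thesis .
qed

text \<open>Both sides sum over the same histories. On the left each measurement is clutter or
  linked, on the right each hidden point is missed or detected; \<open>operator_binomial\<close>
  applies to both, and with \<open>d\<close> detected points the same terms
  \<open>Y n ((?A ^^ d) F)\<close> appear.\<close>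

lemma generating_functional_J:
  assumes f [measurable]: "f \<in> borel_measurable N"
    and F: "F \<in> borel_measurable (list_space N)" "symmetric_on (space N) F"
  shows "(\<integral>\<^sup>+ zs. prod_list (map f zs) * J F zs \<partial>list_mix N (\<lambda>n. ennreal (1 / fact n))) =
    (\<Sum>j. ennreal (1 / fact j) * clutter_int f ^ j) *
    (\<integral>\<^sup>+ xs. prod_list (map (\<lambda>x. ennreal q + detect_int f x) xs) * F xs \<partial>list_mix N (\<lambda>n. ennreal (1 / fact n)))"
proof -
  let ?a = "detect_int f" and ?b = "clutter_int f"
  let ?P = "\<lambda>zs. prod_list (map f zs)" and ?R = "\<lambda>xs. prod_list (map (\<lambda>x. ennreal q + detect_int f x) xs)"
  let ?A = "insert_int ?a"
  define good where "good F \<longleftrightarrow> F \<in> borel_measurable (list_space N) \<and> symmetric_on (space N) F" for F :: "'a list \<Rightarrow> ennreal"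
  have good_A: "good (insert_int g F)" if "good F" "g \<in> borel_measurable N" for g F
    using that by (auto simp: good_def intro: insert_int_symmetric)
  have good_A_pow: "good ((?A ^^ d) F)" if "good F" for d F
    using that by (induction d) (auto intro: good_A)
  define T where "T m F = (\<integral>\<^sup>+ zs. ?P zs * J F zs \<partial>list_power N m)" for m F
  define S where "S n F = (\<integral>\<^sup>+ xs. ?R xs * F xs \<partial>list_power N n)" for n F
  define Y where "Y n F = ennreal q ^ n * (\<integral>\<^sup>+ xs. F xs \<partial>list_power N n)" for n F
  have J_Nil: "J F [] = (\<Sum>n. ennreal (1 / fact n) * Y n F)" if "good F" for F
  proof -
    have "ennreal (q ^ n / fact n) = ennreal (1 / fact n) * ennreal q ^ n" for n
      using q_nonneg by (simp add: ennreal_power ennreal_mult[symmetric])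
    then show ?thesis
      using that unfolding Y_def good_def by (subst J_sum_list_power) (auto simp: mult_ac)
  qed
  \<comment> \<open>Here \<open>Q\<close> multiplies by the clutter integral and \<open>A\<close>
    links a measurement; evaluation of \<open>J\<close> at the empty list collects the missed hidden
    points.\<close>
  have T: "T m F = (\<Sum>d\<le>m. of_nat (m choose d) * (?b ^ (m - d) * J ((?A ^^ d) F) []))" if "good F" for m F
  proof (rule operator_binomial[where good = good and Q = "\<lambda>F xs. ?b * F xs"])
    fix F assume F: "good F"
    then have [measurable]: "F \<in> borel_measurable (list_space N)" by (simp add: good_def)
    show "T 0 F = ?b ^ 0 * J F []"
    proof -
      have "(\<lambda>zs. ?P zs * J F zs) \<in> borel_measurable (list_space N)" by measurable
      from list_power_0[OF this] show ?thesis by (simp add: T_def)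
    qed
    show "good (?A F)" using F by (simp add: good_A)
    show "good (\<lambda>xs. ?b * F xs)" using F by (auto simp: good_def symmetric_on_def)
    show "T (Suc m) F = T m (\<lambda>xs. ?b * F xs) + T m (?A F)" for m
    proof -
      have "T m (\<lambda>xs. ?b * F xs) = (\<integral>\<^sup>+ zs. ?b * (?P zs * J F zs) \<partial>list_power N m)"
        unfolding T_def by (intro nn_integral_cong) (subst J_cmult, auto simp: space_list_space mult_ac)
      also have "\<dots> = ?b * T m F"
        unfolding T_def by (rule nn_integral_cmult) measurable
      finally show ?thesis
        using nn_integral_prod_J_Suc[of f F m] by (simp add: T_def)
    qed
    show "?b ^ j * J ((?A ^^ d) (\<lambda>xs. ?b * F xs)) [] = ?b ^ Suc j * J ((?A ^^ d) F) []" for j d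
    proof -
      have "J ((?A ^^ d) (\<lambda>xs. ?b * F xs)) [] = J (\<lambda>xs. ?b * (?A ^^ d) F xs) []"
        by (rule J_cong, rule insert_int_funpow_cmult) auto
      also have "\<dots> = ?b * J ((?A ^^ d) F) []"
        using good_A_pow[OF F] by (intro J_cmult) (auto simp: good_def)
      finally show ?thesis by (simp add: mult_ac)
    qed
  qed fact
  \<comment> \<open>Here \<open>Q\<close> inserts a missed point with weight \<open>q\<close> and
    \<open>A\<close> a detected one.\<close>
  have S: "S n F = (\<Sum>d\<le>n. of_nat (n choose d) * Y (n - d) ((?A ^^ d) F))" if "good F" for n F
  proof (rule operator_binomial[where good = good and Q = "insert_int (\<lambda>_. ennreal q)"])
    fix F assume F: "good F"
    then have [measurable]: "F \<in> borel_measurable (list_space N)" and sym: "symmetric_on (space N) F"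
      by (simp_all add: good_def)
    show "S 0 F = Y 0 F"
    proof -
      have "(\<lambda>xs. ?R xs * F xs) \<in> borel_measurable (list_space N)" by measurable
      from list_power_0[OF this] show ?thesis by (simp add: S_def Y_def list_power_0)
    qed
    show "good (?A F)" "good (insert_int (\<lambda>_. ennreal q) F)" using F by (simp_all add: good_A)
    show "S (Suc n) F = S n (insert_int (\<lambda>_. ennreal q) F) + S n (?A F)" for n
    proof -
      interpret L: sigma_finite_measure "list_power N n" by (rule sigma_finite_list_power)
      interpret pair_sigma_finite N "list_power N n" ..
      have ins: "S n (insert_int g F) = (\<integral>\<^sup>+ x. \<integral>\<^sup>+ xs. g x * (?R xs * F (x # xs)) \<partial>list_power N n \<partial>N)"
        if [measurable]: "g \<in> borel_measurable N" for g
      proof -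
        have "S n (insert_int g F) = (\<integral>\<^sup>+ xs. \<integral>\<^sup>+ x. g x * (?R xs * F (x # xs)) \<partial>N \<partial>list_power N n)"
          unfolding S_def insert_int_def
        proof (rule nn_integral_cong)
          fix xs assume "xs \<in> space (list_power N n)"
          then have [measurable]: "xs \<in> space (list_space N)" by simp
          have "?R xs * (\<integral>\<^sup>+ x. g x * F (x # xs) \<partial>N) = (\<integral>\<^sup>+ x. ?R xs * (g x * F (x # xs)) \<partial>N)"
            by (rule nn_integral_cmult[symmetric]) measurable
          then show "?R xs * (\<integral>\<^sup>+ x. g x * F (x # xs) \<partial>N) = (\<integral>\<^sup>+ x. g x * (?R xs * F (x # xs)) \<partial>N)"
            by (simp add: mult_ac)
        qed
        also have "\<dots> = (\<integral>\<^sup>+ x. \<integral>\<^sup>+ xs. g x * (?R xs * F (x # xs)) \<partial>list_power N n \<partial>N)"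
          by (rule Fubini') measurable
        finally show ?thesis .
      qed
      have "S (Suc n) F = (\<integral>\<^sup>+ x. \<integral>\<^sup>+ xs. ennreal q * (?R xs * F (x # xs)) + ?a x * (?R xs * F (x # xs)) \<partial>list_power N n \<partial>N)"
        unfolding S_def by (subst nn_integral_list_power_Suc) (auto simp: distrib_right distrib_left mult_ac)
      also have "\<dots> = (\<integral>\<^sup>+ x. (\<integral>\<^sup>+ xs. ennreal q * (?R xs * F (x # xs)) \<partial>list_power N n) +
          (\<integral>\<^sup>+ xs. ?a x * (?R xs * F (x # xs)) \<partial>list_power N n) \<partial>N)"
        by (intro nn_integral_cong nn_integral_add) measurable
      also have "\<dots> = S n (insert_int (\<lambda>_. ennreal q) F) + S n (?A F)"
        unfolding ins[OF detect_int_measurable[OF f]] ins[of "\<lambda>_. ennreal q", OF measurable_const, simplified]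
        by (rule nn_integral_add) measurable
      finally show ?thesis .
    qed
    show "Y j ((?A ^^ d) (insert_int (\<lambda>_. ennreal q) F)) = Y (Suc j) ((?A ^^ d) F)" for j d
    proof -
      note [measurable] = good_A_pow[OF F, unfolded good_def, THEN conjunct1]
      interpret L: sigma_finite_measure "list_power N j" by (rule sigma_finite_list_power)
      have "(\<integral>\<^sup>+ xs. (?A ^^ d) (insert_int (\<lambda>_. ennreal q) F) xs \<partial>list_power N j) =
        (\<integral>\<^sup>+ xs. insert_int (\<lambda>_. ennreal q) ((?A ^^ d) F) xs \<partial>list_power N j)"
        using sym by (intro nn_integral_cong insert_int_funpow_commute) (auto simp: space_list_space)
      also have "\<dots> = (\<integral>\<^sup>+ x. ennreal q * (\<integral>\<^sup>+ xs. (?A ^^ d) F (x # xs) \<partial>list_power N j) \<partial>N)"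
        by (rule nn_integral_insert_int) measurable
      also have "\<dots> = ennreal q * (\<integral>\<^sup>+ x. (\<integral>\<^sup>+ xs. (?A ^^ d) F (x # xs) \<partial>list_power N j) \<partial>N)"
        by (rule nn_integral_cmult) measurable
      also have "\<dots> = ennreal q * (\<integral>\<^sup>+ xs. (?A ^^ d) F xs \<partial>list_power N (Suc j))"
        by (subst nn_integral_list_power_Suc) measurable
      finally show ?thesis
        by (simp add: Y_def mult_ac)
    qed
  qed fact
  have F': "good F" using F by (simp add: good_def)
  note [measurable] = F(1)
  have "(\<integral>\<^sup>+ zs. ?P zs * J F zs \<partial>list_mix N (\<lambda>n. ennreal (1 / fact n))) = (\<Sum>m. ennreal (1 / fact m) * T m F)"
    unfolding T_def by (rule nn_integral_list_mix) measurable
  also have "\<dots> = (\<Sum>d. ennreal (1 / fact d) * (\<Sum>j. ennreal (1 / fact j) * (?b ^ j * J ((?A ^^ d) F) [])))"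
    by (rule operator_exponential[where X = T and Y = "\<lambda>j F. ?b ^ j * J F []"]) (rule T[OF F'])
  \<comment> \<open>The clutter series is the same for every \<open>d\<close>, so it factors
    out.\<close>
  also have "\<dots> = (\<Sum>j. ennreal (1 / fact j) * ?b ^ j) * (\<Sum>d. ennreal (1 / fact d) * J ((?A ^^ d) F) [])"
  proof -
    have "(\<Sum>j. ennreal (1 / fact j) * (?b ^ j * y)) = (\<Sum>j. ennreal (1 / fact j) * ?b ^ j) * y" for y
      unfolding mult.assoc[symmetric] by simp
    then show ?thesis
      by (simp add: mult.left_commute[of _ "\<Sum>j. ennreal (1 / fact j) * ?b ^ j"] del: assoc_int.simps)
  qed
  also have "(\<Sum>d. ennreal (1 / fact d) * J ((?A ^^ d) F) []) =
    (\<Sum>d. ennreal (1 / fact d) * (\<Sum>n. ennreal (1 / fact n) * Y n ((?A ^^ d) F)))"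
    by (simp only: J_Nil[OF good_A_pow[OF F']])
  also have "\<dots> = (\<Sum>n. ennreal (1 / fact n) * S n F)"
    by (rule operator_exponential[where X = S and Y = Y, symmetric]) (rule S[OF F'])
  also have "\<dots> = (\<integral>\<^sup>+ xs. ?R xs * F xs \<partial>list_mix N (\<lambda>n. ennreal (1 / fact n)))"
    unfolding S_def by (rule nn_integral_list_mix[symmetric]) measurable
  finally show ?thesis .
qed

end

section \<open>Generating functionals of the observations and of the clutter\<close>

context measurement
begin

lemma simple_imp_measurable: "simple_function N f \<Longrightarrow> f \<in> borel_measurable N" for f :: "'a \<Rightarrow> ennreal"
  by (rule borel_measurable_simple_function)

abbreviation displaced :: "'a \<Rightarrow> bool \<Rightarrow> 'a multiset measure" where
  "displaced x kept \<equiv> (if kept then distr (density N (\<lambda>z. ennreal (ld z x))) (config_space N) (\<lambda>z. {#z#})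
     else return (config_space N) {#})"

lemma empty_in_config_space: "{#} \<in> space (config_space N)"
  by (simp add: space_config_space)

lemma measurable_single_density:
  "(\<lambda>z. {#z#}) \<in> measurable (density N g) (config_space N)"
  using measurable_config_single[of N] by simp

lemma displaced_in_prob_algebra:
  assumes x [measurable]: "x \<in> space N"
  shows "displaced x kept \<in> space (prob_algebra (config_space N))"
proof -
  have "prob_space (density N (\<lambda>z. ennreal (ld z x)))"
    by (rule prob_spaceI) (simp add: emeasure_density ld_normalized[OF x] cong: nn_integral_cong_simp)
  then have "prob_space (distr (density N (\<lambda>z. ennreal (ld z x))) (config_space N) (\<lambda>z. {#z#}))"
    by (rule prob_space.prob_space_distr) (rule measurable_single_density)
  then show ?thesis
    using empty_in_config_space by (auto simp: space_prob_algebra prob_space_return)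
qed

lemma displaced_measurable:
  assumes "x \<in> space N"
  shows "displaced x \<in> measurable (measure_pmf (bernoulli_pmf p)) (subprob_algebra (config_space N))"
  using displaced_in_prob_algebra[OF assms]
  by (auto simp: space_prob_algebra space_subprob_algebra prob_space_imp_subprob_space)

lemma sets_obs_point:
  assumes "x \<in> space N"
  shows "sets (obs_point N p ld x) = sets (config_space N)"
  unfolding obs_point_def by (rule sets_bind) auto

lemma nn_integral_obs_point:
  assumes x: "x \<in> space N" and f: "simple_function N f"
  shows "(\<integral>\<^sup>+ \<xi>. config_prod f \<xi> \<partial>obs_point N p ld x) = ennreal (1 - p) + detect_int f x"
proof -
  note [measurable] = x config_prod_measurable[OF f] simple_imp_measurable[OF f]
  have "(\<integral>\<^sup>+ \<xi>. config_prod f \<xi> \<partial>obs_point N p ld x) =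
    (\<integral>\<^sup>+ kept. \<integral>\<^sup>+ \<xi>. config_prod f \<xi> \<partial>displaced x kept \<partial>measure_pmf (bernoulli_pmf p))"
    unfolding obs_point_def by (rule nn_integral_bind[OF _ displaced_measurable[OF x]]) measurable
  also have "\<dots> = (\<integral>\<^sup>+ \<xi>. config_prod f \<xi> \<partial>displaced x True) * ennreal p +
      (\<integral>\<^sup>+ \<xi>. config_prod f \<xi> \<partial>displaced x False) * ennreal (1 - p)"
    using p_pos p_le_1 by (subst nn_integral_bernoulli_pmf) auto
  also have "(\<integral>\<^sup>+ \<xi>. config_prod f \<xi> \<partial>displaced x False) = 1"
    using empty_in_config_space by (simp add: nn_integral_return)
  also have "(\<integral>\<^sup>+ \<xi>. config_prod f \<xi> \<partial>displaced x True) = (\<integral>\<^sup>+ z. ennreal (ld z x) * f z \<partial>N)"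
    by (simp add: nn_integral_distr[OF measurable_single_density] nn_integral_density)
  also have "\<dots> * ennreal p = (\<integral>\<^sup>+ z. ennreal (ld z x) * f z * ennreal p \<partial>N)"
    by (rule nn_integral_multc[symmetric]) measurable
  also have "\<dots> = detect_int f x"
    unfolding detect_int_def using p_pos ld_nonneg x
    by (intro nn_integral_cong) (simp add: ennreal_mult' mult_ac)
  finally show ?thesis
    by (simp add: add.commute)
qed

lemma prob_space_obs_point:
  assumes x: "x \<in> space N"
  shows "prob_space (obs_point N p ld x)"
  unfolding obs_point_def
  using displaced_in_prob_algebra[OF x]
  by (intro measure_pmf.prob_space_bind[OF _ displaced_measurable[OF x]]) (auto simp: space_prob_algebra)

text \<open>Given the configuration, the observations of its points are independent, so the
  functional of their sum is the product of the one-point functionals, repeated according to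
  multiplicity.\<close>

lemma nn_integral_obs_config:
  assumes \<phi>: "\<phi> \<in> space (config_space N)" and f: "simple_function N f"
  shows "(\<integral>\<^sup>+ \<xi>. config_prod f \<xi> \<partial>obs_config N p ld \<phi>) = config_prod (\<lambda>x. ennreal (1 - p) + detect_int f x) \<phi>"
proof -
  note [measurable] = config_prod_measurable[OF f]
  define I where "I = (SIGMA x:set_mset \<phi>. {..<count \<phi> x})"
  have fin: "finite I" by (simp add: I_def)
  \<comment> \<open>The product theorem wants a sigma-finite measure at every index; outside
    \<open>I\<close>, where the point may lie outside the window, a point mass serves as a
    filler.\<close>
  define D where "D i = (if i \<in> I then obs_point N p ld (fst i) else return (config_space N) {#})" for i :: "'a \<times> nat"
  have sp: "fst i \<in> space N" if "i \<in> I" for i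
    using that \<phi> by (auto simp: I_def space_config_space)
  have sets_D [measurable_cong]: "sets (D i) = sets (config_space N)" for i
    using sets_obs_point[OF sp] by (auto simp: D_def)
  have "prob_space (D i)" for i
    using prob_space_obs_point[OF sp] empty_in_config_space by (auto simp: D_def prob_space_return)
  then interpret product_sigma_finite D
    by (simp add: product_sigma_finite_def prob_space_imp_sigma_finite)
  have PiM: "PiM I (\<lambda>(x, k). obs_point N p ld x) = PiM I D"
    by (rule PiM_cong) (auto simp: D_def)
  have sum_meas: "(\<lambda>\<omega>. \<Sum>i\<in>K. \<omega> i) \<in> measurable (PiM I D) (config_space N)" if "finite K" "K \<subseteq> I" for K
    using that
  proof (induction K rule: finite_induct)
    case (insert i K)
    then have i: "i \<in> I" by simp
    have "(\<lambda>\<omega>. \<omega> i) \<in> measurable (PiM I D) (D i)"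
      using i by (rule measurable_component_singleton)
    then have [measurable]: "(\<lambda>\<omega>. \<omega> i) \<in> measurable (PiM I D) (config_space N)"
      using sets_D by (simp cong: measurable_cong_sets)
    have [measurable]: "(\<lambda>\<omega>. \<Sum>i\<in>K. \<omega> i) \<in> measurable (PiM I D) (config_space N)"
      using insert by simp
    show ?case
      using insert by simp
  qed simp
  have "(\<integral>\<^sup>+ \<xi>. config_prod f \<xi> \<partial>obs_config N p ld \<phi>) =
    (\<integral>\<^sup>+ \<xi>. config_prod f \<xi> \<partial>distr (PiM I D) (config_space N) (\<lambda>\<omega>. \<Sum>i\<in>I. \<omega> i))"
    unfolding obs_config_def I_def[symmetric] Let_def PiM ..
  also have "\<dots> = (\<integral>\<^sup>+ \<omega>. config_prod f (\<Sum>i\<in>I. \<omega> i) \<partial>PiM I D)"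
    by (rule nn_integral_distr[OF sum_meas[OF fin order_refl]]) measurable
  also have "\<dots> = (\<integral>\<^sup>+ \<omega>. (\<Prod>i\<in>I. config_prod f (\<omega> i)) \<partial>PiM I D)"
    using fin by (simp add: config_prod_sum)
  also have "\<dots> = (\<Prod>i\<in>I. \<integral>\<^sup>+ \<xi>. config_prod f \<xi> \<partial>D i)"
    by (rule product_nn_integral_prod[OF fin]) measurable
  also have "\<dots> = (\<Prod>i\<in>I. ennreal (1 - p) + detect_int f (fst i))"
    by (intro prod.cong refl) (simp add: D_def nn_integral_obs_point[OF sp f])
  also have "\<dots> = (\<Prod>x\<in>set_mset \<phi>. \<Prod>k<count \<phi> x. ennreal (1 - p) + detect_int f x)"
    unfolding I_def by (subst prod.Sigma) (auto simp: case_prod_beta)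
  also have "\<dots> = config_prod (\<lambda>x. ennreal (1 - p) + detect_int f x) \<phi>"
    by (simp add: config_prod_def image_prod_mset_multiplicity)
  finally show ?thesis .
qed

text \<open>The definition of a Poisson process speaks of set integrals of \<open>lc\<close>; the
  level sets of a simple function express both the clutter integral and the total intensity through
  these.\<close>

lemma clutter_int_eq_set_integrals:
  assumes f: "simple_function N f" "\<And>x. x \<in> space N \<Longrightarrow> f x \<noteq> \<top>"
  shows "clutter_int f = (\<Sum>v\<in>f ` space N. v * ennreal (LINT x:(f -` {v} \<inter> space N)|N. lc x))"
    and "(\<Sum>v\<in>f ` space N. (LINT x:(f -` {v} \<inter> space N)|N. lc x)) = (LINT x|N. lc x)"
proof -
  let ?B = "\<lambda>v. f -` {v} \<inter> space N"
  have B [measurable]: "?B v \<in> sets N" for v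
    using f(1) by (rule simple_functionD)
  have fin: "finite (f ` space N)"
    using f(1) by (rule simple_functionD)
  have int: "integrable N (\<lambda>x. indicator (?B v) x *\<^sub>R lc x)" for v
    using lc_integrable by (intro integrable_mult_indicator) auto
  have set_int: "ennreal (LINT x:(?B v)|N. lc x) = (\<integral>\<^sup>+ x. indicator (?B v) x * ennreal (lc x) \<partial>N)" for v
  proof -
    have "(\<integral>\<^sup>+ x. indicator (?B v) x * ennreal (lc x) \<partial>N) = (\<integral>\<^sup>+ x. ennreal (indicator (?B v) x *\<^sub>R lc x) \<partial>N)"
      by (intro nn_integral_cong) (simp add: indicator_def)
    also have "\<dots> = ennreal (LINT x:(?B v)|N. lc x)"
      unfolding set_lebesgue_integral_def
      by (rule nn_integral_eq_integral[OF int]) (auto simp: lc_nonneg indicator_def)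
    finally show ?thesis by simp
  qed
  have "clutter_int f = (\<integral>\<^sup>+ x. (\<Sum>v\<in>f ` space N. v * (indicator (?B v) x * ennreal (lc x))) \<partial>N)"
    unfolding clutter_int_def
  proof (rule nn_integral_cong)
    fix x assume x: "x \<in> space N"
    have "(\<Sum>v\<in>f ` space N. v * (indicator (?B v) x * ennreal (lc x))) =
      (\<Sum>v\<in>f ` space N. if v = f x then v * ennreal (lc x) else 0)"
      using x by (intro sum.cong) (auto simp: indicator_def)
    also have "\<dots> = f x * ennreal (lc x)"
      using x fin by simp
    finally show "f x * ennreal (lc x) = (\<Sum>v\<in>f ` space N. v * (indicator (?B v) x * ennreal (lc x)))" ..
  qed
  also have "\<dots> = (\<Sum>v\<in>f ` space N. v * ennreal (LINT x:(?B v)|N. lc x))"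
    by (subst nn_integral_sum) (auto simp: nn_integral_cmult set_int)
  finally show "clutter_int f = (\<Sum>v\<in>f ` space N. v * ennreal (LINT x:(?B v)|N. lc x))" .
  have "(\<Sum>v\<in>f ` space N. (LINT x:(?B v)|N. lc x)) = (LINT x|N. (\<Sum>v\<in>f ` space N. indicator (?B v) x *\<^sub>R lc x))"
    unfolding set_lebesgue_integral_def using int by (intro Bochner_Integration.integral_sum[symmetric])
  also have "\<dots> = (LINT x|N. lc x)"
  proof (rule Bochner_Integration.integral_cong[OF refl])
    fix x assume x: "x \<in> space N"
    have "(\<Sum>v\<in>f ` space N. indicator (?B v) x *\<^sub>R lc x) = (\<Sum>v\<in>f ` space N. if v = f x then lc x else 0)"
      using x by (intro sum.cong) (auto simp: indicator_def)
    then show "(\<Sum>v\<in>f ` space N. indicator (?B v) x *\<^sub>R lc x) = lc x"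
      using x fin by simp
  qed
  finally show "(\<Sum>v\<in>f ` space N. (LINT x:(?B v)|N. lc x)) = (LINT x|N. lc x)" .
qed

lemma suminf_exp_ennreal:
  assumes "0 \<le> b"
  shows "(\<Sum>j. ennreal (1 / fact j) * ennreal b ^ j) = ennreal (exp b)"
proof -
  have "(\<lambda>j. b ^ j /\<^sub>R fact j) sums exp b" by (rule exp_converges)
  then have "(\<Sum>j. ennreal (b ^ j /\<^sub>R fact j)) = ennreal (exp b)"
    using assms by (intro suminf_ennreal_eq) auto
  moreover have "ennreal (1 / fact j) * ennreal b ^ j = ennreal (b ^ j /\<^sub>R fact j)" for j
    using assms by (simp add: ennreal_power ennreal_mult[symmetric] divide_inverse mult.commute)
  ultimately show ?thesis by simp
qed

text \<open>A simple function splits the window into finitely many level sets. The counts on them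
  are independent Poisson variables, and each factor is \<open>exp (v * L - L)\<close> for the value
  \<open>v\<close> and the mean count \<open>L\<close> of its level set.\<close>

lemma nn_integral_poisson_process:
  assumes P: "poisson_process N lc P"
    and f: "simple_function N f" "\<And>x. x \<in> space N \<Longrightarrow> f x \<le> 1"
  shows "(\<integral>\<^sup>+ \<xi>. config_prod f \<xi> \<partial>P) =
    ennreal (exp (- (LINT x|N. lc x))) * (\<Sum>j. ennreal (1 / fact j) * clutter_int f ^ j)"
proof -
  interpret P: prob_space P using P by (simp add: poisson_process_def)
  have sets_P [measurable_cong]: "sets P = sets (config_space N)" using P by (simp add: poisson_process_def)
  have f_top: "f x \<noteq> \<top>" if "x \<in> space N" for x
    using f(2)[OF that] by (auto simp: top_unique)
  let ?V = "f ` space N" and ?B = "\<lambda>v. f -` {v} \<inter> space N"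
  let ?\<Lambda> = "\<lambda>v. LINT x:(?B v)|N. lc x"
  have B [measurable]: "?B v \<in> sets N" for v
    using f(1) by (rule simple_functionD)
  have fin: "finite ?V"
    using f(1) by (rule simple_functionD)
  have \<Lambda>_nonneg: "0 \<le> ?\<Lambda> v" for v
    unfolding set_lebesgue_integral_def by (intro Bochner_Integration.integral_nonneg) (auto simp: lc_nonneg indicator_def)
  have prob: "P.prob {\<xi> \<in> space P. points_in (?B v) \<xi> = k} = exp (- ?\<Lambda> v) * ?\<Lambda> v ^ k / fact k" for v k
    using P B[of v] by (auto simp: poisson_process_def)
  \<comment> \<open>Independence is assumed for families indexed by natural numbers, so the values
    of \<open>f\<close> are enumerated.\<close>
  obtain e where e: "bij_betw e {..<card ?V} ?V"
    using ex_bij_betw_nat_finite[OF fin] by (auto simp: atLeast0LessThan)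
  have "disjoint_family_on (\<lambda>i. ?B (e i)) {..<card ?V}"
    using e by (auto simp: disjoint_family_on_def bij_betw_def inj_on_def)
  moreover have "(\<lambda>i. ?B (e i)) ` {..<card ?V} \<subseteq> sets N"
    using B by auto
  ultimately have indep: "P.indep_vars (\<lambda>_. count_space UNIV) (\<lambda>i. points_in (?B (e i))) {..<card ?V}"
    using P unfolding poisson_process_def by blast
  have indep': "P.indep_vars (\<lambda>_. borel :: ennreal measure) (\<lambda>i \<xi>. e i ^ points_in (?B (e i)) \<xi>) {..<card ?V}"
    using P.indep_vars_compose2[OF indep, of "\<lambda>i k. e i ^ k" "\<lambda>_. borel"] by simp
  have one: "(\<integral>\<^sup>+ \<xi>. v ^ points_in (?B v) \<xi> \<partial>P) = ennreal (exp (enn2real v * ?\<Lambda> v)) * ennreal (exp (- ?\<Lambda> v))"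
    if v: "v \<in> ?V" for v
  proof -
    obtain t where t: "v = ennreal t" "0 \<le> t"
      using v f_top by (metis (mono_tags, lifting) ennreal_cases imageE)
    have "(\<integral>\<^sup>+ \<xi>. v ^ points_in (?B v) \<xi> \<partial>P) =
      (\<integral>\<^sup>+ \<xi>. (\<Sum>k. v ^ k * indicator {\<xi> \<in> space P. points_in (?B v) \<xi> = k} \<xi>) \<partial>P)"
    proof (rule nn_integral_cong)
      fix \<xi> assume "\<xi> \<in> space P"
      then have eq: "v ^ k * indicator {\<xi> \<in> space P. points_in (?B v) \<xi> = k} \<xi> =
          (if k = points_in (?B v) \<xi> then v ^ k else 0)" for k
        by (auto simp: indicator_def)
      show "v ^ points_in (?B v) \<xi> = (\<Sum>k. v ^ k * indicator {\<xi> \<in> space P. points_in (?B v) \<xi> = k} \<xi>)"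
        unfolding eq by (rule sums_unique[OF sums_single])
    qed
    also have "\<dots> = (\<Sum>k. v ^ k * emeasure P {\<xi> \<in> space P. points_in (?B v) \<xi> = k})"
    proof -
      have [measurable]: "{\<xi> \<in> space P. points_in (?B v) \<xi> = k} \<in> sets P" for k
        by measurable
      show ?thesis
        by (subst nn_integral_suminf) (auto simp: nn_integral_cmult)
    qed
    also have "\<dots> = (\<Sum>k. (ennreal (1 / fact k) * ennreal (t * ?\<Lambda> v) ^ k) * ennreal (exp (- ?\<Lambda> v)))"
    proof (rule suminf_cong)
      fix k
      define L where "L = ?\<Lambda> v"
      have L: "0 \<le> L" unfolding L_def by (rule \<Lambda>_nonneg)
      have "ennreal t ^ k * ennreal (exp (- L) * L ^ k / fact k) = ennreal (t ^ k * (exp (- L) * L ^ k / fact k))"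
        using t(2) L by (subst ennreal_mult) (auto simp: ennreal_power)
      also have "\<dots> = ennreal (1 / fact k * (t * L) ^ k * exp (- L))"
        by (simp add: power_mult_distrib mult_ac)
      also have "\<dots> = ennreal (1 / fact k) * ennreal (t * L) ^ k * ennreal (exp (- L))"
        using t(2) L by (subst ennreal_mult) (auto simp: ennreal_power ennreal_mult[symmetric])
      finally show "v ^ k * emeasure P {\<xi> \<in> space P. points_in (?B v) \<xi> = k} =
          ennreal (1 / fact k) * ennreal (t * ?\<Lambda> v) ^ k * ennreal (exp (- ?\<Lambda> v))"
        unfolding P.emeasure_eq_measure prob L_def t(1) .
    qed
    also have "\<dots> = ennreal (exp (t * ?\<Lambda> v)) * ennreal (exp (- ?\<Lambda> v))"
      using t(2) \<Lambda>_nonneg[of v] by (simp add: suminf_exp_ennreal)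
    finally show ?thesis
      using t by simp
  qed
  let ?b = "\<Sum>v\<in>?V. enn2real v * ?\<Lambda> v"
  have b: "clutter_int f = ennreal ?b" "0 \<le> ?b"
  proof -
    have "v * ennreal (?\<Lambda> v) = ennreal (enn2real v * ?\<Lambda> v)" if "v \<in> ?V" for v
      using that f_top \<Lambda>_nonneg[of v] by (auto simp: ennreal_mult less_top)
    then show "clutter_int f = ennreal ?b"
      using \<Lambda>_nonneg by (simp add: clutter_int_eq_set_integrals(1)[OF f(1) f_top] sum_ennreal)
    show "0 \<le> ?b"
      using \<Lambda>_nonneg by (intro sum_nonneg) auto
  qed
  have "(\<integral>\<^sup>+ \<xi>. config_prod f \<xi> \<partial>P) = (\<integral>\<^sup>+ \<xi>. (\<Prod>i<card ?V. e i ^ points_in (?B (e i)) \<xi>) \<partial>P)"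
  proof (rule nn_integral_cong)
    fix \<xi> assume "\<xi> \<in> space P"
    then have "config_prod f \<xi> = (\<Prod>v\<in>?V. v ^ points_in (?B v) \<xi>)"
      using sets_eq_imp_space_eq[OF sets_P] by (intro config_prod_simple[OF f(1)]) simp
    also have "\<dots> = (\<Prod>i<card ?V. e i ^ points_in (?B (e i)) \<xi>)"
      by (rule prod.reindex_bij_betw[OF e, symmetric])
    finally show "config_prod f \<xi> = \<dots>" .
  qed
  also have "\<dots> = (\<Prod>i<card ?V. \<integral>\<^sup>+ \<xi>. e i ^ points_in (?B (e i)) \<xi> \<partial>P)"
    by (rule P.indep_vars_nn_integral[OF _ indep']) auto
  also have "\<dots> = (\<Prod>v\<in>?V. \<integral>\<^sup>+ \<xi>. v ^ points_in (?B v) \<xi> \<partial>P)"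
    by (rule prod.reindex_bij_betw[OF e])
  also have "\<dots> = (\<Prod>v\<in>?V. ennreal (exp (enn2real v * ?\<Lambda> v))) * (\<Prod>v\<in>?V. ennreal (exp (- ?\<Lambda> v)))"
    by (simp add: one prod.distrib)
  also have "\<dots> = ennreal (exp ?b) * ennreal (exp (- (LINT x|N. lc x)))"
    using fin by (simp add: prod_ennreal exp_sum[symmetric] sum_negf clutter_int_eq_set_integrals(2)[OF f(1) f_top])
  also have "ennreal (exp ?b) = (\<Sum>j. ennreal (1 / fact j) * clutter_int f ^ j)"
    unfolding b(1) by (rule suminf_exp_ennreal[OF b(2), symmetric])
  finally show ?thesis
    by (simp add: mult.commute)
qed

end

text \<open>Both sides are integrals of \<open>h\<close> against measures on \<open>MY\<close>: the
  law of \<open>Y\<close> on the event \<open>X \<in> A\<close>, and the law of \<open>X\<close> on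
  \<open>A\<close> composed with \<open>K\<close>. The defining property of \<open>K\<close> says
  that these agree on sets.\<close>

lemma regular_cond_distr_nn_integral:
  assumes K: "regular_cond_distr M MX X MY Y K"
    and X [measurable]: "X \<in> measurable M MX" and Y [measurable]: "Y \<in> measurable M MY"
    and A [measurable]: "A \<in> sets MX" and h: "h \<in> borel_measurable MY"
  shows "(\<integral>\<^sup>+ \<omega>. indicator A (X \<omega>) * h (Y \<omega>) \<partial>M) = (\<integral>\<^sup>+ \<omega>. indicator A (X \<omega>) * (\<integral>\<^sup>+ y. h y \<partial>K (X \<omega>)) \<partial>M)"
\<comment> \<open>On an empty space the monadic composition does not retain the target
  sigma-algebra, so that case is set aside.\<close>
proof (cases "space M = {}")
  case True
  then show ?thesis by (simp add: nn_integral_empty)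
next
  case False
  then have nonempty: "space MX \<noteq> {}"
    using measurable_space[OF X] by auto
  have Kp [measurable]: "K \<in> measurable MX (subprob_algebra MY)"
    using K unfolding regular_cond_distr_def by (blast intro: measurable_prob_algebraD)
  let ?D = "density M (\<lambda>\<omega>. indicator A (X \<omega>))"
  have KX: "K \<in> measurable (distr ?D MX X) (subprob_algebra MY)"
    by simp
  have sets_bind: "sets (distr ?D MX X \<bind> K) = sets MY"
    using nonempty by (intro sets_bind) (auto dest: sets_kernel[OF Kp])
  have bind: "(\<integral>\<^sup>+ y. g y \<partial>(distr ?D MX X \<bind> K)) = (\<integral>\<^sup>+ \<omega>. indicator A (X \<omega>) * (\<integral>\<^sup>+ y. g y \<partial>K (X \<omega>)) \<partial>M)"
    if [measurable]: "g \<in> borel_measurable MY" for g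
    by (subst nn_integral_bind[OF _ KX], simp, subst nn_integral_distr, simp, simp)
       (subst nn_integral_density, auto)
  have dist: "(\<integral>\<^sup>+ y. g y \<partial>distr ?D MY Y) = (\<integral>\<^sup>+ \<omega>. indicator A (X \<omega>) * g (Y \<omega>) \<partial>M)"
    if [measurable]: "g \<in> borel_measurable MY" for g
    by (subst nn_integral_distr, simp, simp) (subst nn_integral_density, auto)
  have "distr ?D MY Y = distr ?D MX X \<bind> K"
  proof (rule measure_eqI)
    fix B assume "B \<in> sets (distr ?D MY Y)"
    then have B [measurable]: "B \<in> sets MY" by simp
    have "{\<omega> \<in> space M. X \<omega> \<in> A \<and> Y \<omega> \<in> B} \<in> sets M"
      by measurable
    then have "emeasure M {\<omega> \<in> space M. X \<omega> \<in> A \<and> Y \<omega> \<in> B} =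
        (\<integral>\<^sup>+ \<omega>. indicator {\<omega> \<in> space M. X \<omega> \<in> A \<and> Y \<omega> \<in> B} \<omega> \<partial>M)"
      by simp
    also have "\<dots> = (\<integral>\<^sup>+ \<omega>. indicator A (X \<omega>) * indicator B (Y \<omega>) \<partial>M)"
      by (intro nn_integral_cong) (auto simp: indicator_def)
    finally have "(\<integral>\<^sup>+ \<omega>. indicator A (X \<omega>) * indicator B (Y \<omega>) \<partial>M) =
        (\<integral>\<^sup>+ \<omega>. emeasure (K (X \<omega>)) B * indicator A (X \<omega>) \<partial>M)"
      using K A B by (simp add: regular_cond_distr_def)
    also have "\<dots> = (\<integral>\<^sup>+ \<omega>. indicator A (X \<omega>) * (\<integral>\<^sup>+ y. indicator B y \<partial>K (X \<omega>)) \<partial>M)"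
      using sets_kernel[OF Kp measurable_space[OF X]] B by (intro nn_integral_cong) (simp add: mult.commute)
    finally show "emeasure (distr ?D MY Y) B = emeasure (distr ?D MX X \<bind> K) B"
      using bind[of "indicator B"] dist[of "indicator B"] sets_bind by simp
  qed (simp add: sets_bind)
  then show ?thesis
    using bind[OF h] dist[OF h] by simp
qed

section \<open>Symmetric densities\<close>

text \<open>The complements \<open>A - T\<close> run through all subsets of \<open>A - R\<close>, so
  the sum is the expansion of a product of factors \<open>- 1 + 1\<close>, one for each element of
  \<open>A - R\<close>.\<close>

lemma sum_supersets_alternating:
  assumes "finite A" "R \<subseteq> A"
  shows "(\<Sum>T | T \<subseteq> A \<and> R \<subseteq> T. (- 1) ^ card (A - T) :: real) = (if R = A then 1 else 0)"
proof -
  have fin: "finite (A - R)" using assms by simp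
  have "(\<Sum>T | T \<subseteq> A \<and> R \<subseteq> T. (- 1) ^ card (A - T) :: real) = (\<Sum>U\<in>Pow (A - R). (- 1) ^ card U)"
    by (rule sum.reindex_bij_witness[of _ "\<lambda>U. A - U" "\<lambda>T. A - T"])
       (use assms in \<open>auto simp: double_diff\<close>)
  also have "\<dots> = (\<Sum>U\<in>Pow (A - R). (\<Prod>x\<in>U. - 1) * (\<Prod>x\<in>A - R - U. 1))"
    by simp
  also have "\<dots> = (\<Prod>x\<in>A - R. - 1 + 1)"
    by (rule prod_add[OF fin, symmetric])
  also have "\<dots> = (if R = A then 1 else 0)"
    using fin assms by (cases "A - R = {}") (auto simp: prod_zero_iff)
  finally show ?thesis .
qed

text \<open>Ryser's formula for the permanent; it recovers a symmetric multilinear form from its diagonal.\<close>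

lemma permanent_formula:
  fixes u :: "'a \<Rightarrow> 'a \<Rightarrow> real"
  assumes A: "finite A"
  shows "(\<Sum>T\<in>Pow A. (- 1) ^ card (A - T) * (\<Prod>l\<in>A. \<Sum>i\<in>T. u l i)) =
    (\<Sum>g\<in>{g \<in> A \<rightarrow>\<^sub>E A. g ` A = A}. \<Prod>l\<in>A. u l (g l))"
proof -
  have finE: "finite (A \<rightarrow>\<^sub>E A)" using A by (intro finite_PiE) auto
  have "(\<Prod>l\<in>A. \<Sum>i\<in>T. u l i) = (\<Sum>g\<in>A \<rightarrow>\<^sub>E A. if g ` A \<subseteq> T then \<Prod>l\<in>A. u l (g l) else 0)"
    if T: "T \<in> Pow A" for T
  proof -
    have "finite T" using T A by (auto dest: finite_subset)
    then have "(\<Prod>l\<in>A. \<Sum>i\<in>T. u l i) = (\<Sum>g\<in>A \<rightarrow>\<^sub>E T. \<Prod>l\<in>A. u l (g l))"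
      using A by (intro prod_sum_PiE) auto
    also have "A \<rightarrow>\<^sub>E T = {g \<in> A \<rightarrow>\<^sub>E A. g ` A \<subseteq> T}"
      using T by (auto simp: PiE_iff extensional_def)
    finally show ?thesis
      using finE by (simp add: sum.inter_filter)
  qed
  \<comment> \<open>After expansion each map \<open>g\<close> occurs once for every \<open>T\<close>
    that contains its range, and the alternating sum keeps exactly the surjective ones.\<close>
  then have "(\<Sum>T\<in>Pow A. (- 1) ^ card (A - T) * (\<Prod>l\<in>A. \<Sum>i\<in>T. u l i)) =
    (\<Sum>T\<in>Pow A. \<Sum>g\<in>A \<rightarrow>\<^sub>E A. if g ` A \<subseteq> T then (- 1) ^ card (A - T) * (\<Prod>l\<in>A. u l (g l)) else 0)"
    by (intro sum.cong refl) (auto simp: sum_distrib_left intro!: sum.cong)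
  also have "\<dots> = (\<Sum>g\<in>A \<rightarrow>\<^sub>E A. \<Sum>T\<in>Pow A. if g ` A \<subseteq> T then (- 1) ^ card (A - T) * (\<Prod>l\<in>A. u l (g l)) else 0)"
    by (rule sum.swap)
  also have "\<dots> = (\<Sum>g\<in>A \<rightarrow>\<^sub>E A. if g ` A = A then \<Prod>l\<in>A. u l (g l) else 0)"
  proof (rule sum.cong[OF refl])
    fix g assume "g \<in> A \<rightarrow>\<^sub>E A"
    then have sub: "g ` A \<subseteq> A" by auto
    have "(\<Sum>T\<in>Pow A. if g ` A \<subseteq> T then (- 1) ^ card (A - T) * (\<Prod>l\<in>A. u l (g l)) else 0) =
      (\<Sum>T | T \<subseteq> A \<and> g ` A \<subseteq> T. (- 1) ^ card (A - T)) * (\<Prod>l\<in>A. u l (g l))"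
      using A by (simp add: sum.inter_filter[symmetric] sum_distrib_right)
    then show "(\<Sum>T\<in>Pow A. if g ` A \<subseteq> T then (- 1) ^ card (A - T) * (\<Prod>l\<in>A. u l (g l)) else 0) =
      (if g ` A = A then \<Prod>l\<in>A. u l (g l) else 0)"
      by (simp add: sum_supersets_alternating[OF A sub])
  qed
  finally show ?thesis
    using finE by (simp add: sum.inter_filter)
qed

context finite_measure
begin

lemma distr_PiM_permute:
  fixes m :: nat
  assumes g: "bij_betw g {..<m} {..<m}"
  shows "distr (PiM {..<m} (\<lambda>_. M)) (PiM {..<m} (\<lambda>_. M)) (\<lambda>y. \<lambda>l\<in>{..<m}. y (g l)) = PiM {..<m} (\<lambda>_. M)"
proof -
  interpret product_sigma_finite "\<lambda>_. M" by (rule product_sigma_finite_const)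
  have g_in: "g l \<in> {..<m}" if "l \<in> {..<m}" for l
    using g that by (auto simp: bij_betw_def)
  have \<tau>: "(\<lambda>y. \<lambda>l\<in>{..<m}. y (g l)) \<in> measurable (PiM {..<m} (\<lambda>_. M)) (PiM {..<m} (\<lambda>_. M))"
    using g_in by (intro measurable_restrict measurable_component_singleton)
  define h where "h = inv_into {..<m} g"
  have gh: "g (h i) = i" "h i \<in> {..<m}" if "i \<in> {..<m}" for i
    using that g f_inv_into_f[of i g "{..<m}"] inv_into_into[of i g "{..<m}"]
    by (simp_all add: h_def bij_betw_def)
  have hg: "h (g l) = l" if "l \<in> {..<m}" for l
    using that g by (auto simp: h_def bij_betw_def)
  show ?thesis
  proof (rule PiM_eqI)
    fix A assume A: "\<And>i. i \<in> {..<m} \<Longrightarrow> A i \<in> sets M"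
    have eq: "(\<lambda>y. \<lambda>l\<in>{..<m}. y (g l)) -` PiE {..<m} A \<inter> space (PiM {..<m} (\<lambda>_. M)) = PiE {..<m} (\<lambda>i. A (h i))"
    proof (intro set_eqI iffI)
      fix y assume y: "y \<in> (\<lambda>y. \<lambda>l\<in>{..<m}. y (g l)) -` PiE {..<m} A \<inter> space (PiM {..<m} (\<lambda>_. M))"
      then have "\<forall>l\<in>{..<m}. y (g l) \<in> A l"
        by (simp add: restrict_PiE_iff Pi_iff)
      then have "y i \<in> A (h i)" if "i \<in> {..<m}" for i
        using gh[OF that] by metis
      then show "y \<in> PiE {..<m} (\<lambda>i. A (h i))"
        using y by (auto simp: space_PiM PiE_iff)
    next
      fix y assume y: "y \<in> PiE {..<m} (\<lambda>i. A (h i))"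
      have "y (g l) \<in> A l" if "l \<in> {..<m}" for l
        using y g_in[OF that] hg[OF that] by (metis PiE_mem)
      moreover have "y i \<in> space M" if "i \<in> {..<m}" for i
        using y A[OF gh(2)[OF that]] that sets.sets_into_space by (metis PiE_mem subsetD)
      ultimately show "y \<in> (\<lambda>y. \<lambda>l\<in>{..<m}. y (g l)) -` PiE {..<m} A \<inter> space (PiM {..<m} (\<lambda>_. M))"
        using y by (simp add: restrict_PiE_iff Pi_iff space_PiM PiE_iff)
    qed
    have "emeasure (distr (PiM {..<m} (\<lambda>_. M)) (PiM {..<m} (\<lambda>_. M)) (\<lambda>y. \<lambda>l\<in>{..<m}. y (g l))) (PiE {..<m} A) =
      emeasure (PiM {..<m} (\<lambda>_. M)) (PiE {..<m} (\<lambda>i. A (h i)))"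
      using A by (subst emeasure_distr[OF \<tau>]) (auto simp: eq intro!: sets_PiM_I_finite)
    also have "\<dots> = (\<Prod>i<m. emeasure M (A (h i)))"
      using A gh by (intro emeasure_PiM) auto
    also have "\<dots> = (\<Prod>i<m. emeasure M (A i))"
      by (rule prod.reindex_bij_betw) (use bij_betw_inv_into[OF g] in \<open>simp add: h_def\<close>)
    finally show "emeasure (distr (PiM {..<m} (\<lambda>_. M)) (PiM {..<m} (\<lambda>_. M)) (\<lambda>y. \<lambda>l\<in>{..<m}. y (g l))) (PiE {..<m} A) =
      (\<Prod>i<m. emeasure M (A i))" .
  qed auto
qed

lemma symmetric_density_rectangle:
  assumes G [measurable]: "G \<in> borel_measurable (list_space M)" and sym: "symmetric_on (space M) G"
    and g: "bij_betw g {..<m} {..<m}" and B: "\<And>i. i < m \<Longrightarrow> B i \<in> sets M"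
  shows "emeasure (density (PiM {..<m} (\<lambda>_. M)) (\<lambda>z. G (map z [0..<m]))) (PiE {..<m} (\<lambda>l. B (g l))) =
    emeasure (density (PiM {..<m} (\<lambda>_. M)) (\<lambda>z. G (map z [0..<m]))) (PiE {..<m} B)"
proof -
  let ?P = "PiM {..<m} (\<lambda>_. M)" and ?\<tau> = "\<lambda>y. \<lambda>l\<in>{..<m}. y (g l)"
  have g_in: "g l \<in> {..<m}" if "l \<in> {..<m}" for l
    using g that by (auto simp: bij_betw_def)
  have \<tau> [measurable]: "?\<tau> \<in> measurable ?P ?P"
    using g_in by (intro measurable_restrict measurable_component_singleton)
  have [measurable]: "PiE {..<m} (\<lambda>l. B (g l)) \<in> sets ?P" "PiE {..<m} B \<in> sets ?P"
    using B g_in by (auto intro!: sets_PiM_I_finite)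
  have "emeasure (density ?P (\<lambda>z. G (map z [0..<m]))) (PiE {..<m} (\<lambda>l. B (g l))) =
    (\<integral>\<^sup>+ z. G (map z [0..<m]) * indicator (PiE {..<m} (\<lambda>l. B (g l))) z \<partial>?P)"
    by (subst emeasure_density) auto
  also have "\<dots> = (\<integral>\<^sup>+ z. G (map z [0..<m]) * indicator (PiE {..<m} (\<lambda>l. B (g l))) z \<partial>distr ?P ?P ?\<tau>)"
    by (simp only: distr_PiM_permute[OF g])
  also have "\<dots> = (\<integral>\<^sup>+ y. G (map (?\<tau> y) [0..<m]) * indicator (PiE {..<m} (\<lambda>l. B (g l))) (?\<tau> y) \<partial>?P)"
    by (rule nn_integral_distr[OF \<tau>]) measurable
  also have "\<dots> = (\<integral>\<^sup>+ y. G (map y [0..<m]) * indicator (PiE {..<m} B) y \<partial>?P)"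
  proof (rule nn_integral_cong)
    fix y assume y: "y \<in> space ?P"
    have "mset (map (?\<tau> y) [0..<m]) = image_mset (?\<tau> y) (mset_set {0..<m})"
      by (simp only: mset_map mset_upt)
    also have "\<dots> = image_mset (\<lambda>l. y (g l)) (mset_set {0..<m})"
      by (rule image_mset_cong) simp
    also have "\<dots> = image_mset y (image_mset g (mset_set {0..<m}))"
      by (simp add: image_mset.compositionality o_def)
    also have "image_mset g (mset_set {0..<m}) = mset_set {0..<m}"
      using g by (simp add: image_mset_mset_set bij_betw_def atLeast0LessThan)
    also have "image_mset y (mset_set {0..<m}) = mset (map y [0..<m])"
      by (simp only: mset_map mset_upt)
    finally have eq: "mset (map (?\<tau> y) [0..<m]) = mset (map y [0..<m])" .
    have 1: "G (map (?\<tau> y) [0..<m]) = G (map y [0..<m])"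
      by (rule symmetric_onD[OF sym map_upt_in_lists[OF y] eq[symmetric], symmetric])
    have "(\<forall>l\<in>{..<m}. y (g l) \<in> B (g l)) \<longleftrightarrow> (\<forall>i\<in>g ` {..<m}. y i \<in> B i)"
      by blast
    also have "g ` {..<m} = {..<m}"
      using g by (simp add: bij_betw_def)
    finally have "?\<tau> y \<in> PiE {..<m} (\<lambda>l. B (g l)) \<longleftrightarrow> y \<in> PiE {..<m} B"
      using y unfolding restrict_PiE_iff by (simp add: space_PiM PiE_iff)
    with 1 show "G (map (?\<tau> y) [0..<m]) * indicator (PiE {..<m} (\<lambda>l. B (g l))) (?\<tau> y) =
      G (map y [0..<m]) * indicator (PiE {..<m} B) y"
      by (simp add: indicator_def)
  qed
  also have "\<dots> = emeasure (density ?P (\<lambda>z. G (map z [0..<m]))) (PiE {..<m} B)"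
    by (subst emeasure_density) auto
  finally show ?thesis .
qed

text \<open>Each integrand on the left is a product of one function over all coordinates and hence
  depends on the unordered configuration only; the right side is the mass of an ordered rectangle,
  once for each permutation. The signs force real-valued integrals, whence the finiteness
  assumption.\<close>

lemma permanent_density:
  assumes G [measurable]: "G \<in> borel_measurable (list_space M)" and sym: "symmetric_on (space M) G"
    and fin: "(\<integral>\<^sup>+ z. G (map z [0..<m]) \<partial>PiM {..<m} (\<lambda>_. M)) \<noteq> \<infinity>"
    and B: "\<And>i. i < m \<Longrightarrow> B i \<in> sets M"
  shows "(\<Sum>T\<in>Pow {..<m}. (- 1) ^ card ({..<m} - T) *
      (LINT z|density (PiM {..<m} (\<lambda>_. M)) (\<lambda>z. G (map z [0..<m])). (\<Prod>l<m. \<Sum>i\<in>T. indicator (B i) (z l)))) =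
    card {g \<in> {..<m} \<rightarrow>\<^sub>E {..<m}. g ` {..<m} = {..<m}} *
      measure (density (PiM {..<m} (\<lambda>_. M)) (\<lambda>z. G (map z [0..<m]))) (PiE {..<m} B)"
proof -
  let ?P = "PiM {..<m} (\<lambda>_. M)"
  let ?D = "density ?P (\<lambda>z. G (map z [0..<m]))"
  let ?S = "{g \<in> {..<m} \<rightarrow>\<^sub>E {..<m}. g ` {..<m} = {..<m}}"
  interpret D: finite_measure ?D
    using fin by (intro finite_measureI) (simp add: emeasure_density cong: nn_integral_cong_simp)
  have [measurable]: "B i \<in> sets M" if "i < m" for i using B that .
  have int: "integrable ?D (\<lambda>z. \<Prod>l<m. \<Sum>i\<in>T. indicator (B i) (z l) :: real)" if T: "T \<subseteq> {..<m}" for T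
  proof (rule D.integrable_const_bound[where B = "\<Prod>l<m. real (card T)"])
    show "AE z in ?D. norm (\<Prod>l<m. \<Sum>i\<in>T. indicator (B i) (z l) :: real) \<le> (\<Prod>l<m. real (card T))"
    proof (rule AE_I2)
      fix z :: "nat \<Rightarrow> 'a"
      have "(\<Sum>i\<in>T. indicator (B i) (z l) :: real) \<le> real (card T)" for l
        using sum_bounded_above[of T "\<lambda>i. indicator (B i) (z l) :: real" 1] by (auto simp: indicator_def)
      moreover have "0 \<le> (\<Sum>i\<in>T. indicator (B i) (z l) :: real)" for l
        by (intro sum_nonneg) (auto simp: indicator_def)
      ultimately show "norm (\<Prod>l<m. \<Sum>i\<in>T. indicator (B i) (z l) :: real) \<le> (\<Prod>l<m. real (card T))"
        unfolding prod_norm[symmetric] by (intro prod_mono) (simp del: sum_indicator_eq_card)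
    qed
    have [measurable]: "(\<lambda>z. indicator (B i) (z l) :: real) \<in> borel_measurable ?P" if "i \<in> T" "l < m" for i l
    proof -
      have [measurable]: "i < m" "l \<in> {..<m}" using that T by auto
      show ?thesis by measurable
    qed
    show "(\<lambda>z. \<Prod>l<m. \<Sum>i\<in>T. indicator (B i) (z l) :: real) \<in> borel_measurable ?D"
      unfolding measurable_density_eq2
      by (intro borel_measurable_prod borel_measurable_sum) auto
  qed
  have "(\<Sum>T\<in>Pow {..<m}. (- 1) ^ card ({..<m} - T) * (LINT z|?D. (\<Prod>l<m. \<Sum>i\<in>T. indicator (B i) (z l) :: real))) =
    (LINT z|?D. (\<Sum>T\<in>Pow {..<m}. (- 1) ^ card ({..<m} - T) * (\<Prod>l<m. \<Sum>i\<in>T. indicator (B i) (z l))))"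
    using int by (subst Bochner_Integration.integral_sum) auto
  also have "\<dots> = (LINT z|?D. (\<Sum>g\<in>?S. \<Prod>l<m. indicator (B (g l)) (z l)))"
    by (simp only: permanent_formula finite_lessThan)
  also have "\<dots> = (LINT z|?D. (\<Sum>g\<in>?S. indicator (PiE {..<m} (\<lambda>l. B (g l))) z))"
  proof (intro Bochner_Integration.integral_cong refl sum.cong)
    fix z g assume "z \<in> space ?D" and g: "g \<in> ?S"
    then have z: "z \<in> extensional {..<m}" by (simp add: space_PiM PiE_def)
    have "(\<Prod>l<m. indicator (B (g l)) (z l) :: real) = (if \<forall>l<m. z l \<in> B (g l) then 1 else 0)"
      by (auto simp: indicator_def)
    then show "(\<Prod>l<m. indicator (B (g l)) (z l) :: real) = indicator (PiE {..<m} (\<lambda>l. B (g l))) z"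
      using z by (auto simp: indicator_def PiE_iff)
  qed
  also have "\<dots> = (\<Sum>g\<in>?S. measure ?D (PiE {..<m} (\<lambda>l. B (g l))))"
  proof -
    have sets: "PiE {..<m} (\<lambda>l. B (g l)) \<in> sets ?D" if "g \<in> ?S" for g
    proof -
      have "B (g l) \<in> sets M" if "l \<in> {..<m}" for l
        using \<open>g \<in> ?S\<close> that by (intro B) auto
      then show ?thesis by (simp add: sets_PiM_I_finite)
    qed
    then have "(LINT z|?D. (\<Sum>g\<in>?S. indicator (PiE {..<m} (\<lambda>l. B (g l))) z :: real)) =
      (\<Sum>g\<in>?S. (LINT z|?D. indicator (PiE {..<m} (\<lambda>l. B (g l))) z))"
      by (intro Bochner_Integration.integral_sum integrable_real_indicator) (auto simp: D.emeasure_eq_measure)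
    also have "\<dots> = (\<Sum>g\<in>?S. measure ?D (PiE {..<m} (\<lambda>l. B (g l))))"
      using sets sets.sets_into_space by (intro sum.cong refl) (auto simp: Int_absorb2)
    finally show ?thesis .
  qed
  also have "\<dots> = (\<Sum>g\<in>?S. measure ?D (PiE {..<m} B))"
  proof (rule sum.cong[OF refl])
    fix g assume g: "g \<in> ?S"
    then have "bij_betw g {..<m} {..<m}"
      by (auto simp: bij_betw_def intro!: eq_card_imp_inj_on)
    then show "measure ?D (PiE {..<m} (\<lambda>l. B (g l))) = measure ?D (PiE {..<m} B)"
      unfolding measure_def by (subst symmetric_density_rectangle[OF G sym _ B]) auto
  qed
  finally show ?thesis by simp
qed

text \<open>Ordered rectangles generate the product sigma-algebra, and
  \<open>permanent_density\<close> computes their masses from integrals of functions of the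
  configuration. Those integrals agree, since the two densities have the same image on the space of
  configurations.\<close>

lemma symmetric_density_unique:
  assumes G: "G \<in> borel_measurable (list_space M)" "symmetric_on (space M) G"
    and H: "H \<in> borel_measurable (list_space M)" "symmetric_on (space M) H"
    and fin: "(\<integral>\<^sup>+ z. G (map z [0..<m]) \<partial>PiM {..<m} (\<lambda>_. M)) \<noteq> \<infinity>"
    and eq: "\<And>A. A \<in> sets (config_space M) \<Longrightarrow>
      (\<integral>\<^sup>+ z. G (map z [0..<m]) * indicator A (mset (map z [0..<m])) \<partial>PiM {..<m} (\<lambda>_. M)) =
      (\<integral>\<^sup>+ z. H (map z [0..<m]) * indicator A (mset (map z [0..<m])) \<partial>PiM {..<m} (\<lambda>_. M))"
  shows "AE z in PiM {..<m} (\<lambda>_. M). G (map z [0..<m]) = H (map z [0..<m])"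
proof -
  let ?P = "PiM {..<m} (\<lambda>_. M)"
  define c where "c z = mset (map z [0..<m])" for z :: "nat \<Rightarrow> 'a"
  let ?D = "\<lambda>G. density ?P (\<lambda>z. G (map z [0..<m]))"
  note [measurable] = G(1) H(1)
  interpret product_sigma_finite "\<lambda>_. M" by (rule product_sigma_finite_const)
  interpret P: sigma_finite_measure ?P by (rule sigma_finite) simp
  have c [measurable]: "c \<in> measurable ?P (config_space M)"
    unfolding c_def[abs_def] by (rule measurable_compose[OF measurable_map_upt measurable_mset])
  note eq = eq[folded c_def]
  have distr: "distr (?D G) (config_space M) c = distr (?D H) (config_space M) c"
  proof (rule measure_eqI)
    fix A assume "A \<in> sets (distr (?D G) (config_space M) c)"
    then have A [measurable]: "A \<in> sets (config_space M)" by simp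
    have "emeasure (distr (?D F) (config_space M) c) A =
      (\<integral>\<^sup>+ z. F (map z [0..<m]) * indicator A (c z) \<partial>?P)"
      if [measurable]: "F \<in> borel_measurable (list_space M)" for F
    proof -
      have [measurable]: "c -` A \<inter> space ?P \<in> sets ?P"
        by (rule measurable_sets[OF c A])
      have "emeasure (distr (?D F) (config_space M) c) A = emeasure (?D F) (c -` A \<inter> space ?P)"
        by (subst emeasure_distr) auto
      also have "\<dots> = (\<integral>\<^sup>+ z. F (map z [0..<m]) * indicator (c -` A \<inter> space ?P) z \<partial>?P)"
        by (subst emeasure_density) auto
      also have "\<dots> = (\<integral>\<^sup>+ z. F (map z [0..<m]) * indicator A (c z) \<partial>?P)"
        by (intro nn_integral_cong) (auto simp: indicator_def)
      finally show ?thesis .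
    qed
    then show "emeasure (distr (?D G) (config_space M) c) A = emeasure (distr (?D H) (config_space M) c) A"
      using eq[OF A] G(1) H(1) by simp
  qed simp
  \<comment> \<open>The choice of the whole space for \<open>A\<close> transfers finiteness from
    \<open>G\<close> to \<open>H\<close>.\<close>
  have fin': "(\<integral>\<^sup>+ z. H (map z [0..<m]) \<partial>?P) \<noteq> \<infinity>"
  proof -
    have "(\<integral>\<^sup>+ z. F (map z [0..<m]) * indicator (space (config_space M)) (c z) \<partial>?P) = (\<integral>\<^sup>+ z. F (map z [0..<m]) \<partial>?P)" for F
      by (intro nn_integral_cong) (use measurable_space[OF c] in \<open>simp add: indicator_def\<close>)
    then show ?thesis
      using eq[OF sets.top] fin by simp
  qed
  interpret DG: finite_measure "?D G"
    using fin by (intro finite_measureI) (simp add: emeasure_density cong: nn_integral_cong_simp)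
  interpret DH: finite_measure "?D H"
    using fin' by (intro finite_measureI) (simp add: emeasure_density cong: nn_integral_cong_simp)
  have "?D G = ?D H"
  proof (rule measure_eqI_PiM_finite[of "{..<m}" _ "\<lambda>_. M"])
    fix B :: "nat \<Rightarrow> 'a set" assume "\<And>i. i \<in> {..<m} \<Longrightarrow> B i \<in> sets M"
    then have B: "B i \<in> sets M" if "i < m" for i using that by simp
    have diag: "(LINT z|?D G. (\<Prod>l<m. \<Sum>i\<in>T. indicator (B i) (z l) :: real)) =
        (LINT z|?D H. (\<Prod>l<m. \<Sum>i\<in>T. indicator (B i) (z l)))" if T: "T \<subseteq> {..<m}" for T
    proof -
      define f where "f x = ennreal (\<Sum>i\<in>T. indicator (B i) x)" for x
      have "simple_function M (\<lambda>x. \<Sum>i\<in>T. indicator (B i) x :: real)"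
        using T B by (intro simple_function_sum simple_function_indicator) auto
      then have f: "simple_function M f"
        unfolding f_def by (rule simple_function_compose1)
      note [measurable] = config_prod_measurable[OF f]
      have prod: "(\<Prod>l<m. \<Sum>i\<in>T. indicator (B i) (z l) :: real) = enn2real (config_prod f (c z))" for z
      proof -
        have "config_prod f (c z) = (\<Prod>l<m. f (z l))"
          by (simp add: c_def config_prod_def image_mset.compositionality mset_upt o_def prod_unfold_prod_mset[symmetric] atLeast0LessThan)
        also have "\<dots> = ennreal (\<Prod>l<m. \<Sum>i\<in>T. indicator (B i) (z l))"
          unfolding f_def by (intro prod_ennreal sum_nonneg) (auto simp: indicator_def)
        finally show ?thesis
          by (simp add: prod_nonneg sum_nonneg del: sum_indicator_eq_card)
      qed
      have "(LINT z|?D F. enn2real (config_prod f (c z))) =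
          (LINT \<phi>|distr (?D F) (config_space M) c. enn2real (config_prod f \<phi>))" for F
        by (rule integral_distr[symmetric]) auto
      then show ?thesis
        unfolding prod by (simp only: distr)
    qed
    let ?S = "{g \<in> {..<m} \<rightarrow>\<^sub>E {..<m}. g ` {..<m} = {..<m}}"
    have *: "real (card ?S) * measure (?D G) (PiE {..<m} B) = real (card ?S) * measure (?D H) (PiE {..<m} B)"
    proof -
      have "real (card ?S) * measure (?D G) (PiE {..<m} B) = (\<Sum>T\<in>Pow {..<m}. (- 1) ^ card ({..<m} - T) *
          (LINT z|?D G. (\<Prod>l<m. \<Sum>i\<in>T. indicator (B i) (z l))))"
        by (rule permanent_density[OF G fin B, symmetric])
      also have "\<dots> = (\<Sum>T\<in>Pow {..<m}. (- 1) ^ card ({..<m} - T) *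
          (LINT z|?D H. (\<Prod>l<m. \<Sum>i\<in>T. indicator (B i) (z l))))"
        by (intro sum.cong refl arg_cong2[where f = "(*)"] diag) auto
      also have "\<dots> = real (card ?S) * measure (?D H) (PiE {..<m} B)"
        by (rule permanent_density[OF H fin' B])
      finally show ?thesis .
    qed
    have "card ?S \<noteq> 0"
    proof -
      have "(\<lambda>i\<in>{..<m}. i) \<in> ?S" by auto
      moreover have "finite ?S" by (rule finite_subset[of _ "{..<m} \<rightarrow>\<^sub>E {..<m}"]) (auto intro!: finite_PiE)
      ultimately show ?thesis by (metis (no_types, lifting) card_0_eq empty_iff)
    qed
    then have "real (card ?S) \<noteq> 0" by simp
    then have "measure (?D G) (PiE {..<m} B) = measure (?D H) (PiE {..<m} B)"
      using * by simp
    then show "emeasure (?D G) (PiE {..<m} B) = emeasure (?D H) (PiE {..<m} B)"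
      by (simp only: DG.emeasure_eq_measure DH.emeasure_eq_measure)
  next
    show "range (\<lambda>_::nat. space ?P) \<subseteq> prod_algebra {..<m} (\<lambda>_. M)"
      by (auto simp: space_PiM intro!: prod_algebraI_finite)
  qed (auto simp: DG.emeasure_eq_measure)
  then show ?thesis
    by (intro P.density_unique) auto
qed

end

section \<open>The joint law of the hidden and the observed process\<close>

locale measured_process = measurement N p ld lc + M: prob_space M
  for N :: "'a measure" and p :: real and ld :: "'a \<Rightarrow> 'a \<Rightarrow> real" and lc :: "'a \<Rightarrow> real"
    and M :: "'w measure" +
  fixes \<Phi> \<Theta> C \<Xi> :: "'w \<Rightarrow> 'a multiset" and j :: "'a list \<Rightarrow> real"
  assumes hidden_measurable [measurable]: "\<Phi> \<in> measurable M (config_space N)"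
    and hidden_janossy: "janossy_densities N (distr M (config_space N) \<Phi>) j"
    and detected_measurable [measurable]: "\<Theta> \<in> measurable M (config_space N)"
    and detected_distr: "regular_cond_distr M (config_space N) \<Phi> (config_space N) \<Theta> (obs_config N p ld)"
    and clutter_measurable [measurable]: "C \<in> measurable M (config_space N)"
    and clutter_poisson: "poisson_process N lc (distr M (config_space N) C)"
    and clutter_indep: "M.indep_set
         (sets (vimage_algebra (space M) (\<lambda>\<omega>. (\<Phi> \<omega>, \<Theta> \<omega>)) (config_space N \<Otimes>\<^sub>M config_space N)))
         (sets (vimage_algebra (space M) C (config_space N)))"
    and observed: "\<And>\<omega>. \<omega> \<in> space M \<Longrightarrow> \<Xi> \<omega> = \<Theta> \<omega> + C \<omega>"
begin

lemma observed_measurable [measurable]: "\<Xi> \<in> measurable M (config_space N)"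
  by (subst measurable_cong[OF observed]) auto

lemma j_nonneg: "xs \<in> lists (space N) \<Longrightarrow> 0 \<le> j xs"
  using hidden_janossy unfolding janossy_densities_def by (metis in_listsD subsetI)

lemma j_symmetric: "xs \<in> lists (space N) \<Longrightarrow> mset xs = mset ys \<Longrightarrow> j xs = j ys"
  using hidden_janossy unfolding janossy_densities_def by (metis in_listsD subsetI)

lemma j_measurable [measurable]: "(\<lambda>xs. ennreal (j xs)) \<in> borel_measurable (list_space N)"
proof (rule measurable_list_spaceI)
  fix n
  have "(\<lambda>x. j (map x [0..<n])) \<in> borel_measurable (PiM {..<n} (\<lambda>_. N))"
    using hidden_janossy by (simp add: janossy_densities_def)
  then show "(\<lambda>x. ennreal (j (map x [0..<n]))) \<in> borel_measurable (PiM {..<n} (\<lambda>_. N))"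
    by measurable
qed

abbreviation mix1 :: "'a list measure" where
  "mix1 \<equiv> list_mix N (\<lambda>n. ennreal (1 / fact n))"

lemma hidden_nn_integral:
  assumes [measurable]: "F \<in> borel_measurable (config_space N)"
  shows "(\<integral>\<^sup>+ \<omega>. F (\<Phi> \<omega>) \<partial>M) = (\<integral>\<^sup>+ xs. F (mset xs) * ennreal (j xs) \<partial>mix1)"
proof -
  have "(\<integral>\<^sup>+ \<omega>. F (\<Phi> \<omega>) \<partial>M) = (\<integral>\<^sup>+ \<phi>. F \<phi> \<partial>distr M (config_space N) \<Phi>)"
    by (rule nn_integral_distr[symmetric]) auto
  also have "\<dots> = (\<Sum>n. ennreal (1 / fact n) *
             (\<integral>\<^sup>+ x. F (mset (map x [0..<n])) * ennreal (j (map x [0..<n])) \<partial>PiM {..<n} (\<lambda>_. N)))"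
    using hidden_janossy assms unfolding janossy_densities_def by blast
  also have "\<dots> = (\<Sum>n. ennreal (1 / fact n) * (\<integral>\<^sup>+ xs. F (mset xs) * ennreal (j xs) \<partial>list_power N n))"
    by (intro suminf_cong arg_cong2[where f = "(*)"] refl nn_integral_list_power[symmetric]) measurable
  also have "\<dots> = (\<integral>\<^sup>+ xs. F (mset xs) * ennreal (j xs) \<partial>mix1)"
    by (rule nn_integral_list_mix[symmetric]) measurable
  finally show ?thesis .
qed

text \<open>Up to the factor \<open>exp (- \<integral> lc)\<close>, the integral of \<open>H\<close> over the hidden process weighted by the
  likelihood of observing \<open>zs\<close>.\<close>

definition post_int :: "('a multiset \<Rightarrow> ennreal) \<Rightarrow> 'a list \<Rightarrow> ennreal" where
  "post_int H = J (\<lambda>xs. H (mset xs) * ennreal (j xs))"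

lemma post_int_measurable [measurable]:
  assumes [measurable]: "H \<in> borel_measurable (config_space N)"
  shows "post_int H \<in> borel_measurable (list_space N)"
  unfolding post_int_def by measurable

lemma post_int_symmetric:
  assumes [measurable]: "H \<in> borel_measurable (config_space N)"
  shows "symmetric_on (space N) (post_int H)"
proof -
  have "symmetric_on (space N) (\<lambda>xs. H (mset xs) * ennreal (j xs))"
    unfolding symmetric_on_def using j_symmetric by (metis (no_types, lifting))
  then show ?thesis
    unfolding post_int_def symmetric_on_def[of _ "assoc_int _ _ _ _ _"]
    by (intro allI impI J_symmetric) measurable
qed

lemma prod_list_config_prod: "prod_list (map f zs) = config_prod f (mset zs)"
  by (induction zs) auto

definition clutter_const :: ennreal where
  "clutter_const = ennreal (exp (- (LINT x|N. lc x)))"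

lemma clutter_const: "clutter_const \<noteq> 0" "clutter_const \<noteq> \<top>"
  by (simp_all add: clutter_const_def)

text \<open>Detections and clutter contribute separate factors: the first by the conditional law of
  \<open>\<Theta>\<close> and the Janossy expansion, the second by independence and the Poisson
  formula. \<open>generating_functional_J\<close> merges the two into one integral over
  measurements.\<close>

lemma joint_generating_functional:
  assumes E [measurable]: "E \<in> sets (config_space N)"
    and f: "simple_function N f" "\<And>x. x \<in> space N \<Longrightarrow> f x \<le> 1"
  shows "(\<integral>\<^sup>+ \<omega>. indicator E (\<Phi> \<omega>) * config_prod f (\<Xi> \<omega>) \<partial>M) =
    clutter_const * (\<integral>\<^sup>+ zs. config_prod f (mset zs) * post_int (indicator E) zs \<partial>mix1)"
proof -
  note [measurable] = config_prod_measurable[OF f(1)] simple_imp_measurable[OF f(1)]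
  let ?F = "\<lambda>xs. indicator E (mset xs) * ennreal (j xs)"
  let ?g = "\<lambda>x. ennreal (1 - p) + detect_int f x"
  let ?Z = "\<lambda>\<omega>. indicator E (\<Phi> \<omega>) * config_prod f (\<Theta> \<omega>)" and ?W = "\<lambda>\<omega>. config_prod f (C \<omega>)"
  let ?V = "vimage_algebra (space M) (\<lambda>\<omega>. (\<Phi> \<omega>, \<Theta> \<omega>)) (config_space N \<Otimes>\<^sub>M config_space N)"
    and ?U = "vimage_algebra (space M) C (config_space N)"
  have V: "(\<lambda>\<omega>. (\<Phi> \<omega>, \<Theta> \<omega>)) \<in> measurable ?V (config_space N \<Otimes>\<^sub>M config_space N)"
    by (rule measurable_vimage_algebra1) (use measurable_space[OF hidden_measurable] measurable_space[OF detected_measurable] in \<open>auto simp: space_pair_measure\<close>)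
  have "(\<lambda>(\<phi>, \<theta>). indicator E \<phi> * config_prod f \<theta>) \<in> borel_measurable (config_space N \<Otimes>\<^sub>M config_space N)"
    by measurable
  from measurable_compose[OF V this] have Z_meas: "?Z \<in> borel_measurable ?V"
    by simp
  have U: "C \<in> measurable ?U (config_space N)"
    by (rule measurable_vimage_algebra1) (use measurable_space[OF clutter_measurable] in auto)
  have W_meas: "?W \<in> borel_measurable ?U"
    by (rule measurable_compose[OF U config_prod_measurable[OF f(1)]])
  \<comment> \<open>Independence is assumed for the sigma-algebras generated by the pair and by the
    clutter; it passes to \<open>?Z\<close> and \<open>?W\<close>, which are measurable for
    them.\<close>
  have sub: "sigma_sets (space M) {X -` A \<inter> space M | A. A \<in> sets borel} \<subseteq> sets S"
    if "X \<in> borel_measurable S" "space S = space M" for X :: "'w \<Rightarrow> ennreal" and S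
    unfolding that(2)[symmetric] using measurable_sets[OF that(1)] by (intro sets.sigma_sets_subset) auto
  have "M.indep_var borel ?Z borel ?W"
    unfolding M.indep_var_eq
  proof (intro conjI)
    show "M.indep_set (sigma_sets (space M) {?Z -` A \<inter> space M | A. A \<in> sets borel})
        (sigma_sets (space M) {?W -` A \<inter> space M | A. A \<in> sets borel})"
      using clutter_indep sub[OF Z_meas space_vimage_algebra] sub[OF W_meas space_vimage_algebra]
      unfolding M.indep_sets2_eq by (meson subset_eq)
  qed measurable
  then have "M.indep_vars (case_bool borel borel) (case_bool ?Z ?W) UNIV"
    unfolding M.indep_var_def by (simp add: o_def)
  moreover have "case_bool borel borel = (\<lambda>_. borel :: ennreal measure)"
    by (auto split: bool.split)
  ultimately have "(\<integral>\<^sup>+ \<omega>. (\<Prod>b\<in>UNIV. case_bool ?Z ?W b \<omega>) \<partial>M) = (\<Prod>b\<in>UNIV. \<integral>\<^sup>+ \<omega>. case_bool ?Z ?W b \<omega> \<partial>M)"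
    by (intro M.indep_vars_nn_integral) auto
  then have ZW: "(\<integral>\<^sup>+ \<omega>. ?Z \<omega> * ?W \<omega> \<partial>M) = (\<integral>\<^sup>+ \<omega>. ?Z \<omega> \<partial>M) * (\<integral>\<^sup>+ \<omega>. ?W \<omega> \<partial>M)"
    by (simp add: UNIV_bool mult.commute)
  have K [measurable]: "obs_config N p ld \<in> measurable (config_space N) (subprob_algebra (config_space N))"
    using detected_distr unfolding regular_cond_distr_def by (blast intro: measurable_prob_algebraD)
  have "(\<integral>\<^sup>+ \<omega>. ?Z \<omega> \<partial>M) = (\<integral>\<^sup>+ \<omega>. indicator E (\<Phi> \<omega>) * (\<integral>\<^sup>+ \<xi>. config_prod f \<xi> \<partial>obs_config N p ld (\<Phi> \<omega>)) \<partial>M)"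
    by (rule regular_cond_distr_nn_integral[OF detected_distr]) measurable
  also have "\<dots> = (\<integral>\<^sup>+ xs. indicator E (mset xs) * (\<integral>\<^sup>+ \<xi>. config_prod f \<xi> \<partial>obs_config N p ld (mset xs)) * ennreal (j xs) \<partial>mix1)"
    by (rule hidden_nn_integral) measurable
  also have "\<dots> = (\<integral>\<^sup>+ xs. prod_list (map ?g xs) * ?F xs \<partial>mix1)"
  proof (rule nn_integral_cong)
    fix xs assume "xs \<in> space mix1"
    then have "mset xs \<in> space (config_space N)"
      by (auto simp: space_list_space space_config_space)
    from nn_integral_obs_config[OF this f(1)]
    show "indicator E (mset xs) * (\<integral>\<^sup>+ \<xi>. config_prod f \<xi> \<partial>obs_config N p ld (mset xs)) * ennreal (j xs) =
        prod_list (map ?g xs) * ?F xs"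
      by (simp add: prod_list_config_prod mult_ac)
  qed
  finally have Z: "(\<integral>\<^sup>+ \<omega>. ?Z \<omega> \<partial>M) = \<dots>" .
  have "(\<integral>\<^sup>+ \<omega>. ?W \<omega> \<partial>M) = (\<integral>\<^sup>+ \<xi>. config_prod f \<xi> \<partial>distr M (config_space N) C)"
    by (rule nn_integral_distr[symmetric]) auto
  also have "\<dots> = clutter_const * (\<Sum>i. ennreal (1 / fact i) * clutter_int f ^ i)"
    unfolding clutter_const_def by (rule nn_integral_poisson_process[OF clutter_poisson f])
  finally have W: "(\<integral>\<^sup>+ \<omega>. ?W \<omega> \<partial>M) = \<dots>" .
  have "symmetric_on (space N) ?F"
    unfolding symmetric_on_def using j_symmetric by (metis (no_types, lifting))
  then have "(\<integral>\<^sup>+ zs. prod_list (map f zs) * J ?F zs \<partial>mix1) =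
    (\<Sum>i. ennreal (1 / fact i) * clutter_int f ^ i) * (\<integral>\<^sup>+ xs. prod_list (map ?g xs) * ?F xs \<partial>mix1)"
    by (intro generating_functional_J) measurable
  then have "(\<integral>\<^sup>+ \<omega>. ?Z \<omega> * ?W \<omega> \<partial>M) = clutter_const * (\<integral>\<^sup>+ zs. prod_list (map f zs) * J ?F zs \<partial>mix1)"
    unfolding ZW Z W by (simp add: mult_ac)
  moreover have "(\<integral>\<^sup>+ \<omega>. indicator E (\<Phi> \<omega>) * config_prod f (\<Xi> \<omega>) \<partial>M) = (\<integral>\<^sup>+ \<omega>. ?Z \<omega> * ?W \<omega> \<partial>M)"
    by (intro nn_integral_cong) (simp add: observed mult.assoc)
  ultimately show ?thesis
    by (simp add: post_int_def prod_list_config_prod)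
qed

text \<open>Both sides, as functions of \<open>h\<close>, are integrals against measures on
  configurations, and these two measures have equal generating functionals.\<close>

lemma joint_law:
  assumes E [measurable]: "E \<in> sets (config_space N)" and h: "h \<in> borel_measurable (config_space N)"
  shows "(\<integral>\<^sup>+ \<omega>. indicator E (\<Phi> \<omega>) * h (\<Xi> \<omega>) \<partial>M) =
    clutter_const * (\<integral>\<^sup>+ zs. h (mset zs) * post_int (indicator E) zs \<partial>mix1)"
proof -
  let ?P = "distr (density M (\<lambda>\<omega>. indicator E (\<Phi> \<omega>))) (config_space N) \<Xi>"
  let ?Q = "scale_measure clutter_const (distr (density mix1 (post_int (indicator E))) (config_space N) mset)"
  have P: "(\<integral>\<^sup>+ \<phi>. g \<phi> \<partial>?P) = (\<integral>\<^sup>+ \<omega>. indicator E (\<Phi> \<omega>) * g (\<Xi> \<omega>) \<partial>M)"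
    if [measurable]: "g \<in> borel_measurable (config_space N)" for g
    by (subst nn_integral_distr, simp, simp) (subst nn_integral_density, auto)
  have Q: "(\<integral>\<^sup>+ \<phi>. g \<phi> \<partial>?Q) = clutter_const * (\<integral>\<^sup>+ zs. g (mset zs) * post_int (indicator E) zs \<partial>mix1)"
    if [measurable]: "g \<in> borel_measurable (config_space N)" for g
    by (subst nn_integral_scale_measure, simp, subst nn_integral_distr, simp, simp)
       (subst nn_integral_density, auto simp: mult.commute)
  have eq: "(\<integral>\<^sup>+ \<phi>. config_prod f \<phi> \<partial>?P) = (\<integral>\<^sup>+ \<phi>. config_prod f \<phi> \<partial>?Q)"
    if f: "simple_function N f" "\<And>x. x \<in> space N \<Longrightarrow> f x \<le> 1" for f
    unfolding P[OF config_prod_measurable[OF f(1)]] Q[OF config_prod_measurable[OF f(1)]]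
    using f by (rule joint_generating_functional[OF E])
  have fin: "finite_measure ?P"
  proof (rule finite_measureI)
    have "emeasure ?P (space ?P) = (\<integral>\<^sup>+ \<omega>. indicator E (\<Phi> \<omega>) * 1 \<partial>M)"
      using P[of "\<lambda>_. 1"] by simp
    also have "\<dots> \<le> (\<integral>\<^sup>+ \<omega>. 1 \<partial>M)"
      by (intro nn_integral_mono) (auto simp: indicator_def)
    finally show "emeasure ?P (space ?P) \<noteq> \<infinity>"
      by (auto simp: M.emeasure_space_1 top_unique)
  qed
  \<comment> \<open>The constant function 1 compares the total masses and thus shows
    \<open>?Q\<close> to be finite.\<close>
  have one: "(\<integral>\<^sup>+ \<phi>. 1 \<partial>?P) = (\<integral>\<^sup>+ \<phi>. 1 \<partial>?Q)"
    using eq[of "\<lambda>_. 1"] by (simp add: config_prod_def)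
  have "?P = ?Q"
  proof (rule generating_functional_unique[OF fin])
    show "finite_measure ?Q"
      using one finite_measure.emeasure_finite[OF fin, of "space ?P"]
      by (intro finite_measureI) simp
  qed (use eq in auto)
  then show ?thesis
    using P[OF h] Q[OF h] by simp
qed

text \<open>For the certain event, \<open>joint_law\<close> expresses a probability, which bounds
  the integral over sequences of all lengths together. This makes the normalizing constant in Bayes'
  formula finite almost everywhere.\<close>

lemma post_int_1_finite:
  "(\<integral>\<^sup>+ z. post_int (\<lambda>_. 1) (map z [0..<m]) \<partial>PiM {..<m} (\<lambda>_. N)) \<noteq> \<infinity>"
proof -
  have sp: "post_int (indicator (space (config_space N))) = post_int (\<lambda>_. 1)"
    unfolding post_int_def by (intro ext J_cong) (auto simp: space_config_space indicator_def)
  have "clutter_const * (\<integral>\<^sup>+ zs. post_int (\<lambda>_. 1) zs \<partial>mix1) =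
      (\<integral>\<^sup>+ \<omega>. indicator (space (config_space N)) (\<Phi> \<omega>) * 1 \<partial>M)"
    using joint_law[of "space (config_space N)" "\<lambda>_. 1"] by (simp add: sp)
  also have "\<dots> \<le> (\<integral>\<^sup>+ \<omega>. 1 \<partial>M)"
    by (intro nn_integral_mono) (auto simp: indicator_def)
  also have "\<dots> = 1"
    by (simp add: M.emeasure_space_1)
  finally have "clutter_const * (\<integral>\<^sup>+ zs. post_int (\<lambda>_. 1) zs \<partial>mix1) \<noteq> \<top>"
    by (auto simp: top_unique)
  then have fin: "(\<integral>\<^sup>+ zs. post_int (\<lambda>_. 1) zs \<partial>mix1) \<noteq> \<top>"
    using clutter_const by (auto simp: ennreal_mult_eq_top_iff)
  have "(\<integral>\<^sup>+ zs. post_int (\<lambda>_. 1) zs \<partial>mix1) =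
      (\<Sum>n. ennreal (1 / fact n) * (\<integral>\<^sup>+ zs. post_int (\<lambda>_. 1) zs \<partial>list_power N n))"
    by (rule nn_integral_list_mix) measurable
  then have "ennreal (1 / fact m) * (\<integral>\<^sup>+ zs. post_int (\<lambda>_. 1) zs \<partial>list_power N m) \<le>
      (\<integral>\<^sup>+ zs. post_int (\<lambda>_. 1) zs \<partial>mix1)"
    using sum_le_suminf[of "\<lambda>n. ennreal (1 / fact n) * (\<integral>\<^sup>+ zs. post_int (\<lambda>_. 1) zs \<partial>list_power N n)" "{m}"]
    by simp
  then have "(\<integral>\<^sup>+ zs. post_int (\<lambda>_. 1) zs \<partial>list_power N m) \<noteq> \<top>"
    using fin by (auto simp: ennreal_mult_eq_top_iff top_unique)
  then show ?thesis
    by (subst (asm) nn_integral_list_power) auto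
qed

lemma list_mix_restrict_length:
  assumes [measurable]: "F \<in> borel_measurable (list_space N)"
  shows "(\<integral>\<^sup>+ zs. F zs * (if length zs = m then 1 else 0) \<partial>mix1) =
    ennreal (1 / fact m) * (\<integral>\<^sup>+ z. F (map z [0..<m]) \<partial>PiM {..<m} (\<lambda>_. N))"
proof -
  have "(\<integral>\<^sup>+ zs. F zs * (if length zs = m then 1 else 0) \<partial>mix1) =
    (\<Sum>n. ennreal (1 / fact n) * (\<integral>\<^sup>+ zs. F zs * (if length zs = m then 1 else 0) \<partial>list_power N n))"
    by (rule nn_integral_list_mix) measurable
  also have "\<dots> = (\<Sum>n. if n = m then ennreal (1 / fact n) * (\<integral>\<^sup>+ z. F (map z [0..<n]) \<partial>PiM {..<n} (\<lambda>_. N)) else 0)"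
  proof (rule suminf_cong)
    fix n
    have "(\<integral>\<^sup>+ zs. F zs * (if length zs = m then 1 else 0) \<partial>list_power N n) =
      (\<integral>\<^sup>+ z. F (map z [0..<n]) * (if length (map z [0..<n]) = m then 1 else 0) \<partial>PiM {..<n} (\<lambda>_. N))"
      by (rule nn_integral_list_power) measurable
    then show "ennreal (1 / fact n) * (\<integral>\<^sup>+ zs. F zs * (if length zs = m then 1 else 0) \<partial>list_power N n) =
      (if n = m then ennreal (1 / fact n) * (\<integral>\<^sup>+ z. F (map z [0..<n]) \<partial>PiM {..<n} (\<lambda>_. N)) else 0)"
      by simp
  qed
  also have "\<dots> = ennreal (1 / fact m) * (\<integral>\<^sup>+ z. F (map z [0..<m]) \<partial>PiM {..<m} (\<lambda>_. N))"
    by (rule sums_unique[OF sums_single, symmetric])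
  finally show ?thesis .
qed

text \<open>The conditional distribution and \<open>joint_law\<close> are compared on events
  \<open>\<Xi> \<in> A\<close>, \<open>\<Phi> \<in> E\<close>. This tests two symmetric functions of
  the measurements on unordered events, so \<open>symmetric_density_unique\<close> applies; the null
  set still depends on \<open>E\<close>.\<close>

lemma posterior_event:
  assumes K: "regular_cond_distr M (config_space N) \<Xi> (config_space N) \<Phi> K"
    and E [measurable]: "E \<in> sets (config_space N)"
  shows "AE z in PiM {..<m} (\<lambda>_. N).
    emeasure (K (mset (map z [0..<m]))) E * post_int (\<lambda>_. 1) (map z [0..<m]) = post_int (indicator E) (map z [0..<m])"
proof -
  have Kp: "K \<in> measurable (config_space N) (prob_algebra (config_space N))"
    using K by (simp add: regular_cond_distr_def)
  then have [measurable]: "K \<in> measurable (config_space N) (subprob_algebra (config_space N))"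
    by (rule measurable_prob_algebraD)
  have sp: "post_int (indicator (space (config_space N))) = post_int (\<lambda>_. 1)"
    unfolding post_int_def by (intro ext J_cong) (auto simp: space_config_space indicator_def)
  let ?G = "\<lambda>zs. emeasure (K (mset zs)) E * post_int (\<lambda>_. 1) zs"
  have eq: "(\<integral>\<^sup>+ z. ?G (map z [0..<m]) * indicator A (mset (map z [0..<m])) \<partial>PiM {..<m} (\<lambda>_. N)) =
      (\<integral>\<^sup>+ z. post_int (indicator E) (map z [0..<m]) * indicator A (mset (map z [0..<m])) \<partial>PiM {..<m} (\<lambda>_. N))"
    if A [measurable]: "A \<in> sets (config_space N)" for A
  proof -
    \<comment> \<open>Configurations with exactly \<open>m\<close> points isolate the
      \<open>m\<close>-th term of the series over all lengths.\<close>
    define A' where "A' = A \<inter> {\<phi> \<in> space (config_space N). size \<phi> = m}"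
    have A' [measurable]: "A' \<in> sets (config_space N)"
      unfolding A'_def by measurable
    have ind: "indicator A' (mset zs) = (indicator A (mset zs) * (if length zs = m then 1 else 0) :: ennreal)"
      if "zs \<in> space mix1" for zs
      using that by (auto simp: A'_def indicator_def space_config_space space_list_space)
    have "emeasure M {\<omega> \<in> space M. \<Xi> \<omega> \<in> A' \<and> \<Phi> \<omega> \<in> E} =
        (\<integral>\<^sup>+ \<omega>. indicator (space (config_space N)) (\<Phi> \<omega>) * (emeasure (K (\<Xi> \<omega>)) E * indicator A' (\<Xi> \<omega>)) \<partial>M)"
      using K A' E measurable_space[OF hidden_measurable]
      by (auto simp: regular_cond_distr_def intro!: nn_integral_cong)
    also have "\<dots> = clutter_const * (\<integral>\<^sup>+ zs. emeasure (K (mset zs)) E * indicator A' (mset zs) * post_int (\<lambda>_. 1) zs \<partial>mix1)"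
      unfolding sp[symmetric] by (rule joint_law) measurable
    also have "(\<integral>\<^sup>+ zs. emeasure (K (mset zs)) E * indicator A' (mset zs) * post_int (\<lambda>_. 1) zs \<partial>mix1) =
       (\<integral>\<^sup>+ zs. (?G zs * indicator A (mset zs)) * (if length zs = m then 1 else 0) \<partial>mix1)"
      by (intro nn_integral_cong) (simp add: ind mult_ac)
    also have "\<dots> = ennreal (1 / fact m) * (\<integral>\<^sup>+ z. ?G (map z [0..<m]) * indicator A (mset (map z [0..<m])) \<partial>PiM {..<m} (\<lambda>_. N))"
      by (rule list_mix_restrict_length) measurable
    finally have 1: "emeasure M {\<omega> \<in> space M. \<Xi> \<omega> \<in> A' \<and> \<Phi> \<omega> \<in> E} = clutter_const * \<dots>" .
    have "{\<omega> \<in> space M. \<Xi> \<omega> \<in> A' \<and> \<Phi> \<omega> \<in> E} \<in> sets M"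
      by measurable
    then have "emeasure M {\<omega> \<in> space M. \<Xi> \<omega> \<in> A' \<and> \<Phi> \<omega> \<in> E} =
        (\<integral>\<^sup>+ \<omega>. indicator {\<omega> \<in> space M. \<Xi> \<omega> \<in> A' \<and> \<Phi> \<omega> \<in> E} \<omega> \<partial>M)"
      by simp
    also have "\<dots> = (\<integral>\<^sup>+ \<omega>. indicator E (\<Phi> \<omega>) * indicator A' (\<Xi> \<omega>) \<partial>M)"
      by (intro nn_integral_cong) (auto simp: indicator_def)
    also have "\<dots> = clutter_const * (\<integral>\<^sup>+ zs. indicator A' (mset zs) * post_int (indicator E) zs \<partial>mix1)"
      by (rule joint_law) measurable
    also have "(\<integral>\<^sup>+ zs. indicator A' (mset zs) * post_int (indicator E) zs \<partial>mix1) =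
       (\<integral>\<^sup>+ zs. (post_int (indicator E) zs * indicator A (mset zs)) * (if length zs = m then 1 else 0) \<partial>mix1)"
      by (intro nn_integral_cong) (simp add: ind mult_ac)
    also have "\<dots> = ennreal (1 / fact m) * (\<integral>\<^sup>+ z. post_int (indicator E) (map z [0..<m]) * indicator A (mset (map z [0..<m])) \<partial>PiM {..<m} (\<lambda>_. N))"
      by (rule list_mix_restrict_length) measurable
    finally show ?thesis
      unfolding 1 using clutter_const by (auto simp: ennreal_mult_cancel_left)
  qed
  have sym: "symmetric_on (space N) ?G"
    unfolding symmetric_on_def
    using post_int_symmetric[of "\<lambda>_. 1"] by (auto simp: symmetric_on_def)
  have fin: "(\<integral>\<^sup>+ z. ?G (map z [0..<m]) \<partial>PiM {..<m} (\<lambda>_. N)) \<noteq> \<infinity>"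
  proof -
    have "(\<integral>\<^sup>+ z. ?G (map z [0..<m]) \<partial>PiM {..<m} (\<lambda>_. N)) \<le> (\<integral>\<^sup>+ z. post_int (\<lambda>_. 1) (map z [0..<m]) \<partial>PiM {..<m} (\<lambda>_. N))"
    proof (rule nn_integral_mono)
      fix z assume z: "z \<in> space (PiM {..<m} (\<lambda>_. N))"
      have "mset (map z [0..<m]) \<in> space (config_space N)"
        using map_upt_in_lists[OF z] unfolding space_config_space by (metis in_listsD mem_Collect_eq set_mset_mset subsetI)
      then have "K (mset (map z [0..<m])) \<in> space (prob_algebra (config_space N))"
        by (rule measurable_space[OF Kp])
      then have "emeasure (K (mset (map z [0..<m]))) E \<le> 1"
        by (simp only: space_prob_algebra mem_Collect_eq prob_space.measure_le_1)
      from mult_right_mono[OF this, of "post_int (\<lambda>_. 1) (map z [0..<m])"]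
      show "?G (map z [0..<m]) \<le> post_int (\<lambda>_. 1) (map z [0..<m])"
        by simp
    qed
    then show ?thesis
      using post_int_1_finite[of m] by (auto simp: top_unique)
  qed
  show ?thesis
    by (rule symmetric_density_unique[OF _ sym _ post_int_symmetric fin eq]) measurable
qed

end

section \<open>The posterior law\<close>

context measured_process
begin

lemma weighted_measurable:
  assumes [measurable]: "H \<in> borel_measurable (config_space N)"
  shows "(\<lambda>xs. H (mset xs) * ennreal (j xs)) \<in> borel_measurable (list_space N)"
  by measurable

lemma post_int_cong:
  assumes "\<And>\<phi>. \<phi> \<in> space (config_space N) \<Longrightarrow> H \<phi> = H' \<phi>"
  shows "post_int H zs = post_int H' zs"
  unfolding post_int_def
proof (rule J_cong)
  fix xs assume "xs \<in> lists (space N)"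
  then have "mset xs \<in> space (config_space N)"
    by (auto simp: space_config_space)
  then show "H (mset xs) * ennreal (j xs) = H' (mset xs) * ennreal (j xs)"
    by (simp add: assms)
qed

lemma post_int_add:
  assumes "H \<in> borel_measurable (config_space N)" "H' \<in> borel_measurable (config_space N)" "zs \<in> lists (space N)"
  shows "post_int (\<lambda>\<phi>. H \<phi> + H' \<phi>) zs = post_int H zs + post_int H' zs"
  unfolding post_int_def distrib_right
  using assms by (intro J_add weighted_measurable)

lemma post_int_cmult:
  assumes "H \<in> borel_measurable (config_space N)" "zs \<in> lists (space N)"
  shows "post_int (\<lambda>\<phi>. a * H \<phi>) zs = a * post_int H zs"
  unfolding post_int_def mult.assoc
  using assms by (intro J_cmult weighted_measurable)

lemma post_int_SUP:
  assumes "\<And>i. H i \<in> borel_measurable (config_space N)" "incseq H" "zs \<in> lists (space N)"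
  shows "post_int (\<lambda>\<phi>. SUP i. H i \<phi>) zs = (SUP i. post_int (H i) zs)"
proof -
  have "incseq (\<lambda>i xs. H i (mset xs) * ennreal (j xs))"
    using assms(2) by (auto simp: incseq_def le_fun_def intro!: mult_right_mono)
  from J_monotone_convergence[OF weighted_measurable[OF assms(1)] this assms(3)]
  show ?thesis
    unfolding post_int_def SUP_mult_right_ennreal by simp
qed

lemma post_int_suminf:
  assumes H: "\<And>i. H i \<in> borel_measurable (config_space N)" and zs: "zs \<in> lists (space N)"
  shows "post_int (\<lambda>\<phi>. \<Sum>i. H i \<phi>) zs = (\<Sum>i. post_int (H i) zs)"
proof -
  have sums: "post_int (\<lambda>\<phi>. \<Sum>i<n. H i \<phi>) zs = (\<Sum>i<n. post_int (H i) zs)" for n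
  proof (induction n)
    case 0
    have "post_int (\<lambda>\<phi>. 0 * H 0 \<phi>) zs = 0 * post_int (H 0) zs"
      by (rule post_int_cmult[OF H zs])
    then show ?case by simp
  next
    case (Suc n)
    have "(\<lambda>\<phi>. \<Sum>i<n. H i \<phi>) \<in> borel_measurable (config_space N)"
      using H by (intro borel_measurable_sum) auto
    from post_int_add[OF this H[of n] zs] show ?case
      by (simp add: Suc)
  qed
  have "post_int (\<lambda>\<phi>. \<Sum>i. H i \<phi>) zs = post_int (\<lambda>\<phi>. SUP n. \<Sum>i<n. H i \<phi>) zs"
    by (simp add: suminf_eq_SUP)
  also have "\<dots> = (SUP n. post_int (\<lambda>\<phi>. \<Sum>i<n. H i \<phi>) zs)"
    using H zs by (intro post_int_SUP borel_measurable_sum) (auto simp: incseq_def le_fun_def intro!: sum_mono2)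
  also have "\<dots> = (\<Sum>i. post_int (H i) zs)"
    by (simp add: sums suminf_eq_SUP)
  finally show ?thesis .
qed

text \<open>This concerns one fixed sequence \<open>zs\<close>, so no further null sets arise. The
  events that satisfy the equation form a Dynkin class; its complement step subtracts, which needs
  the finite value at the whole space.\<close>

lemma posterior_extend_events:
  assumes G: "Int_stable G" "G \<subseteq> Pow (space (config_space N))"
      "sets (config_space N) = sigma_sets (space (config_space N)) G"
    and \<kappa>: "sets \<kappa> = sets (config_space N)" "prob_space \<kappa>"
    and zs: "zs \<in> lists (space N)" and fin: "post_int (\<lambda>_. 1) zs \<noteq> \<top>"
    and eq: "\<And>E. E \<in> G \<Longrightarrow> emeasure \<kappa> E * post_int (\<lambda>_. 1) zs = post_int (indicator E) zs"
    and E: "E \<in> sets (config_space N)"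
  shows "emeasure \<kappa> E * post_int (\<lambda>_. 1) zs = post_int (indicator E) zs"
proof -
  interpret \<kappa>: prob_space \<kappa> by fact
  have space_\<kappa>: "space \<kappa> = space (config_space N)"
    using \<kappa>(1) by (rule sets_eq_imp_space_eq)
  show ?thesis
    using G(1,2) E[unfolded G(3)]
  proof (induction E rule: sigma_sets_induct_disjoint)
    case (basic A)
    then show ?case by (rule eq)
  next
    case empty
    have "post_int (\<lambda>\<phi>. 0 * 1) zs = 0 * post_int (\<lambda>_. 1) zs"
      using zs by (intro post_int_cmult) auto
    moreover have "indicator {} = (\<lambda>\<phi>::'a multiset. 0 * (1::ennreal))" by auto
    ultimately show ?case by simp
  next
    case (compl A)
    let ?Ac = "space (config_space N) - A"
    have A [measurable]: "A \<in> sets (config_space N)"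
      using compl by (simp add: G(3))
    have "post_int (indicator A) zs + post_int (indicator ?Ac) zs = post_int (\<lambda>\<phi>. indicator A \<phi> + indicator ?Ac \<phi>) zs"
      using zs by (intro post_int_add[symmetric]) measurable
    also have "\<dots> = post_int (\<lambda>_. 1) zs"
      by (rule post_int_cong) (auto simp: indicator_def)
    finally have 1: "post_int (indicator A) zs + post_int (indicator ?Ac) zs = post_int (\<lambda>_. 1) zs" .
    have "emeasure \<kappa> A + emeasure \<kappa> ?Ac = emeasure \<kappa> (space \<kappa>)"
      using \<kappa>(1) A sets.sets_into_space[OF A]
      by (subst plus_emeasure) (auto simp: space_\<kappa> Un_absorb1)
    then have "(emeasure \<kappa> A + emeasure \<kappa> ?Ac) * post_int (\<lambda>_. 1) zs = post_int (\<lambda>_. 1) zs"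
      by (simp add: \<kappa>.emeasure_space_1)
    then have "post_int (indicator A) zs + emeasure \<kappa> ?Ac * post_int (\<lambda>_. 1) zs =
        post_int (indicator A) zs + post_int (indicator ?Ac) zs"
      unfolding distrib_right compl.IH 1 .
    moreover have "post_int (indicator A) zs \<noteq> \<top>"
      using 1 fin by (metis add_top ennreal_add_eq_top)
    ultimately show ?case
      by (simp only: ennreal_add_left_cancel infinity_ennreal_def simp_thms)
  next
    case (union A)
    have A: "A i \<in> sets (config_space N)" for i
      using union by (auto simp: G(3))
    have "emeasure \<kappa> (\<Union>i. A i) * post_int (\<lambda>_. 1) zs = (\<Sum>i. emeasure \<kappa> (A i)) * post_int (\<lambda>_. 1) zs"
      using A \<kappa>(1) union(1) by (subst suminf_emeasure) auto
    also have "\<dots> = (\<Sum>i. emeasure \<kappa> (A i) * post_int (\<lambda>_. 1) zs)"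
      by simp
    also have "\<dots> = (\<Sum>i. post_int (indicator (A i)) zs)"
      by (simp only: union.IH)
    also have "\<dots> = post_int (\<lambda>\<phi>. \<Sum>i. indicator (A i) \<phi>) zs"
      using A zs by (intro post_int_suminf[symmetric]) auto
    also have "\<dots> = post_int (indicator (\<Union>i. A i)) zs"
      by (intro post_int_cong suminf_indicator[OF union(1)])
    finally show ?case .
  qed
qed

lemma posterior_extend:
  assumes \<kappa>: "sets \<kappa> = sets (config_space N)"
    and zs: "zs \<in> lists (space N)"
    and eq: "\<And>E. E \<in> sets (config_space N) \<Longrightarrow> emeasure \<kappa> E * post_int (\<lambda>_. 1) zs = post_int (indicator E) zs"
    and H: "H \<in> borel_measurable (config_space N)"
  shows "(\<integral>\<^sup>+ \<phi>. H \<phi> \<partial>\<kappa>) * post_int (\<lambda>_. 1) zs = post_int H zs"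
proof -
  have space_\<kappa>: "space \<kappa> = space (config_space N)"
    using \<kappa> by (rule sets_eq_imp_space_eq)
  have meas: "f \<in> borel_measurable \<kappa>" if "f \<in> borel_measurable (config_space N)" for f :: "'a multiset \<Rightarrow> ennreal"
    using that \<kappa> by (simp cong: measurable_cong_sets)
  show ?thesis
    using H
  proof (induction rule: borel_measurable_induct)
    case (cong f g)
    have "(\<integral>\<^sup>+ \<phi>. f \<phi> \<partial>\<kappa>) = (\<integral>\<^sup>+ \<phi>. g \<phi> \<partial>\<kappa>)"
      using cong(3) by (intro nn_integral_cong) (simp add: space_\<kappa>)
    moreover have "post_int f zs = post_int g zs"
      using cong(3) by (rule post_int_cong)
    ultimately show ?case
      using cong(4) by simp
  next
    case (set A)
    then show ?case
      using eq[OF set] \<kappa> by simp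
  next
    case (mult u a)
    then show ?case
      using zs by (simp add: nn_integral_cmult meas post_int_cmult mult.assoc)
  next
    case (add u v)
    then show ?case
      using zs by (simp add: nn_integral_add meas post_int_add distrib_right)
  next
    case (seq U)
    have U: "U i \<in> borel_measurable (config_space N)" for i by fact
    have "(\<integral>\<^sup>+ \<phi>. (SUP i. U i \<phi>) \<partial>\<kappa>) * post_int (\<lambda>_. 1) zs = (SUP i. \<integral>\<^sup>+ \<phi>. U i \<phi> \<partial>\<kappa>) * post_int (\<lambda>_. 1) zs"
      using \<open>incseq U\<close> meas[OF U] by (subst nn_integral_monotone_convergence_SUP) auto
    also have "\<dots> = (SUP i. (\<integral>\<^sup>+ \<phi>. U i \<phi> \<partial>\<kappa>) * post_int (\<lambda>_. 1) zs)"
      by (rule SUP_mult_right_ennreal)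
    also have "\<dots> = (SUP i. post_int (U i) zs)"
      by (simp only: seq.IH)
    also have "\<dots> = post_int (\<lambda>\<phi>. SUP i. U i \<phi>) zs"
      by (rule post_int_SUP[OF U \<open>incseq U\<close> zs, symmetric])
    finally show ?case
      unfolding SUP_apply[abs_def] .
  qed
qed

text \<open>One null set serves all \<open>H\<close>. This is essential, because the density
  property quantifies over all \<open>A\<close> and \<open>B\<close> for a given
  \<open>z\<close>.\<close>

lemma posterior_law:
  fixes G :: "'a multiset set set"
  assumes K: "regular_cond_distr M (config_space N) \<Xi> (config_space N) \<Phi> K"
    and G: "countable G" "Int_stable G" "G \<subseteq> Pow (space (config_space N))"
      "sets (config_space N) = sigma_sets (space (config_space N)) G"
  shows "AE z in PiM {..<m} (\<lambda>_. N). post_int (\<lambda>_. 1) (map z [0..<m]) \<noteq> \<top> \<and>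
    (\<forall>H\<in>borel_measurable (config_space N).
      (\<integral>\<^sup>+ \<phi>. H \<phi> \<partial>K (mset (map z [0..<m]))) * post_int (\<lambda>_. 1) (map z [0..<m]) = post_int H (map z [0..<m]))"
proof -
  have G_sets: "E \<in> sets (config_space N)" if "E \<in> G" for E
    unfolding G(4) using that by auto
  have "AE z in PiM {..<m} (\<lambda>_. N). \<forall>E\<in>G.
      emeasure (K (mset (map z [0..<m]))) E * post_int (\<lambda>_. 1) (map z [0..<m]) = post_int (indicator E) (map z [0..<m])"
    using posterior_event[OF K G_sets] G(1) by (simp add: AE_ball_countable)
  moreover have "AE z in PiM {..<m} (\<lambda>_. N). post_int (\<lambda>_. 1) (map z [0..<m]) \<noteq> \<infinity>"
    using post_int_1_finite by (intro nn_integral_PInf_AE) measurable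
  ultimately show ?thesis
    using AE_space
  proof eventually_elim
    case (elim z)
    have zs: "map z [0..<m] \<in> lists (space N)"
      using elim(3) by (rule map_upt_in_lists)
    then have "mset (map z [0..<m]) \<in> space (config_space N)"
      unfolding space_config_space by (metis in_listsD mem_Collect_eq set_mset_mset subsetI)
    then have "K (mset (map z [0..<m])) \<in> space (prob_algebra (config_space N))"
      using K unfolding regular_cond_distr_def by (metis measurable_space)
    then have \<kappa>: "sets (K (mset (map z [0..<m]))) = sets (config_space N)" "prob_space (K (mset (map z [0..<m])))"
      by (simp_all only: space_prob_algebra mem_Collect_eq)
    have fin: "post_int (\<lambda>_. 1) (map z [0..<m]) \<noteq> \<top>"
      using elim(2) by simp
    have "emeasure (K (mset (map z [0..<m]))) E * post_int (\<lambda>_. 1) (map z [0..<m]) = post_int (indicator E) (map z [0..<m])"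
      if "E \<in> sets (config_space N)" for E
      by (rule posterior_extend_events[OF G(2-4) \<kappa> zs fin _ that]) (rule elim(1)[rule_format])
    from posterior_extend[OF \<kappa>(1) zs this] fin show ?case
      by simp
  qed
qed

text \<open>The stated density lists \<open>x\<close> and \<open>y\<close> last, while the recursion
  puts hidden points first; symmetry of \<open>j\<close> reconciles the two.\<close>

lemma Upsilon2_eq_J:
  assumes xy [measurable]: "x \<in> space N" "y \<in> space N" and ws: "ws \<in> lists (space N)"
  shows "Upsilon2 N p ld lc j ws x y = J (\<lambda>xs. ennreal (j (x # y # xs))) ws"
proof -
  have eq: "j (xs @ [x, y]) = j (x # y # xs)" if "xs \<in> lists (space N)" for xs
    using that xy by (intro j_symmetric) auto
  have "(\<lambda>xs. ennreal (j (xs @ [x, y]))) \<in> borel_measurable (list_space N)"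
    using measurable_compose[OF _ j_measurable, of "\<lambda>xs. xs @ [x, y]"] by measurable
  then have "Upsilon2 N p ld lc j ws x y = J (\<lambda>xs. ennreal (j (xs @ [x, y]))) ws"
    unfolding Upsilon2_def using xy by (intro assoc_sum_eq_J j_nonneg ws) auto
  also have "\<dots> = J (\<lambda>xs. ennreal (j (x # y # xs))) ws"
    by (rule J_cong) (simp add: eq)
  finally show ?thesis .
qed

lemma j_Xi_eq_post_int:
  assumes "zs \<in> lists (space N)"
  shows "j_Xi N p ld lc j zs = post_int (\<lambda>_. 1) zs"
  unfolding j_Xi_def post_int_def using assms by (subst assoc_sum_eq_J) (auto intro: j_nonneg)

text \<open>The numerator of the density, kept in the form that \<open>J_pair_sum\<close> produces;
  \<open>posterior_density_eq\<close> translates it into sums over positions.\<close>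

definition pair_density :: "'a list \<Rightarrow> 'a \<Rightarrow> 'a \<Rightarrow> ennreal" where
  "pair_density zs x y =
     ennreal (1 - p) ^ 2 * J (\<lambda>xs. ennreal (j (x # y # xs))) zs
     + ennreal (1 - p) * removal_sum (\<lambda>w ws. (ennreal (p * ld w x) + ennreal (p * ld w y)) *
         J (\<lambda>xs. ennreal (j (x # y # xs))) ws) zs
     + removal_sum (\<lambda>w ws. removal_sum (\<lambda>v vs. ennreal (p * ld w x) * ennreal (p * ld v y) *
         J (\<lambda>xs. ennreal (j (x # y # xs))) vs) ws) zs"

lemma pair_density_measurable:
  assumes "zs \<in> lists (space N)"
  shows "(\<lambda>(x, y). pair_density zs x y) \<in> borel_measurable (N \<Otimes>\<^sub>M N)"
proof -
  have [measurable]: "zs \<in> space (list_space N)"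
    using assms by (simp add: space_list_space)
  have [measurable]: "(\<lambda>p. ennreal (j (fst (fst p) # snd (fst p) # snd p))) \<in> borel_measurable ((N \<Otimes>\<^sub>M N) \<Otimes>\<^sub>M list_space N)"
    by (rule measurable_compose[OF _ j_measurable]) measurable
  show ?thesis
    unfolding pair_density_def case_prod_beta by measurable
qed

definition pair_count :: "'a set \<Rightarrow> 'a set \<Rightarrow> 'a multiset \<Rightarrow> ennreal" where
  "pair_count A B \<phi> = (\<Sum>x\<in>#\<phi>. \<Sum>y\<in>#\<phi>. if x \<noteq> y then indicator A x * indicator B y else 0)"

text \<open>Removing the diagonal from a rectangle must leave a measurable set. This is a property
  of the space, which holds for the Borel sets of the theorem and can fail for a general measurable
  space.\<close>

lemma pair_count_measurable:
  assumes diag: "{(x, y). x = y} \<inter> space (N \<Otimes>\<^sub>M N) \<in> sets (N \<Otimes>\<^sub>M N)"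
    and AB [measurable]: "A \<in> sets N" "B \<in> sets N"
  shows "pair_count A B \<in> borel_measurable (config_space N)"
proof -
  let ?W = "A \<times> B - ({(x, y). x = y} \<inter> space (N \<Otimes>\<^sub>M N))"
  have W: "?W \<in> sets (N \<Otimes>\<^sub>M N)"
    using diag by measurable
  have "(if x \<noteq> y then indicator A x * indicator B y else 0) = (indicator ?W (x, y) :: ennreal)" for x y
    using AB[THEN sets.sets_into_space] by (auto simp: indicator_def space_pair_measure)
  then have "pair_count A B = (\<lambda>\<phi>. \<Sum>x\<in>#\<phi>. \<Sum>y\<in>#\<phi>. indicator ?W (x, y))"
    unfolding pair_count_def by presburger
  then show ?thesis
    using sum_mset_pair_measurable[OF W] by simp
qed

text \<open>The density is set to 0 on the diagonal, since the reference measure may have atoms and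
  then charges the diagonal, whereas the count leaves out pairs with equal entries.\<close>

lemma post_int_pair_count:
  assumes diag: "{(x, y). x = y} \<inter> space (N \<Otimes>\<^sub>M N) \<in> sets (N \<Otimes>\<^sub>M N)"
    and AB [measurable]: "A \<in> sets N" "B \<in> sets N" and zs: "zs \<in> lists (space N)"
  shows "post_int (pair_count A B) zs =
    (\<integral>\<^sup>+ (x, y). (if x = y then 0 else pair_density zs x y) * indicator (A \<times> B) (x, y) \<partial>(N \<Otimes>\<^sub>M N))"
proof -
  let ?h = "\<lambda>x y. if x \<noteq> y then indicator A x * indicator B y else (0 :: ennreal)"
  have diag' [measurable]: "Measurable.pred (N \<Otimes>\<^sub>M N) (\<lambda>q. fst q = snd q)"
    using diag by (simp add: pred_def Int_def case_prod_beta conj_commute)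
  have h: "(\<lambda>(x, y). ?h x y) \<in> borel_measurable (N \<Otimes>\<^sub>M N)"
    unfolding case_prod_beta by measurable
  have [measurable]: "(\<lambda>q. pair_density zs (fst q) (snd q)) \<in> borel_measurable (N \<Otimes>\<^sub>M N)"
    using pair_density_measurable[OF zs] by (simp add: case_prod_beta)
  have sym: "symmetric_on (space N) (\<lambda>xs. ennreal (j xs))"
    using j_symmetric by (auto simp: symmetric_on_def)
  have "pair_count A B (mset xs) = (\<Sum>x\<leftarrow>xs. \<Sum>y\<leftarrow>xs. ?h x y)" for xs
    unfolding pair_count_def by (simp only: mset_map[symmetric] sum_mset_sum_list)
  then have "post_int (pair_count A B) zs = J (\<lambda>xs. (\<Sum>x\<leftarrow>xs. \<Sum>y\<leftarrow>xs. ?h x y) * ennreal (j xs)) zs"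
    by (simp only: post_int_def)
  also have "\<dots> = (\<integral>\<^sup>+ x. \<integral>\<^sup>+ y. ?h x y * pair_density zs x y \<partial>N \<partial>N)"
    unfolding pair_density_def by (rule J_pair_sum[OF h _ j_measurable sym zs]) simp
  also have "\<dots> = (\<integral>\<^sup>+ (x, y). ?h x y * pair_density zs x y \<partial>(N \<Otimes>\<^sub>M N))"
  proof -
    have "(\<lambda>(x, y). ?h x y * pair_density zs x y) \<in> borel_measurable (N \<Otimes>\<^sub>M N)"
      using h unfolding case_prod_beta by measurable
    from nn_integral_fst[OF this] show ?thesis
      by (simp only: prod.case)
  qed
  also have "\<dots> = (\<integral>\<^sup>+ (x, y). (if x = y then 0 else pair_density zs x y) * indicator (A \<times> B) (x, y) \<partial>(N \<Otimes>\<^sub>M N))"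
    by (intro nn_integral_cong) (auto simp: indicator_def)
  finally show ?thesis .
qed

text \<open>Division in \<open>ennreal\<close> is multiplication by the inverse, so it distributes
  over the sums for every value of \<open>j_Xi\<close>; the rest identifies positions with
  removals.\<close>

lemma posterior_density_eq:
  assumes zs: "zs \<in> lists (space N)" and x: "x \<in> space N" and y: "y \<in> space N"
  shows "ennreal ((1 - p)\<^sup>2) * l2 N p ld lc j zs {} x y
      + ennreal (1 - p) * (\<Sum>r<length zs. ennreal (p * ld (zs ! r) x + p * ld (zs ! r) y) * l2 N p ld lc j zs {r} x y)
      + (\<Sum>r<length zs. \<Sum>u\<in>{..<length zs} - {r}. ennreal (p * ld (zs ! r) x * (p * ld (zs ! u) y)) * l2 N p ld lc j zs {r, u} x y)
    = pair_density zs x y / j_Xi N p ld lc j zs"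
proof -
  let ?U = "\<lambda>ws. J (\<lambda>xs. ennreal (j (x # y # xs))) ws" and ?I = "inverse (j_Xi N p ld lc j zs)"
  have sub: "nths zs S \<in> lists (space N)" for S
    using zs set_nths_subset[of zs S] by auto
  have l2: "l2 N p ld lc j zs R x y = ?U (nths zs (- R)) * ?I" for R
    unfolding l2_def Upsilon2_eq_J[OF x y sub] by (rule divide_ennreal_def)
  have nn: "0 \<le> p * ld (zs ! r) x" "0 \<le> p * ld (zs ! r) y" if "r < length zs" for r
    using that zs x y p_pos by (auto intro!: mult_nonneg_nonneg ld_nonneg simp: in_lists_conv_set)
  have "ennreal ((1 - p)\<^sup>2) = ennreal (1 - p) ^ 2"
    using p_le_1 by (simp add: ennreal_power)
  moreover have "(\<Sum>r<length zs. ennreal (p * ld (zs ! r) x + p * ld (zs ! r) y) * l2 N p ld lc j zs {r} x y) =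
    removal_sum (\<lambda>w ws. (ennreal (p * ld w x) + ennreal (p * ld w y)) * ?U ws) zs * ?I"
    unfolding removal_sum_conv_nths sum_distrib_right
    by (intro sum.cong refl) (simp add: l2 nn ennreal_plus[symmetric] mult.assoc del: ennreal_plus)
  moreover have "(\<Sum>r<length zs. \<Sum>u\<in>{..<length zs} - {r}. ennreal (p * ld (zs ! r) x * (p * ld (zs ! u) y)) * l2 N p ld lc j zs {r, u} x y) =
    removal_sum (\<lambda>w ws. removal_sum (\<lambda>v vs. ennreal (p * ld w x) * ennreal (p * ld v y) * ?U vs) ws) zs * ?I"
    unfolding removal_sum_removal_sum_conv_nths sum_distrib_right
  proof (intro sum.cong refl)
    fix r u assume "r \<in> {..<length zs}" "u \<in> {..<length zs} - {r}"
    then have "ennreal (p * ld (zs ! r) x * (p * ld (zs ! u) y)) = ennreal (p * ld (zs ! r) x) * ennreal (p * ld (zs ! u) y)"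
      using nn by (intro ennreal_mult) auto
    then show "ennreal (p * ld (zs ! r) x * (p * ld (zs ! u) y)) * l2 N p ld lc j zs {r, u} x y =
        ennreal (p * ld (zs ! r) x) * ennreal (p * ld (zs ! u) y) * ?U (nths zs (- {r, u})) * ?I"
      by (simp only: l2 mult.assoc)
  qed
  ultimately show ?thesis
    by (simp add: pair_density_def l2 divide_ennreal_def distrib_right mult.assoc nths_all)
qed

end

theorem proposition3p3:
  fixes \<Lambda> :: "'a::euclidean_space set"
    and \<nu> N :: "'a measure"
    and M :: "'w measure"
    and \<Phi> \<Theta> C \<Xi> :: "'w \<Rightarrow> 'a multiset"
    and j :: "'a list \<Rightarrow> real"
    and p\<^sub>d q\<^sub>d :: real
    and l\<^sub>d :: "'a \<Rightarrow> 'a \<Rightarrow> real"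
    and l\<^sub>c :: "'a \<Rightarrow> real"
    and K :: "'a multiset \<Rightarrow> 'a multiset measure"
    and m :: nat
  assumes window: "\<Lambda> \<in> sets borel" "compact (closure \<Lambda>)"
    and radon: "sets \<nu> = sets borel" "\<And>A. compact A \<Longrightarrow> emeasure \<nu> A < \<infinity>"
    and N: "N = restrict_space \<nu> \<Lambda>"
    and prob: "prob_space M"
    and Phi: "\<Phi> \<in> measurable M (config_space N)"
      "AE \<omega> in M. simple_config (\<Phi> \<omega>)"
      "janossy_densities N (distr M (config_space N) \<Phi>) j"
    and detection: "0 < p\<^sub>d" "p\<^sub>d \<le> 1" "q\<^sub>d = 1 - p\<^sub>d"
    and displacement: "(\<lambda>(z, x). l\<^sub>d z x) \<in> borel_measurable (N \<Otimes>\<^sub>M N)"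
      "\<And>z x. z \<in> \<Lambda> \<Longrightarrow> x \<in> \<Lambda> \<Longrightarrow> 0 \<le> l\<^sub>d z x"
      "\<And>x. x \<in> \<Lambda> \<Longrightarrow> (\<integral>\<^sup>+ z. ennreal (l\<^sub>d z x) \<partial>N) = 1"
    and clutter_intensity: "integrable N l\<^sub>c" "\<And>z. z \<in> \<Lambda> \<Longrightarrow> 0 \<le> l\<^sub>c z"
    and detected: "\<Theta> \<in> measurable M (config_space N)"
      "regular_cond_distr M (config_space N) \<Phi> (config_space N) \<Theta> (obs_config N p\<^sub>d l\<^sub>d)"
    and clutter: "C \<in> measurable M (config_space N)"
      "poisson_process N l\<^sub>c (distr M (config_space N) C)"
      "prob_space.indep_set M
         (sets (vimage_algebra (space M) (\<lambda>\<omega>. (\<Phi> \<omega>, \<Theta> \<omega>)) (config_space N \<Otimes>\<^sub>M config_space N)))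
         (sets (vimage_algebra (space M) C (config_space N)))"
    and superposition: "\<And>\<omega>. \<omega> \<in> space M \<Longrightarrow> \<Xi> \<omega> = \<Theta> \<omega> + C \<omega>"
    and posterior: "regular_cond_distr M (config_space N) \<Xi> (config_space N) \<Phi> K"
  shows "AE z in PiM {..<m} (\<lambda>_. N).
    (let zs = map z [0..<m] in
      0 < j_Xi N p\<^sub>d l\<^sub>d l\<^sub>c j zs \<longrightarrow>
      second_factorial_density N (K (mset zs))
        (\<lambda>x y. if x = y then 0 else
           ennreal (q\<^sub>d\<^sup>2) * l2 N p\<^sub>d l\<^sub>d l\<^sub>c j zs {} x y
           + ennreal q\<^sub>d * (\<Sum>r<m. ennreal (p\<^sub>d * l\<^sub>d (zs ! r) x + p\<^sub>d * l\<^sub>d (zs ! r) y)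
                                   * l2 N p\<^sub>d l\<^sub>d l\<^sub>c j zs {r} x y)
           + (\<Sum>r<m. \<Sum>u\<in>{..<m} - {r}. ennreal (p\<^sub>d * l\<^sub>d (zs ! r) x * (p\<^sub>d * l\<^sub>d (zs ! u) y))
                                   * l2 N p\<^sub>d l\<^sub>d l\<^sub>c j zs {r, u} x y)))"
proof -
  have space_N: "space N = \<Lambda>"
    using sets_eq_imp_space_eq[OF radon(1)] by (simp add: N space_restrict_space)
  have sets_N: "sets N = sets (restrict_space borel \<Lambda>)"
    unfolding N using radon(1) by (simp add: sets_restrict_space)
  \<comment> \<open>The window lies in the compact set \<open>closure \<Lambda>\<close>, to which a
    Radon measure gives finite mass.\<close>
  have "finite_measure N"
  proof (rule finite_measureI)
    have "emeasure N (space N) = emeasure \<nu> \<Lambda>"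
      using window(1) radon(1) unfolding space_N N by (subst emeasure_restrict_space) auto
    also have "\<dots> \<le> emeasure \<nu> (closure \<Lambda>)"
      using radon(1) by (intro emeasure_mono closure_subset) auto
    also have "\<dots> < \<infinity>"
      by (rule radon(2)[OF window(2)])
    finally show "emeasure N (space N) \<noteq> \<infinity>" by simp
  qed
  then interpret measured_process N p\<^sub>d l\<^sub>d l\<^sub>c M \<Phi> \<Theta> C \<Xi> j
    using prob Phi detection displacement clutter_intensity detected clutter superposition
    by (intro measured_process.intro measurement.intro measurement_axioms.intro measured_process_axioms.intro)
       (simp_all add: space_N)
  obtain G :: "'a multiset set set" where G: "countable G" "Int_stable G" "G \<subseteq> Pow (space (config_space N))"
      "sets (config_space N) = sigma_sets (space (config_space N)) G"
    using countable_config_generator[OF sets_N window(1)] by metis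
  \<comment> \<open>The metric makes the diagonal measurable, as the zero set of the
    distance.\<close>
  have diag: "{(x, y). x = y} \<inter> space (N \<Otimes>\<^sub>M N) \<in> sets (N \<Otimes>\<^sub>M N)"
  proof -
    have id: "(\<lambda>x. x) \<in> borel_measurable N"
      using sets_N by (simp add: measurable_restrict_space1 cong: measurable_cong_sets)
    have "(\<lambda>q. dist (fst q) (snd q)) \<in> borel_measurable (N \<Otimes>\<^sub>M N)"
      using measurable_compose[OF measurable_fst id] measurable_compose[OF measurable_snd id]
      by (rule borel_measurable_dist)
    moreover have "{(x, y). x = y} = (\<lambda>q :: 'a \<times> 'a. dist (fst q) (snd q)) -` {0}"
      by auto
    ultimately show ?thesis
      by (simp add: measurable_sets)
  qed
  show ?thesis
    using posterior_law[OF posterior G, where m = m] AE_space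
  proof eventually_elim
    case (elim z)
    define zs where "zs = map z [0..<m]"
    let ?l = "j_Xi N p\<^sub>d l\<^sub>d l\<^sub>c j zs"
    have zs: "zs \<in> lists (space N)" and len: "length zs = m"
      using map_upt_in_lists[OF elim(2)] by (simp_all add: zs_def)
    note post = elim(1)[folded zs_def, folded j_Xi_eq_post_int[OF zs]]
    have "second_factorial_density N (K (mset zs))
        (\<lambda>x y. if x = y then 0 else
           ennreal (q\<^sub>d\<^sup>2) * l2 N p\<^sub>d l\<^sub>d l\<^sub>c j zs {} x y
           + ennreal q\<^sub>d * (\<Sum>r<m. ennreal (p\<^sub>d * l\<^sub>d (zs ! r) x + p\<^sub>d * l\<^sub>d (zs ! r) y)
                                   * l2 N p\<^sub>d l\<^sub>d l\<^sub>c j zs {r} x y)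
           + (\<Sum>r<m. \<Sum>u\<in>{..<m} - {r}. ennreal (p\<^sub>d * l\<^sub>d (zs ! r) x * (p\<^sub>d * l\<^sub>d (zs ! u) y))
                                   * l2 N p\<^sub>d l\<^sub>d l\<^sub>c j zs {r, u} x y))"
      (is "second_factorial_density _ _ ?\<rho>") if pos: "0 < ?l"
    proof -
      \<comment> \<open>The identity is available inside the window only, where the displacement
        density is nonnegative; measurability and integrals are transferred from
        \<open>pair_density\<close> by congruence.\<close>
      have \<rho>: "?\<rho> x y = (if x = y then 0 else pair_density zs x y) / ?l" if "x \<in> space N" "y \<in> space N" for x y
        using posterior_density_eq[OF zs that] unfolding len detection(3) by simp
      have diag' [measurable]: "Measurable.pred (N \<Otimes>\<^sub>M N) (\<lambda>q. fst q = snd q)"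
        using diag by (simp add: pred_def Int_def case_prod_beta conj_commute)
      have [measurable]: "(\<lambda>q. pair_density zs (fst q) (snd q)) \<in> borel_measurable (N \<Otimes>\<^sub>M N)"
        using pair_density_measurable[OF zs] by (simp add: case_prod_beta)
      let ?d = "\<lambda>q. if fst q = snd q then 0 else pair_density zs (fst q) (snd q)"
      have d: "?d \<in> borel_measurable (N \<Otimes>\<^sub>M N)"
        by measurable
      have \<rho>': "?\<rho> (fst q) (snd q) = ?d q / ?l" if "q \<in> space (N \<Otimes>\<^sub>M N)" for q
        using that by (intro \<rho>) (auto simp: space_pair_measure)
      show ?thesis
        unfolding second_factorial_density_def
      proof (intro conjI ballI)
        show "(\<lambda>(x, y). ?\<rho> x y) \<in> borel_measurable (N \<Otimes>\<^sub>M N)"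
          unfolding case_prod_beta using d by (subst measurable_cong[OF \<rho>']) auto
        fix A B assume AB [measurable]: "A \<in> sets N" "B \<in> sets N"
        note [measurable] = d
        have "(\<integral>\<^sup>+ \<phi>. pair_count A B \<phi> \<partial>K (mset zs)) * ?l = post_int (pair_count A B) zs"
          using post pair_count_measurable[OF diag AB] by blast
        also have "\<dots> = (\<integral>\<^sup>+ q. ?d q * indicator (A \<times> B) q \<partial>(N \<Otimes>\<^sub>M N))"
          unfolding post_int_pair_count[OF diag AB zs] by (simp only: case_prod_unfold prod.collapse)
        \<comment> \<open>Division by \<open>j_Xi\<close> is legitimate here: it is positive by the
          case assumption, and finite outside the null set of \<open>posterior_law\<close>.\<close>
        finally have "(\<integral>\<^sup>+ \<phi>. pair_count A B \<phi> \<partial>K (mset zs)) =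
            (\<integral>\<^sup>+ q. ?d q * indicator (A \<times> B) q \<partial>(N \<Otimes>\<^sub>M N)) / ?l"
          using pos post by (metis ennreal_mult_divide_eq mult.commute not_gr_zero)
        also have "\<dots> = (\<integral>\<^sup>+ q. ?d q * indicator (A \<times> B) q / ?l \<partial>(N \<Otimes>\<^sub>M N))"
          by (rule nn_integral_divide[symmetric]) measurable
        also have "\<dots> = (\<integral>\<^sup>+ q. ?\<rho> (fst q) (snd q) * indicator (A \<times> B) q \<partial>(N \<Otimes>\<^sub>M N))"
        proof (rule nn_integral_cong)
          fix q assume q: "q \<in> space (N \<Otimes>\<^sub>M N)"
          show "?d q * indicator (A \<times> B) q / ?l = ?\<rho> (fst q) (snd q) * indicator (A \<times> B) q"
            unfolding \<rho>'[OF q] divide_ennreal_def by (simp only: mult_ac)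
        qed
        finally show "(\<integral>\<^sup>+ \<phi>. (\<Sum>x\<in>#\<phi>. \<Sum>y\<in>#\<phi>. if x \<noteq> y then indicator A x * indicator B y else 0) \<partial>K (mset zs)) =
            (\<integral>\<^sup>+ (x, y). ?\<rho> x y * indicator (A \<times> B) (x, y) \<partial>(N \<Otimes>\<^sub>M N))"
          by (simp only: pair_count_def case_prod_unfold prod.collapse)
      qed
    qed
    then show ?case
      by (simp only: Let_def zs_def[symmetric] simp_thms) simp
  qed
qed

end
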